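(* Let $n$ be a positive integer, let $c=3n$ and let $p=\omega\left(\frac{\log n}{n}\right)$. Then w.h.p. a random edge-colored graph $G\sim\mathcal G_c(K_{n,n},p)$ contains at least $t=(1-o(1))\frac{np}{6}$ edge-disjoint rainbow perfect matchings.
   Context: Asymptotic notation is as $n\to\infty$; $p=p(n)\in[0,1]$; $p=\omega(\log n/n)$ means $pn/\log n\to\infty$. "W.h.p." means with probability tending to $1$ as $n\to\infty$. $K_{n,n}$ is the complete bipartite graph with both parts of size $n$. For a graph $F$, $p\in[0,1]$ and a positive integer $c$, $\mathcal G_c(F,p)$ is the probability space of edge-colored graphs obtained by keeping each edge of $F$ independently with probability $p$ and then coloring each kept edge independently and uniformly at random with a color from $[c]=\{1,\dots,c\}$. A subgraph is rainbow if all of its edges have distinct colors. *)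

theory Defs
  imports "HOL-Probability.Probability" "HOL-Probability.Product_PMF"
begin

text \<open>A graph is a pair of its vertex set and its set of edges, an edge being the set of its two
  endpoints. In an edge-colored graph, the edge set is the domain of the coloring.\<close>

type_synonym 'v graph = "'v set \<times> 'v set set"
type_synonym 'v colored_graph = "'v set \<times> ('v set \<rightharpoonup> nat)"

definition complete_bipartite :: "nat \<Rightarrow> nat \<Rightarrow> (nat + nat) graph" where
  "complete_bipartite m n =
     (Inl ` {1..m} \<union> Inr ` {1..n}, {{Inl i, Inr j} | i j. i \<in> {1..m} \<and> j \<in> {1..n}})"

text \<open>The edge set of \<open>F\<close> is meant to be finite, and \<open>c\<close> to be positive.\<close>

definition random_colored_graph :: "nat \<Rightarrow> 'v graph \<Rightarrow> real \<Rightarrow> 'v colored_graph pmf" where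
  "random_colored_graph c F p =
     bind_pmf (Pi_pmf (snd F) False (\<lambda>_. bernoulli_pmf p)) (\<lambda>kept.
     map_pmf (Pair (fst F))
       (Pi_pmf {e \<in> snd F. kept e} None (\<lambda>_. map_pmf Some (pmf_of_set {1..c}))))"

definition perfect_matching :: "'v graph \<Rightarrow> 'v set set \<Rightarrow> bool" where
  "perfect_matching F M \<longleftrightarrow> M \<subseteq> snd F \<and> (\<forall>v \<in> fst F. \<exists>!e. e \<in> M \<and> v \<in> e)"

definition underlying_graph :: "'v colored_graph \<Rightarrow> 'v graph" where
  "underlying_graph G = (fst G, dom (snd G))"

definition rainbow :: "'v colored_graph \<Rightarrow> 'v set set \<Rightarrow> bool" where
  "rainbow G M \<longleftrightarrow> inj_on (snd G) M"

text \<open>The bound \<open>t\<close> is real, so that it need not be rounded.\<close>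

definition has_disjoint_rainbow_perfect_matchings :: "'v colored_graph \<Rightarrow> real \<Rightarrow> bool" where
  "has_disjoint_rainbow_perfect_matchings G t \<longleftrightarrow>
     (\<exists>\<M>. finite \<M> \<and> t \<le> real (card \<M>) \<and> disjoint \<M> \<and>
       (\<forall>M \<in> \<M>. perfect_matching (underlying_graph G) M \<and> rainbow G M))"

end

theory Submission
  imports Defs "HOL-Real_Asymp.Real_Asymp"
begin

text \<open>
  Write \<open>d = n p\<close> and reserve the colors \<open>1, \<dots>, 3n/5\<close>. From the edges with unreserved colors, choose
  successively \<open>\<lceil>d/6\<rceil>\<close> edge-disjoint rainbow matchings of maximal size. The earlier matchings use up at
  most \<open>d/6\<close> of the about \<open>d\<close> edges at a vertex, so augmenting paths of length three show that each matching
  misses only \<open>o(n)\<close> vertices. The matchings depend on the unreserved edges alone; hence the reserved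
  edges are still random with respect to the sets of uncovered vertices, and no vertex has many reserved
  neighbors there.

  The matchings are then completed one after the other. The uncovered vertices are paired up as
  \<open>(x\<^sub>i, y\<^sub>i)\<close>, and each pair is to be connected by an alternating path: rainbow trees of reserved edges
  grow from \<open>x\<^sub>i\<close> and from \<open>y\<^sub>i\<close> to linear size, and are then joined by two edges with unused unreserved
  colors. All pairs can be served at once, by paths without common vertices or colors, because of Haxell's
  version of Hall's theorem for hypergraphs: few vertices and colors obstruct the growth of the trees at
  even fewer vertices.
\<close>

section \<open>Haxell's theorem\<close>

text \<open>The order n / ln n of \<open>slack n\<close> is forced from both sides. The union bound
  behind \<open>many_between\<close> runs over 2^(5n) triples of sets, which a deviation of order d
  * \<open>slack n\<close> outweighs because d is a large multiple of ln n. On the other side each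
  missed vertex needs a path of up to 4 ln n edges, and all these paths together must touch only a
  small fraction of the n matching edges and of the colors. The room for the proof is the gap
  between d/5 and d/6. A vertex has about d/5 reserved edges, and 9n/20 vertices with 27n/20 colors
  attract a share of 9/20 * 9/20 > 1/5 of the edges; either must exceed the d/6 edges lost to other
  matchings. Yet the maximal matchings and the perfect ones made from them might take d/3 at a
  vertex. Two facts save the count: the maximal ones have no reserved colors, and a perfect one
  differs from its origin in so few edges that sets of linear size hardly notice. For an augmenting
  path of length three, 11n/20 vertices are reached from each side, more than half, so that some
  matching edge joins the two sets.\<close>

lemma lex_map_upt:
  fixes f f' :: "nat \<Rightarrow> nat"
  assumes "l < N" and eq: "\<And>j. j < l \<Longrightarrow> f' j = f j" and "f' l < f l"
  shows "(map f' [0..<N], map f [0..<N]) \<in> lex less_than"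
proof -
  have split: "[0..<N] = [0..<l] @ l # [Suc l..<N]"
    using assms(1) by (metis le0 less_imp_le_nat upt_add_eq_append upt_conv_Cons le_add_diff_inverse)
  have pre: "map f' [0..<l] = map f [0..<l]"
    using eq by simp
  show ?thesis
    unfolding lex_conv split map_append list.map pre using assms(3) by auto
qed

text \<open>
  Extends a disjoint transversal \<open>g\<close> of the indices \<open>I\<close> by an index \<open>i0\<close>. The sets \<open>e 0, \<dots>, e k\<close> form
  an alternating tree: \<open>e j\<close> belongs to \<open>i0\<close> or to an index whose current set meets an earlier \<open>e l\<close>. A new
  set can be appended as long as \<open>e k\<close> meets some set of \<open>g\<close>; otherwise \<open>e k\<close> replaces the set of its index,
  which frees an earlier \<open>e l\<close>. Both steps decrease lexicographically the sequence of the numbers of sets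
  met by \<open>e 0, e 1, \<dots>\<close>, padded by a large number.
\<close>

lemma disjoint_transversal_extend:
  fixes F :: "'i \<Rightarrow> 'a set set" and g :: "'i \<Rightarrow> 'a set" and ix :: "nat \<Rightarrow> 'i" and e :: "nat \<Rightarrow> 'a set"
  defines "B \<equiv> \<lambda>I (g :: 'i \<Rightarrow> 'a set) e. {i \<in> I. g i \<inter> e \<noteq> {}}"
  assumes "finite I" "i0 \<notin> I"
    and free: "\<And>J \<Z>. J \<subseteq> insert i0 I \<Longrightarrow> J \<noteq> {} \<Longrightarrow> finite \<Z> \<Longrightarrow> \<Z> \<subseteq> (\<Union>i\<in>insert i0 I. F i) \<Longrightarrow>
      card \<Z> \<le> 2 * (card J - 1) \<Longrightarrow> \<exists>i\<in>J. \<exists>e\<in>F i. e \<inter> \<Union>\<Z> = {}"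
    and "\<forall>i\<in>I. g i \<in> F i" "\<forall>i\<in>I. \<forall>j\<in>I. i \<noteq> j \<longrightarrow> g i \<inter> g j = {}"
    and "\<forall>j\<le>k. ix j \<in> insert i0 (\<Union>l<j. B I g (e l)) \<and> e j \<in> F (ix j) \<and>
      (\<forall>l<j. e j \<inter> e l = {} \<and> (\<forall>i\<in>B I g (e l). e j \<inter> g i = {}))"
    and "\<forall>j<k. B I g (e j) \<noteq> {}"
  shows "\<exists>h. (\<forall>i\<in>insert i0 I. h i \<in> F i) \<and> (\<forall>i\<in>insert i0 I. \<forall>j\<in>insert i0 I. i \<noteq> j \<longrightarrow> h i \<inter> h j = {})"
  using assms(5-8)
\<comment> \<open>\<open>lex\<close> relates only lists of equal length and is well-founded for that
  reason; this is why the sequence is padded to a fixed length.\<close>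
proof (induction "map (\<lambda>j. if j \<le> k then card (B I g (e j)) else Suc (card I)) [0..<Suc (card I)]"
    arbitrary: g ix e k rule: wf_induct_rule[OF wf_lex[OF wf_less_than]])
  case (1 g e k ix)
  note gF = "1.prems"(1) and gd = "1.prems"(2) and tree = "1.prems"(3) and ne = "1.prems"(4)
  let ?B = "\<lambda>j. B I g (e j)"
  have finB: "finite (?B j)" for j
    using \<open>finite I\<close> by (simp add: B_def)
  have disjB: "?B j \<inter> ?B l = {}" if "j \<le> k" "l < j" for j l
    using tree that by (fastforce simp: B_def)
  have card_Un: "card (\<Union>l<m. ?B l) = (\<Sum>l<m. card (?B l))" if "m \<le> Suc k" for m
    using that disjB by (intro card_UN_disjoint) (auto simp: finB, (metis Int_iff empty_iff less_Suc_eq_le linorder_neqE_nat order_less_le_trans)+)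
  have ge: "m \<le> (\<Sum>l<m. card (?B l))" if "\<forall>l<m. ?B l \<noteq> {}" for m
  proof -
    have "(\<Sum>l<m. 1) \<le> (\<Sum>l<m. card (?B l))"
      using that finB by (intro sum_mono) (simp add: Suc_le_eq card_gt_0_iff)
    then show ?thesis by simp
  qed
  have le: "card (\<Union>l<m. ?B l) \<le> card I" for m
    using \<open>finite I\<close> by (intro card_mono) (auto simp: B_def)
  show ?case
  proof (cases "?B k = {}")
    case False
    let ?U = "\<Union>l<Suc k. ?B l"
    let ?J = "insert i0 ?U" and ?Z = "e ` {..<Suc k} \<union> g ` ?U"
    have ne': "\<forall>l<Suc k. ?B l \<noteq> {}"
      using ne False less_Suc_eq by auto
    have finU: "finite ?U" using finB by auto
    have i0U: "i0 \<notin> ?U" using \<open>i0 \<notin> I\<close> by (auto simp: B_def)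
    \<comment> \<open>The blocking sets \<open>?B l\<close> are nonempty and pairwise disjoint, so
      there are at least as many blockers as tree sets, and both together number at most twice the
      blockers. This is the origin of the factor 2 in \<open>free\<close>.\<close>
    have "card ?Z \<le> Suc k + card ?U"
      using card_Un_le[of "e ` {..<Suc k}" "g ` ?U"] card_image_le[OF finU, of g] card_image_le[of "{..<Suc k}" e]
      by simp
    also have "\<dots> \<le> 2 * card ?U" using ge[OF ne'] card_Un[of "Suc k"] by simp
    also have "\<dots> = 2 * (card ?J - 1)" using finU i0U by simp
    finally have cZ: "card ?Z \<le> 2 * (card ?J - 1)" .
    have Zsub: "?Z \<subseteq> (\<Union>i\<in>insert i0 I. F i)"
    proof -
      have "e l \<in> (\<Union>i\<in>insert i0 I. F i)" if "l < Suc k" for l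
        using tree[rule_format, of l] that by (auto simp: B_def)
      then show ?thesis using gF by (auto simp: B_def)
    qed
    have "\<exists>i\<in>?J. \<exists>x\<in>F i. x \<inter> \<Union>?Z = {}"
      by (rule free[OF _ _ _ Zsub cZ]) (use finU in \<open>auto simp: B_def\<close>)
    then obtain i x where ix: "i \<in> ?J" "x \<in> F i" "x \<inter> \<Union>?Z = {}" by blast
    \<comment> \<open>The disjoint blockers are drawn from \<open>I\<close>, so the appended entry
      still has a position in the list.\<close>
    have kN: "Suc k \<le> card I" using ge[OF ne'] card_Un[of "Suc k"] le[of "Suc k"] by simp
    show ?thesis
    proof (rule "1.hyps"[of "Suc k" g "e(Suc k := x)" "ix(Suc k := i)"])
      show "(map (\<lambda>j. if j \<le> Suc k then card (B I g ((e(Suc k := x)) j)) else Suc (card I)) [0..<Suc (card I)],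
        map (\<lambda>j. if j \<le> k then card (B I g (e j)) else Suc (card I)) [0..<Suc (card I)]) \<in> lex less_than"
      proof (rule lex_map_upt[of "Suc k"])
        have "card (B I g x) \<le> card I" using \<open>finite I\<close> by (intro card_mono) (auto simp: B_def)
        then show "(if Suc k \<le> Suc k then card (B I g ((e(Suc k := x)) (Suc k))) else Suc (card I))
          < (if Suc k \<le> k then card (B I g (e (Suc k))) else Suc (card I))" by simp
      qed (use kN in auto)
      have [simp]: "(\<Union>l<j. B I g (if l = Suc k then x else e l)) = (\<Union>l<j. B I g (e l))" if "j \<le> Suc k" for j
        using that by auto
      show "\<forall>j\<le>Suc k. (ix(Suc k := i)) j \<in> insert i0 (\<Union>l<j. B I g ((e(Suc k := x)) l)) \<and>
        (e(Suc k := x)) j \<in> F ((ix(Suc k := i)) j) \<and> (\<forall>l<j. (e(Suc k := x)) j \<inter> (e(Suc k := x)) l = {} \<and>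
        (\<forall>i\<in>B I g ((e(Suc k := x)) l). (e(Suc k := x)) j \<inter> g i = {}))"
        using tree ix by (auto simp: le_Suc_eq)
      show "\<forall>j<Suc k. B I g ((e(Suc k := x)) j) \<noteq> {}" using ne' by auto
    qed (use gF gd in auto)
  next
    case True
    show ?thesis
    proof (cases "ix k = i0")
      case eq: True
      have "e k \<in> F i0" using tree eq by auto
      moreover have "\<forall>i\<in>I. g i \<inter> e k = {}" using True by (auto simp: B_def)
      ultimately show ?thesis
        using gF gd \<open>i0 \<notin> I\<close> by (intro exI[of _ "g(i0 := e k)"]) (auto simp: Int_commute)
    next
      case False
      then obtain l where l: "l < k" "ix k \<in> ?B l" using tree by blast
      let ?i = "ix k"
      let ?g = "g(?i := e k)"
      have iI: "?i \<in> I" using l by (auto simp: B_def)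
      have eF: "e k \<in> F ?i" using tree by auto
      have free_k: "\<forall>i\<in>I. g i \<inter> e k = {}" using True by (auto simp: B_def)
      have el: "e k \<inter> e j = {}" if "j < k" for j using tree that by auto
      have same: "B I ?g (e j) = ?B j" if "j < l" for j
        using disjB[of l j] l that el[of j] by (auto simp: B_def split: if_splits)
      \<comment> \<open>The new set of index \<open>?i\<close> is \<open>e k\<close>, which is
        disjoint from \<open>e l\<close>; thus \<open>?i\<close> stops blocking \<open>e l\<close>
        and no other index starts to.\<close>
      have less: "B I ?g (e l) = ?B l - {?i}"
        using el[of l] l by (auto simp: B_def split: if_splits)
      have lN: "l < Suc (card I)"
        using ge[of k] ne card_Un[of k] le[of k] l by simp
      show ?thesis
      proof (rule "1.hyps"[of l ?g e ix])
        show "(map (\<lambda>j. if j \<le> l then card (B I ?g (e j)) else Suc (card I)) [0..<Suc (card I)],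
          map (\<lambda>j. if j \<le> k then card (B I g (e j)) else Suc (card I)) [0..<Suc (card I)]) \<in> lex less_than"
        proof (rule lex_map_upt[OF lN])
          show "(if l \<le> l then card (B I ?g (e l)) else Suc (card I)) < (if l \<le> k then card (?B l) else Suc (card I))"
            unfolding less using l card_Diff1_less[OF finB, of ?i l] by simp
        qed (use l same in auto)
        show "\<forall>j\<le>l. ix j \<in> insert i0 (\<Union>m<j. B I ?g (e m)) \<and> e j \<in> F (ix j) \<and>
          (\<forall>m<j. e j \<inter> e m = {} \<and> (\<forall>i\<in>B I ?g (e m). e j \<inter> ?g i = {}))"
        proof (intro allI impI)
          fix j assume j: "j \<le> l"
          have U: "(\<Union>m<j. B I ?g (e m)) = (\<Union>m<j. B I g (e m))" using same j by auto
          have "e j \<inter> ?g i = {}" if "m < j" "i \<in> B I ?g (e m)" for m i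
            using that tree l j same[of m] el[of j] by (auto simp: Int_commute)
          then show "ix j \<in> insert i0 (\<Union>m<j. B I ?g (e m)) \<and> e j \<in> F (ix j) \<and>
            (\<forall>m<j. e j \<inter> e m = {} \<and> (\<forall>i\<in>B I ?g (e m). e j \<inter> ?g i = {}))"
            unfolding U using tree l j by auto
        qed
        show "\<forall>j<l. B I ?g (e j) \<noteq> {}" using same ne l by auto
        show "\<forall>i\<in>I. ?g i \<in> F i" using gF eF by auto
        show "\<forall>i\<in>I. \<forall>j\<in>I. i \<noteq> j \<longrightarrow> ?g i \<inter> ?g j = {}" using gd free_k by (auto simp: Int_commute)
      qed
    qed
  qed
qed

text \<open>This is Haxell's criterion for independent transversals, applied to the graph whose
  vertices are the sets and whose edges join intersecting sets: 2 (|J| - 1) vertices never dominate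
  the classes in \<open>J\<close>. Indices are added one at a time, each starting from a tree with a
  single set.\<close>

lemma disjoint_transversal:
  fixes F :: "'i \<Rightarrow> 'a set set"
  assumes "finite I"
    and "\<And>J \<Z>. J \<subseteq> I \<Longrightarrow> J \<noteq> {} \<Longrightarrow> finite \<Z> \<Longrightarrow> \<Z> \<subseteq> (\<Union>i\<in>I. F i) \<Longrightarrow>
      card \<Z> \<le> 2 * (card J - 1) \<Longrightarrow> \<exists>i\<in>J. \<exists>e\<in>F i. e \<inter> \<Union>\<Z> = {}"
  shows "\<exists>h. (\<forall>i\<in>I. h i \<in> F i) \<and> (\<forall>i\<in>I. \<forall>j\<in>I. i \<noteq> j \<longrightarrow> h i \<inter> h j = {})"
  using assms
proof (induction I)
  case empty
  then show ?case by auto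
next
  case (insert i0 I)
  have "\<exists>h. (\<forall>i\<in>I. h i \<in> F i) \<and> (\<forall>i\<in>I. \<forall>j\<in>I. i \<noteq> j \<longrightarrow> h i \<inter> h j = {})"
  proof (rule insert.IH)
    fix J \<Z>
    assume J: "J \<subseteq> I" "J \<noteq> {}" "finite \<Z>" "\<Z> \<subseteq> (\<Union>i\<in>I. F i)" "card \<Z> \<le> 2 * (card J - 1)"
    show "\<exists>i\<in>J. \<exists>e\<in>F i. e \<inter> \<Union>\<Z> = {}"
      by (rule insert.prems[OF _ J(2,3) _ J(5)]) (use J(1,4) in auto)
  qed
  then obtain g where "(\<forall>i\<in>I. g i \<in> F i) \<and> (\<forall>i\<in>I. \<forall>j\<in>I. i \<noteq> j \<longrightarrow> g i \<inter> g j = {})" ..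
  note g = conjunct1[OF this] conjunct2[OF this]
  have "\<exists>i\<in>{i0}. \<exists>e\<in>F i. e \<inter> \<Union>{} = {}" by (rule insert.prems) simp_all
  then obtain x where x: "x \<in> F i0" by blast
  show ?case
  proof (rule disjoint_transversal_extend[where k = 0 and ix = "\<lambda>_. i0" and e = "\<lambda>_. x" and g = g, OF insert.hyps(1,2)])
    fix J \<Z>
    assume "J \<subseteq> insert i0 I" "J \<noteq> {}" "finite \<Z>" "\<Z> \<subseteq> (\<Union>i\<in>insert i0 I. F i)" "card \<Z> \<le> 2 * (card J - 1)"
    then show "\<exists>i\<in>J. \<exists>e\<in>F i. e \<inter> \<Union>\<Z> = {}" by (rule insert.prems)
  qed (use g x in simp_all)
qed

section \<open>Quasirandom edge colorings\<close>

definition hits :: "(nat \<times> nat \<Rightarrow> nat option) \<Rightarrow> nat set \<Rightarrow> nat set \<Rightarrow> nat set \<Rightarrow> (nat \<times> nat) set" where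
  "hits \<omega> A B C = {e \<in> A \<times> B. \<omega> e \<in> Some ` C}"

text \<open>The number of vertices that a maximal rainbow matching may miss on each side.\<close>

definition slack :: "nat \<Rightarrow> real" where
  "slack n = real n / (1000000000000 * ln (real n))"

text \<open>
  A partial coloring \<open>\<omega>\<close> of the pairs stands for the random graph. Every condition is required for one
  orientation only, and used for \<open>\<omega>\<close> and \<open>\<omega> \<circ> prod.swap\<close>. The reserved colors give each vertex a degree of about
  \<open>d/5 > d/6\<close>, so that they cannot be used up by \<open>d/6\<close> matchings, and leave \<open>7n/5\<close> unreserved colors
  unused by a single matching.
\<close>

locale quasirandom =
  fixes n :: nat and d :: real and \<omega> :: "nat \<times> nat \<Rightarrow> nat option"
  assumes n_large: "1000000000000000 \<le> real n" and ln_large: "100 \<le> ln (real n)" and d_large: "1000000 \<le> d"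
    and few_between: "\<And>A B. A \<subseteq> {1..n} \<Longrightarrow> B \<subseteq> {1..n} \<Longrightarrow> A \<noteq> {} \<Longrightarrow>
      real (card B) \<le> 40 * real (card A) * ln (real n) \<Longrightarrow> real (card B) \<le> real n / 100000000 \<Longrightarrow>
      real (card (hits \<omega> A B {1..3 * n})) < d * real (card A) / 1000"
    and few_colored: "\<And>A C. A \<subseteq> {1..n} \<Longrightarrow> C \<subseteq> {1..3 * n} \<Longrightarrow> A \<noteq> {} \<Longrightarrow>
      real (card C) \<le> 40 * real (card A) * ln (real n) \<Longrightarrow> real (card C) \<le> real n / 100000000 \<Longrightarrow>
      real (card (hits \<omega> A {1..n} C)) < d * real (card A) / 1000"
    and many_between: "\<And>A B C. A \<subseteq> {1..n} \<Longrightarrow> B \<subseteq> {1..n} \<Longrightarrow> C \<subseteq> {1..3 * n} \<Longrightarrow>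
      slack n \<le> real (card A) \<Longrightarrow> 9 / 20 * real n \<le> real (card B) \<Longrightarrow> 27 / 20 * real n \<le> real (card C) \<Longrightarrow>
      18 / 100 * d * real (card A) \<le> real (card (hits \<omega> A B C))"
    and few_monochromatic: "\<And>y c. y \<in> {1..n} \<Longrightarrow> c \<in> {1..3 * n} \<Longrightarrow>
      real (card (hits \<omega> {1..n} {y} {c})) \<le> d / (200000000000000 * ln (real n))"
    and reserved_degree: "\<And>x. x \<in> {1..n} \<Longrightarrow> 19 / 100 * d \<le> real (card (hits \<omega> {x} {1..n} {1..3 * n div 5}))"
begin

lemma n_pos: "0 < n" using n_large by (cases n) auto

lemma d_pos: "0 < d" using d_large by linarith

lemma slack_pos: "0 < slack n"
proof -
  have "0 < ln (real n)" using ln_large by linarith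
  then show ?thesis unfolding slack_def using n_pos by (intro divide_pos_pos mult_pos_pos) simp_all
qed

lemma finite_hits: "finite A \<Longrightarrow> finite B \<Longrightarrow> finite (hits \<omega> A B C)"
  by (simp add: hits_def)

text \<open>Otherwise the vertices outside of \<open>?Y\<close> number 9n/20 and receive 18/100 d
  |A| edges. At such a vertex all edges outside of \<open>H\<close> with colors in \<open>C\<close>
  share one color, so \<open>few_monochromatic\<close> applies; its bound is chosen such that n
  vertices contribute at most d/200 * \<open>slack n\<close>. With the 17/100 d |A| edges in
  \<open>H\<close> this gives only 175/1000 d |A|.\<close>

lemma card_twice_reached:
  assumes A: "A \<subseteq> {1..n}" "slack n \<le> real (card A)"
    and C: "C \<subseteq> {1..3 * n}" "27 / 20 * real n \<le> real (card C)"
    and H: "real (card (H \<inter> A \<times> {1..n})) \<le> 17 / 100 * d * real (card A)"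
  shows "11 / 20 * real n \<le> real (card {y \<in> {1..n}. \<exists>a\<in>A. \<exists>a'\<in>A. \<exists>c\<in>C. \<exists>c'\<in>C. c \<noteq> c' \<and>
    \<omega> (a, y) = Some c \<and> \<omega> (a', y) = Some c' \<and> (a, y) \<notin> H \<and> (a', y) \<notin> H})"
    (is "_ \<le> real (card ?Y)")
proof (rule ccontr)
  assume neg: "\<not> ?thesis"
  define B where "B = {1..n} - ?Y"
  have finA: "finite A" using A finite_subset by blast
  have Y: "?Y \<subseteq> {1..n}" by auto
  have cB: "card B = n - card ?Y"
    unfolding B_def using card_Diff_subset[OF finite_subset[OF Y] Y] by simp
  have "card ?Y \<le> n" using card_mono[OF _ Y] by simp
  with cB neg have B: "9 / 20 * real n \<le> real (card B)" by (simp add: of_nat_diff)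
  have lower: "18 / 100 * d * real (card A) \<le> real (card (hits \<omega> A B C))"
    by (rule many_between) (use A C B in \<open>auto simp: B_def\<close>)
  define S where "S y = hits \<omega> A {y} C - H" for y
  let ?m = "d / (200000000000000 * ln (real n))"
  have m0: "0 \<le> ?m" using d_large ln_large by simp
  have S: "real (card (S y)) \<le> ?m" if y: "y \<in> B" for y
  proof (cases "S y = {}")
    case True
    then show ?thesis using m0 by simp
  next
    case False
    then obtain a c where ac: "a \<in> A" "c \<in> C" "\<omega> (a, y) = Some c" "(a, y) \<notin> H"
      by (auto simp: S_def hits_def)
    have "S y \<subseteq> hits \<omega> {1..n} {y} {c}"
    proof
      fix e assume e: "e \<in> S y"
      then obtain a' c' where a': "e = (a', y)" "a' \<in> A" "c' \<in> C" "\<omega> (a', y) = Some c'" "(a', y) \<notin> H"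
        by (auto simp: S_def hits_def)
      have "c' = c"
        using y ac a' unfolding B_def by blast
      with a' A show "e \<in> hits \<omega> {1..n} {y} {c}" by (auto simp: hits_def)
    qed
    then have "card (S y) \<le> card (hits \<omega> {1..n} {y} {c})"
      by (intro card_mono finite_hits) auto
    moreover have "real (card (hits \<omega> {1..n} {y} {c})) \<le> ?m"
      by (rule few_monochromatic) (use ac C y in \<open>auto simp: B_def\<close>)
    ultimately show ?thesis by simp
  qed
  have scale: "x * (d / (200 * c)) = d / 200 * (x / c)" for x c :: real by simp
  have "hits \<omega> A B C \<subseteq> (H \<inter> A \<times> {1..n}) \<union> (\<Union>y\<in>B. S y)"
    by (auto simp: hits_def S_def B_def)
  moreover have "finite (H \<inter> A \<times> {1..n})" "finite B" "finite (\<Union>y\<in>B. S y)"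
    using finA by (auto simp: B_def S_def finite_hits)
  ultimately have "card (hits \<omega> A B C) \<le> card (H \<inter> A \<times> {1..n}) + card (\<Union>y\<in>B. S y)"
    by (meson card_Un_le card_mono finite_UnI order_trans)
  also have "card (\<Union>y\<in>B. S y) \<le> (\<Sum>y\<in>B. card (S y))"
    by (rule card_UN_le) (simp add: B_def)
  finally have "card (hits \<omega> A B C) \<le> card (H \<inter> A \<times> {1..n}) + (\<Sum>y\<in>B. card (S y))" by simp
  from of_nat_mono[OF this, where ?'a = real]
  have "real (card (hits \<omega> A B C)) \<le> real (card (H \<inter> A \<times> {1..n})) + (\<Sum>y\<in>B. real (card (S y)))"
    by simp
  also have "(\<Sum>y\<in>B. real (card (S y))) \<le> real (card B) * ?m"
    using S by (rule sum_bounded_above)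
  also have "real (card B) * ?m \<le> real n * ?m"
    using cB m0 by (intro mult_right_mono) auto
  also have "real n * ?m = d / 200 * slack n"
    unfolding slack_def using scale[of "real n" "1000000000000 * ln (real n)"] by (simp only: mult.assoc[symmetric])
  also have "d / 200 * slack n \<le> d / 200 * real (card A)"
    by (rule mult_left_mono[OF A(2)]) (use d_pos in simp)
  finally have "real (card (hits \<omega> A B C)) \<le> real (card (H \<inter> A \<times> {1..n})) + d / 200 * real (card A)"
    by linarith
  with H have "real (card (hits \<omega> A B C)) \<le> 175 / 1000 * (d * real (card A))"
    by linarith
  moreover have "0 < d * real (card A)"
    by (rule mult_pos_pos) (use d_pos slack_pos A(2) in linarith)+
  ultimately show False using lower by linarith
qed

end

section \<open>Near-perfect rainbow matchings by augmentation\<close>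

lemma card_hits_swap:
  "card (hits (\<omega> \<circ> prod.swap) A B C) = card (hits \<omega> B A C)"
proof -
  have "hits (\<omega> \<circ> prod.swap) A B C = prod.swap ` hits \<omega> B A C"
    by (auto simp: hits_def image_iff)
  then show ?thesis by (simp add: card_image)
qed

lemma maximal_card_subset:
  assumes "finite S" "P {}"
  obtains M where "M \<subseteq> S" "P M" "\<And>M'. M' \<subseteq> S \<Longrightarrow> P M' \<Longrightarrow> card M' \<le> card M"
proof -
  have "\<exists>M. (M \<subseteq> S \<and> P M) \<and> (\<forall>M'. M' \<subseteq> S \<and> P M' \<longrightarrow> card M' \<le> card M)"
    by (rule ex_has_greatest_nat[where b = "Suc (card S)" and k = "{}"])
      (use assms card_mono in \<open>auto simp: less_Suc_eq_le\<close>)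
  then show ?thesis using that by blast
qed

text \<open>A matching takes at most n of the 3n - 3n/5 unreserved colors.\<close>

lemma card_unused_colors:
  assumes "finite M" "inj_on \<omega> M" "\<omega> ` M \<subseteq> Some ` {3 * n div 5<..3 * n}" "card M \<le> n"
  shows "7 * n \<le> 5 * card {c \<in> {3 * n div 5<..3 * n}. Some c \<notin> \<omega> ` M}"
proof -
  let ?C = "{c \<in> {3 * n div 5<..3 * n}. Some c \<notin> \<omega> ` M}"
  have "Some ` ?C = Some ` {3 * n div 5<..3 * n} - \<omega> ` M" by auto
  moreover have "card (Some ` ?C) = card ?C" by (rule card_image) simp
  ultimately have "card ?C = card (Some ` {3 * n div 5<..3 * n} - \<omega> ` M)" by simp
  also have "\<dots> = 3 * n - 3 * n div 5 - card M"
    using card_Diff_subset[OF finite_imageI[OF assms(1)] assms(3)] card_image[OF assms(2)] by (simp add: card_image)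
  finally show ?thesis using assms(4) by linarith
qed

lemma inj_on_insert_fresh: "f a \<notin> f ` A \<Longrightarrow> inj_on f (insert a A) \<longleftrightarrow> inj_on f A"
  by (auto simp: inj_on_insert)

text \<open>If a matching \<open>M\<close> of maximal size missed too much, the sets
  \<open>Y1\<close> and \<open>X2\<close> reached from the uncovered vertices would consist of
  covered vertices and contain more than half of either side. A matching edge \<open>(x, y)\<close>
  between them could be replaced by \<open>(a, y)\<close> and \<open>(x, b)\<close>, which enlarges
  \<open>M\<close>.\<close>

theorem near_perfect_rainbow_matching:
  assumes "quasirandom n d \<omega>" "quasirandom n d (\<omega> \<circ> prod.swap)"
    and H: "\<And>A. A \<subseteq> {1..n} \<Longrightarrow> real (card (H \<inter> A \<times> {1..n})) \<le> 17 / 100 * d * real (card A)"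
    and H': "\<And>B. B \<subseteq> {1..n} \<Longrightarrow> real (card (H \<inter> {1..n} \<times> B)) \<le> 17 / 100 * d * real (card B)"
  shows "\<exists>M \<subseteq> {1..n} \<times> {1..n} - H. inj_on fst M \<and> inj_on snd M \<and> inj_on \<omega> M \<and>
    \<omega> ` M \<subseteq> Some ` {3 * n div 5<..3 * n} \<and> real n - slack n < real (card M)"
proof -
  interpret X: quasirandom n d \<omega> by fact
  interpret Y: quasirandom n d "\<omega> \<circ> prod.swap" by fact
  let ?V = "{1..n}"
  let ?P = "\<lambda>M. inj_on fst M \<and> inj_on snd M \<and> inj_on \<omega> M \<and> \<omega> ` M \<subseteq> Some ` {3 * n div 5<..3 * n}"
  define S where "S = ?V \<times> ?V - H"
  define P where "P = ?P"
  have "finite S" "P {}" by (auto simp: S_def P_def)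
  then obtain M where "M \<subseteq> S" "P M" "\<And>M'. M' \<subseteq> S \<Longrightarrow> P M' \<Longrightarrow> card M' \<le> card M"
    by (rule maximal_card_subset) (rule that)
  then have sub: "M \<subseteq> ?V \<times> ?V - H" and M: "?P M"
    and max: "\<And>M'. M' \<subseteq> ?V \<times> ?V - H \<Longrightarrow> ?P M' \<Longrightarrow> card M' \<le> card M"
    unfolding S_def P_def by blast+
  have finM: "finite M" using sub by (rule finite_subset) auto
  have "real n - slack n < real (card M)"
  proof (rule ccontr)
    assume neg: "\<not> ?thesis"
    define X0 where "X0 = ?V - fst ` M"
    define Y0 where "Y0 = ?V - snd ` M"
    define C where "C = {c \<in> {3 * n div 5<..3 * n}. Some c \<notin> \<omega> ` M}"
    have subs: "fst ` M \<subseteq> ?V" "snd ` M \<subseteq> ?V" using sub by auto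
    have cM: "card (fst ` M) = card M" "card (snd ` M) = card M" "card (\<omega> ` M) = card M"
      using M card_image by blast+
    have Mn: "card M \<le> n" using card_mono[OF _ subs(1)] cM by simp
    have c0: "card X0 = n - card M" "card Y0 = n - card M"
      unfolding X0_def Y0_def using subs cM finM by (simp_all add: card_Diff_subset)
    have cX: "slack n \<le> real (card X0)" "slack n \<le> real (card Y0)"
      using neg Mn c0 by (simp_all add: of_nat_diff)
    have "7 * n \<le> 5 * card C"
      unfolding C_def by (rule card_unused_colors[OF finM _ _ Mn]) (use M in simp_all)
    then have cC: "27 / 20 * real n \<le> real (card C)" by linarith
    have CK: "C \<subseteq> {1..3 * n}" by (auto simp: C_def)
    define Y1 where "Y1 = {y \<in> ?V. \<exists>a\<in>X0. \<exists>a'\<in>X0. \<exists>c\<in>C. \<exists>c'\<in>C. c \<noteq> c' \<and>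
      \<omega> (a, y) = Some c \<and> \<omega> (a', y) = Some c' \<and> (a, y) \<notin> H \<and> (a', y) \<notin> H}"
    define X2 where "X2 = {y \<in> ?V. \<exists>a\<in>Y0. \<exists>a'\<in>Y0. \<exists>c\<in>C. \<exists>c'\<in>C. c \<noteq> c' \<and>
      (\<omega> \<circ> prod.swap) (a, y) = Some c \<and> (\<omega> \<circ> prod.swap) (a', y) = Some c' \<and> (a, y) \<notin> prod.swap ` H \<and> (a', y) \<notin> prod.swap ` H}"
    have Y1: "11 / 20 * real n \<le> real (card Y1)"
      unfolding Y1_def by (rule X.card_twice_reached) (use cX cC CK H in \<open>auto simp: X0_def\<close>)
    have "prod.swap ` H \<inter> Y0 \<times> ?V = prod.swap ` (H \<inter> ?V \<times> Y0)" by auto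
    then have "card (prod.swap ` H \<inter> Y0 \<times> ?V) = card (H \<inter> ?V \<times> Y0)" by (simp add: card_image)
    then have X2: "11 / 20 * real n \<le> real (card X2)"
      unfolding X2_def by (intro Y.card_twice_reached) (use cX cC CK H'[of Y0] in \<open>auto simp: Y0_def\<close>)
    \<comment> \<open>The reason for asking for two colors: once the color of \<open>(x, b)\<close>
      is fixed, \<open>(a, y)\<close> can still be given another one.\<close>
    have Y1D: "\<exists>a\<in>X0. \<exists>c\<in>C. c \<noteq> c0 \<and> \<omega> (a, y) = Some c \<and> (a, y) \<notin> H" if "y \<in> Y1" for y c0
    proof -
      from \<open>y \<in> Y1\<close> obtain a a' c c' where "a \<in> X0" "a' \<in> X0" "c \<in> C" "c' \<in> C" "c \<noteq> c'"
        "\<omega> (a, y) = Some c" "\<omega> (a', y) = Some c'" "(a, y) \<notin> H" "(a', y) \<notin> H"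
        unfolding Y1_def by blast
      then show ?thesis by (cases "c = c0") auto
    qed
    have X2D: "\<exists>b\<in>Y0. \<exists>c\<in>C. \<omega> (x, b) = Some c \<and> (x, b) \<notin> H" if "x \<in> X2" for x
      using that unfolding X2_def by force
    have CR: "c \<in> {3 * n div 5<..3 * n} \<and> Some c \<notin> \<omega> ` M" if "c \<in> C" for c
      using that by (simp add: C_def)
    have grow: False if "a \<in> X0" "b \<in> Y0" "\<omega> (a, b) = Some c" "(a, b) \<notin> H" "c \<in> C" for a b c
    proof -
      have "card (insert (a, b) M) \<le> card M"
        using that sub M CR[OF that(5)] by (intro max) (auto simp: X0_def Y0_def)
      moreover have "(a, b) \<notin> M" using that by (force simp: X0_def)
      ultimately show False using finM by simp
    qed
    have Y1M: "Y1 \<subseteq> snd ` M"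
    proof
      fix y assume y: "y \<in> Y1"
      obtain a c where "a \<in> X0" "c \<in> C" "\<omega> (a, y) = Some c" "(a, y) \<notin> H" using Y1D[OF y] by blast
      moreover have "y \<in> ?V" using y by (simp add: Y1_def)
      ultimately show "y \<in> snd ` M" using grow[of a y c] by (simp only: Y0_def Diff_iff) blast
    qed
    have X2M: "X2 \<subseteq> fst ` M"
    proof
      fix x assume x: "x \<in> X2"
      obtain b c where "b \<in> Y0" "c \<in> C" "\<omega> (x, b) = Some c" "(x, b) \<notin> H" using X2D[OF x] by blast
      moreover have "x \<in> ?V" using x by (simp add: X2_def)
      ultimately show "x \<in> fst ` M" using grow[of x b c] by (simp only: X0_def Diff_iff) blast
    qed
    define M1 where "M1 = {e \<in> M. snd e \<in> Y1}"
    define M2 where "M2 = {e \<in> M. fst e \<in> X2}"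
    have "snd ` M1 = Y1" "fst ` M2 = X2" using Y1M X2M by (auto simp: M1_def M2_def image_iff)
    then have c12: "card Y1 \<le> card M1" "card X2 \<le> card M2"
      using card_image_le[of M1 snd] card_image_le[of M2 fst] finM by (simp_all add: M1_def M2_def)
    have "M1 \<inter> M2 \<noteq> {}"
    proof
      assume "M1 \<inter> M2 = {}"
      then have "card M1 + card M2 = card (M1 \<union> M2)"
        using finM by (intro card_Un_disjoint[symmetric]) (auto simp: M1_def M2_def)
      also have "\<dots> \<le> card M" using finM by (intro card_mono) (auto simp: M1_def M2_def)
      finally show False using c12 Y1 X2 Mn X.n_pos by linarith
    qed
    then obtain x y where xy: "(x, y) \<in> M" "y \<in> Y1" "x \<in> X2" by (auto simp: M1_def M2_def)
    obtain b c' where b: "b \<in> Y0" "c' \<in> C" "\<omega> (x, b) = Some c'" "(x, b) \<notin> H" using X2D[OF xy(3)] by blast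
    obtain a c where a: "a \<in> X0" "c \<in> C" "c \<noteq> c'" "\<omega> (a, y) = Some c" "(a, y) \<notin> H" using Y1D[OF xy(2)] by blast
    let ?rest = "M - {(x, y)}"
    let ?M = "insert (a, y) (insert (x, b) ?rest)"
    have ax: "a \<noteq> x" "b \<noteq> y" using a b xy by (force simp: X0_def Y0_def)+
    have av: "a \<in> ?V" "a \<notin> fst ` M" "b \<in> ?V" "b \<notin> snd ` M" using a b by (auto simp: X0_def Y0_def)
    have xv: "x \<in> ?V" "y \<in> ?V" using sub xy by auto
    have inj: "inj_on fst M" "inj_on snd M" using M by auto
    have "fst (x, y) \<notin> fst ` ?rest" "snd (x, y) \<notin> snd ` ?rest"
      by (simp_all only: inj_on_image_mem_iff[OF inj(1) xy(1) Diff_subset]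
        inj_on_image_mem_iff[OF inj(2) xy(1) Diff_subset]) simp_all
    then have x0: "x \<notin> fst ` ?rest" "y \<notin> snd ` ?rest" by simp_all
    have "inj_on fst ?rest" "inj_on snd ?rest" "inj_on \<omega> ?rest" using M inj_on_diff by blast+
    moreover have "a \<notin> fst ` insert (x, b) ?rest" "y \<notin> snd ` insert (x, b) ?rest" "b \<notin> snd ` ?rest"
      using av ax x0 by auto
    moreover have "Some c \<notin> \<omega> ` insert (x, b) ?rest" "Some c' \<notin> \<omega> ` ?rest" "\<omega> ` ?rest \<subseteq> Some ` {3 * n div 5<..3 * n}"
      using CR[OF a(2)] CR[OF b(2)] a(3) b(3) M by auto
    ultimately have "?P ?M"
      using CR[OF a(2)] CR[OF b(2)] x0 a(4) b(3) by (simp add: inj_on_insert_fresh del: inj_on_insert)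
    moreover have "?M \<subseteq> ?V \<times> ?V - H" using sub a b av xv by auto
    ultimately have "card ?M \<le> card M" by (rule max[rotated])
    have fin: "finite ?rest" using finM by simp
    have new: "(x, b) \<notin> ?rest" "(a, y) \<notin> insert (x, b) ?rest"
      using av ax by (auto simp: image_iff)
    have "card ?M = Suc (Suc (card ?rest))"
      unfolding card_insert_disjoint[OF finite.insertI[OF fin] new(2)] card_insert_disjoint[OF fin new(1)] ..
    moreover have "Suc (card ?rest) = card M" using xy finM by (meson card_Suc_Diff1)
    ultimately show False using \<open>card ?M \<le> card M\<close> by linarith
  qed
  then show ?thesis using sub M by blast
qed

section \<open>Rainbow trees of alternating paths\<close>

text \<open>
  A set \<open>Q\<close> of matching edges and a set \<open>P\<close> of other edges, such that replacing \<open>Q\<close> by \<open>P\<close> moves the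
  uncovered vertex from \<open>x\<close> to \<open>a\<close>. That \<open>P\<close> is a matching is not demanded: it follows by counting when all
  exchanges have been made.
\<close>

definition segment :: "'a \<Rightarrow> 'a \<Rightarrow> ('a \<times> 'b) set \<Rightarrow> ('a \<times> 'b) set \<Rightarrow> bool" where
  "segment x a Q P \<longleftrightarrow> a \<in> insert x (fst ` Q) \<and> fst ` P = insert x (fst ` Q) - {a} \<and> snd ` P = snd ` Q \<and>
    finite P \<and> card P \<le> card Q"

text \<open>The shape of the tree of alternating paths with root \<open>x\<close> is not recorded,
  only its matching edges \<open>TQ\<close>, its other edges \<open>TP\<close>, and that every
  vertex is reached by a path with at most \<open>j\<close> matching edges.\<close>

definition tree :: "nat \<Rightarrow> 'a \<Rightarrow> ('a \<times> 'b) set \<Rightarrow> ('a \<times> 'b) set \<Rightarrow> bool" where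
  "tree j x TQ TP \<longleftrightarrow> (\<forall>a\<in>insert x (fst ` TQ). \<exists>Q\<subseteq>TQ. \<exists>P\<subseteq>TP. card Q \<le> j \<and> segment x a Q P)"

text \<open>A new vertex is the first end of some \<open>m\<close> in \<open>MF\<close>. The path to
  it runs inside the old tree to \<open>fst f\<close>, where \<open>f\<close> in \<open>F\<close>
  has the same second end as \<open>m\<close>, and then along \<open>f\<close> and
  \<open>m\<close>.\<close>

lemma tree_extend:
  assumes t: "tree j x TQ TP" and fin: "finite TQ" and inj: "inj_on fst (TQ \<union> MF)"
    and disj: "TQ \<inter> MF = {}" and x: "x \<notin> fst ` (TQ \<union> MF)"
    and F: "fst ` F \<subseteq> insert x (fst ` TQ)" "snd ` F = snd ` MF"
  shows "tree (Suc j) x (TQ \<union> MF) (TP \<union> F)"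
  unfolding tree_def
proof
  fix a assume "a \<in> insert x (fst ` (TQ \<union> MF))"
  then consider "a \<in> insert x (fst ` TQ)" | "a \<in> fst ` MF" by blast
  then show "\<exists>Q\<subseteq>TQ \<union> MF. \<exists>P\<subseteq>TP \<union> F. card Q \<le> Suc j \<and> segment x a Q P"
  proof cases
    case 1
    then obtain Q P where "Q \<subseteq> TQ" "P \<subseteq> TP" "card Q \<le> j" "segment x a Q P"
      using t unfolding tree_def by blast
    then show ?thesis by (meson le_Suc_eq le_supI1)
  next
    case 2
    then obtain m where m: "m \<in> MF" "a = fst m" by blast
    then obtain f where f: "f \<in> F" "snd f = snd m" using F(2) by (metis imageE image_eqI)
    then have "fst f \<in> insert x (fst ` TQ)" using F(1) by blast
    then obtain Q P where QP: "Q \<subseteq> TQ" "P \<subseteq> TP" "card Q \<le> j" "segment x (fst f) Q P"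
      using t unfolding tree_def by blast
    have finQ: "finite Q" using QP(1) fin finite_subset by blast
    have mQ: "m \<notin> Q" using disj QP(1) m by blast
    have aQ: "a \<notin> fst ` Q"
      using inj m QP(1) mQ unfolding inj_on_def by blast
    have ax: "a \<noteq> x" using x m by blast
    have cQ: "card (insert m Q) = Suc (card Q)" using finQ mQ by simp
    have "segment x a (insert m Q) (insert f P)"
      unfolding segment_def
    proof (intro conjI)
      have s: "fst f \<in> insert x (fst ` Q)" "fst ` P = insert x (fst ` Q) - {fst f}" "snd ` P = snd ` Q"
        "finite P" "card P \<le> card Q" using QP(4) by (auto simp: segment_def)
      obtain S where S: "S = fst ` Q" by simp
      show "fst ` insert f P = insert x (fst ` insert m Q) - {a}"
        using s(1) aQ ax unfolding image_insert s(2) m(2)[symmetric] S[symmetric] by blast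
      show "snd ` insert f P = snd ` insert m Q" using s(3) f by auto
      show "finite (insert f P)" using s by simp
      show "card (insert f P) \<le> card (insert m Q)" using s cQ by (simp add: card_insert_if)
      show "a \<in> insert x (fst ` insert m Q)" using m by simp
    qed
    moreover have "insert m Q \<subseteq> TQ \<union> MF" "insert f P \<subseteq> TP \<union> F" "card (insert m Q) \<le> Suc j"
      using QP m f cQ by auto
    ultimately show ?thesis by blast
  qed
qed

section \<open>Growing rainbow trees by greedy choice\<close>

lemma card_fibres:
  assumes "finite A" "finite L"
  shows "card {e \<in> L. fst e \<in> A} = (\<Sum>x\<in>A. card {e \<in> L. fst e = x})"
proof -
  have "{e \<in> L. fst e \<in> A} = (\<Union>x\<in>A. {e \<in> L. fst e = x})" by auto
  moreover have "card (\<Union>x\<in>A. {e \<in> L. fst e = x}) = (\<Sum>x\<in>A. card {e \<in> L. fst e = x})"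
    using assms by (intro card_UN_disjoint) auto
  ultimately show ?thesis by (rule trans[OF arg_cong[where f = card]])
qed

lemma card_colors_le:
  assumes "finite P"
  shows "card {c. Some c \<in> \<omega> ` P} \<le> card P"
  by (rule surj_card_le[OF assms, of _ "\<lambda>e. the (\<omega> e)"]) (auto simp: image_iff, metis option.sel)

lemma colors_subset:
  assumes "\<omega> ` L \<subseteq> Some ` K" "P \<subseteq> L"
  shows "{c. Some c \<in> \<omega> ` P} \<subseteq> K"
proof
  fix c assume "c \<in> {c. Some c \<in> \<omega> ` P}"
  then have "Some c \<in> Some ` K" using assms by blast
  then show "c \<in> K" by auto
qed

lemma Some_image_colors: "S \<subseteq> Some ` K \<Longrightarrow> Some ` {c. Some c \<in> S} = S"
  by auto

lemma swap_disjoint: "A \<inter> prod.swap ` B = {} \<longleftrightarrow> B \<inter> prod.swap ` A = {}"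
  by force

lemma inj_on_swap: "inj_on fst (prod.swap ` M) = inj_on snd M" "inj_on snd (prod.swap ` M) = inj_on fst M"
  by (simp_all add: comp_inj_on_iff comp_def)

lemma image_swap: "fst ` prod.swap ` M = snd ` M" "snd ` prod.swap ` M = fst ` M"
  by (simp_all add: image_image)

context quasirandom
begin

lemma ln_pos: "0 < ln (real n)" using ln_large by linarith

text \<open>The edges are chosen greedily. Forbidden and already used ends number at most 20 |A|,
  and so do the colors; \<open>few_between\<close> and \<open>few_colored\<close> let each kind
  block fewer than d |A| / 1000 edges, while \<open>L\<close> has at least 3 d |A| / 1000.\<close>

lemma star_edges:
  assumes A: "A \<subseteq> {1..n}" "A \<noteq> {}" "20 * real (card A) \<le> real n / 100000000"
    and L: "L \<subseteq> {1..n} \<times> {1..n}" "\<omega> ` L \<subseteq> Some ` {1..3 * n}"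
    and deg: "\<And>x. x \<in> A \<Longrightarrow> 3 / 1000 * d \<le> real (card {e \<in> L. fst e = x})"
    and B: "B \<subseteq> {1..n}" "C \<subseteq> {1..3 * n}"
  shows "card B + m \<le> 20 * card A \<Longrightarrow> card C + m \<le> 20 * card A \<Longrightarrow> \<exists>F\<subseteq>L. card F = m \<and> fst ` F \<subseteq> A \<and>
    inj_on snd F \<and> inj_on \<omega> F \<and> snd ` F \<inter> B = {} \<and> \<omega> ` F \<inter> Some ` C = {}"
proof (induction m)
  case 0
  show ?case by (intro exI[of _ "{}"]) auto
next
  case (Suc m)
  then obtain F where F: "F \<subseteq> L" "card F = m" "fst ` F \<subseteq> A" "inj_on snd F" "inj_on \<omega> F"
    "snd ` F \<inter> B = {}" "\<omega> ` F \<inter> Some ` C = {}" by auto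
  have finL: "finite L" using L(1) finite_subset by blast
  have finF: "finite F" using F(1) finL finite_subset by blast
  have finA: "finite A" using A(1) finite_subset by blast
  define B' where "B' = B \<union> snd ` F"
  define C' where "C' = C \<union> {c. Some c \<in> \<omega> ` F}"
  have sub: "B' \<subseteq> {1..n}" "C' \<subseteq> {1..3 * n}"
    using B colors_subset[OF L(2) F(1)] L(1) F(1) unfolding B'_def C'_def by auto
  have "card {c. Some c \<in> \<omega> ` F} \<le> card F" by (rule card_colors_le[OF finF])
  then have "card B' \<le> card B + m" "card C' \<le> card C + m"
    unfolding B'_def C'_def using F(2) finF card_image_le[OF finF, of snd] card_Un_le[of B "snd ` F"]
      card_Un_le[of C "{c. Some c \<in> \<omega> ` F}"] by linarith+
  then have c20: "real (card B') \<le> 20 * real (card A)" "real (card C') \<le> 20 * real (card A)"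
    using Suc.prems by linarith+
  have "real (card A) * 20 \<le> real (card A) * (40 * ln (real n))"
    by (rule mult_left_mono) (use ln_large in auto)
  with c20 have c40: "real (card B') \<le> 40 * real (card A) * ln (real n)" "real (card C') \<le> 40 * real (card A) * ln (real n)"
    by (simp_all add: mult.commute mult.left_commute)
  have b1: "real (card (hits \<omega> A B' {1..3 * n})) < d * real (card A) / 1000"
    by (rule few_between) (use A sub c20 c40 in linarith)+
  have b2: "real (card (hits \<omega> A {1..n} C')) < d * real (card A) / 1000"
    by (rule few_colored) (use A sub c20 c40 in linarith)+
  have "real (card {e \<in> L. fst e \<in> A}) = (\<Sum>x\<in>A. real (card {e \<in> L. fst e = x}))"
    using card_fibres[OF finA finL] by simp
  also have "\<dots> \<ge> (\<Sum>x\<in>A. 3 / 1000 * d)" using deg by (rule sum_mono)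
  finally have b3: "3 / 1000 * d * real (card A) \<le> real (card {e \<in> L. fst e \<in> A})"
    by (simp add: mult.commute)
  have "\<not> {e \<in> L. fst e \<in> A} \<subseteq> hits \<omega> A B' {1..3 * n} \<union> hits \<omega> A {1..n} C'"
  proof
    assume "{e \<in> L. fst e \<in> A} \<subseteq> hits \<omega> A B' {1..3 * n} \<union> hits \<omega> A {1..n} C'"
    moreover have "finite (hits \<omega> A B' {1..3 * n} \<union> hits \<omega> A {1..n} C')"
      using finA finF finite_subset[OF sub(1)] by (simp add: finite_hits)
    ultimately have "card {e \<in> L. fst e \<in> A} \<le> card (hits \<omega> A B' {1..3 * n}) + card (hits \<omega> A {1..n} C')"
      by (meson card_Un_le card_mono order_trans)
    then have "3 / 1000 * d * real (card A) < 2 * (d * real (card A) / 1000)"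
      using b1 b2 b3 by linarith
    moreover have "0 \<le> d * real (card A)" using d_pos by simp
    ultimately show False by linarith
  qed
  then obtain e where e: "e \<in> L" "fst e \<in> A" "e \<notin> hits \<omega> A B' {1..3 * n}" "e \<notin> hits \<omega> A {1..n} C'" by blast
  have se: "snd e \<in> {1..n}" "\<omega> e \<in> Some ` {1..3 * n}" using e(1) L by auto
  have eB: "snd e \<notin> B'" using e(2,3) se by (auto simp: hits_def mem_Times_iff)
  have eC: "\<omega> e \<notin> Some ` C'" using e(2,4) se by (auto simp: hits_def mem_Times_iff)
  have "\<omega> e \<notin> \<omega> ` F"
  proof
    assume "\<omega> e \<in> \<omega> ` F"
    moreover obtain c where "\<omega> e = Some c" using se(2) by blast
    ultimately have "c \<in> C'" by (simp add: C'_def)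
    then show False using eC \<open>\<omega> e = Some c\<close> by simp
  qed
  moreover have "snd e \<notin> snd ` F" using eB by (simp add: B'_def)
  ultimately have "inj_on snd (insert e F)" "inj_on \<omega> (insert e F)" "e \<notin> F"
    using F(4,5) by auto
  moreover have "snd e \<notin> B" "\<omega> e \<notin> Some ` C" using eB eC by (auto simp: B'_def C'_def)
  ultimately show ?case
    using F e(1,2) finF by (intro exI[of _ "insert e F"]) auto
qed

end

text \<open>The state after \<open>j\<close> doublings: with the root there are 2 ^ j vertices on
  the side of \<open>x\<close>. \<open>L\<close> supplies the edges, and the vertices in
  \<open>W\<close> are avoided because their degree in \<open>L\<close> may be small.\<close>

definition grown :: "(nat \<times> nat \<Rightarrow> nat option) \<Rightarrow> (nat \<times> nat) set \<Rightarrow> (nat \<times> nat) set \<Rightarrow> nat set \<Rightarrow> nat \<Rightarrow> nat \<Rightarrow>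
    (nat \<times> nat) set \<Rightarrow> (nat \<times> nat) set \<Rightarrow> bool" where
  "grown \<omega> M L W x j TQ TP \<longleftrightarrow> TQ \<subseteq> M \<and> fst ` TQ \<inter> W = {} \<and> TP \<subseteq> L \<and> inj_on \<omega> TP \<and>
    card TQ = 2 ^ j - 1 \<and> card TP = 2 ^ j - 1 \<and> tree j x TQ TP"

text \<open>The 2 ^ j vertices send out 2 ^ j edges to new ends, whose matching edges lead to the
  next vertices. \<open>BQ\<close> and \<open>BC\<close> stand for the matching edges and colors of
  the tree on the other side, which may be one round ahead; hence the factor 2.\<close>

lemma (in quasirandom) grown_step:
  assumes g: "grown \<omega> M L W x j TQ TP"
    and M: "M \<subseteq> {1..n} \<times> {1..n}" "inj_on fst M" "inj_on snd M"
    and x: "x \<in> {1..n}" "x \<notin> W" "x \<notin> fst ` M"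
    and L: "L \<subseteq> {1..n} \<times> {1..n}" "\<omega> ` L \<subseteq> Some ` {1..3 * n}" "snd ` L \<subseteq> snd ` {m \<in> M. fst m \<notin> W}"
    and deg: "\<And>x. x \<in> {1..n} - W \<Longrightarrow> 3 / 1000 * d \<le> real (card {e \<in> L. fst e = x})"
    and BQ: "BQ \<subseteq> M" "TQ \<inter> BQ = {}" "card BQ \<le> 2 * 2 ^ j"
    and BC: "BC \<subseteq> {1..3 * n}" "\<omega> ` TP \<inter> Some ` BC = {}" "card BC \<le> 2 * 2 ^ j"
    and small: "20 * 2 ^ j \<le> real n / 100000000"
  shows "\<exists>TQ' TP'. grown \<omega> M L W x (Suc j) TQ' TP' \<and> TQ' \<inter> BQ = {} \<and> \<omega> ` TP' \<inter> Some ` BC = {}"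
proof -
  have TQ: "TQ \<subseteq> M" "fst ` TQ \<inter> W = {}" "card TQ = 2 ^ j - 1"
    and TP: "TP \<subseteq> L" "inj_on \<omega> TP" "card TP = 2 ^ j - 1" and t: "tree j x TQ TP"
    using g by (auto simp: grown_def)
  have finM: "finite M" and finL: "finite L" using M(1) L(1) finite_subset by blast+
  have fin: "finite TQ" "finite TP" "finite BQ" using TQ(1) TP(1) BQ(1) finM finL finite_subset by blast+
  define A where "A = insert x (fst ` TQ)"
  have A: "A \<subseteq> {1..n}" "A \<inter> W = {}" using x TQ M(1) by (auto simp: A_def)
  have "card (fst ` TQ) = 2 ^ j - 1" using TQ M(2) card_image inj_on_subset by metis
  then have cA: "card A = 2 ^ j" using fin x TQ(1) by (auto simp: A_def card_insert_if)
  define B where "B = snd ` (TQ \<union> BQ)"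
  define C where "C = BC \<union> {c. Some c \<in> \<omega> ` TP}"
  have "card {c. Some c \<in> \<omega> ` TP} \<le> card TP"
    by (rule card_colors_le[OF fin(2)])
  then have cC: "card C + 2 ^ j \<le> 20 * card A"
    using card_Un_le[of BC "{c. Some c \<in> \<omega> ` TP}"] BC(3) TP(3) cA unfolding C_def by linarith
  have "card B \<le> card TQ + card BQ"
    unfolding B_def using card_image_le[of "TQ \<union> BQ" snd] card_Un_le[of TQ BQ] fin by auto
  then have cB: "card B + 2 ^ j \<le> 20 * card A" using BQ(3) TQ(3) cA by linarith
  have BCsub: "B \<subseteq> {1..n}" "C \<subseteq> {1..3 * n}"
    using TQ(1) BQ(1) M(1) BC(1) colors_subset[OF L(2) TP(1)] unfolding B_def C_def by auto
  have "\<exists>F\<subseteq>L. card F = 2 ^ j \<and> fst ` F \<subseteq> A \<and> inj_on snd F \<and> inj_on \<omega> F \<and> snd ` F \<inter> B = {} \<and> \<omega> ` F \<inter> Some ` C = {}"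
  proof (rule star_edges[OF A(1) _ _ L(1,2) _ BCsub cB cC])
    show "A \<noteq> {}" by (simp add: A_def)
    show "20 * real (card A) \<le> real n / 100000000" using small cA by simp
    show "3 / 1000 * d \<le> real (card {e \<in> L. fst e = z})" if "z \<in> A" for z
      using deg that A by blast
  qed
  then obtain F where F: "F \<subseteq> L" "card F = 2 ^ j" "fst ` F \<subseteq> A" "inj_on snd F" "inj_on \<omega> F"
    "snd ` F \<inter> B = {}" "\<omega> ` F \<inter> Some ` C = {}" by blast
  have finF: "finite F" using F(1) finL finite_subset by blast
  define MF where "MF = {m \<in> M. snd m \<in> snd ` F}"
  \<comment> \<open>Ends of edges in \<open>L\<close> have a partner outside of \<open>W\<close>,
    and this partner is unique since \<open>snd\<close> is injective on \<open>M\<close>.\<close>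
  have MFW: "fst m \<notin> W" if m: "m \<in> MF" for m
  proof -
    obtain m' where "m' \<in> M" "fst m' \<notin> W" "snd m' = snd m"
      using m F(1) L(3) unfolding MF_def by (smt (verit) image_iff image_mono mem_Collect_eq subset_iff)
    moreover have "m \<in> M" using m by (simp add: MF_def)
    ultimately show ?thesis using M(3) by (metis inj_onD)
  qed
  have "snd ` {m \<in> M. fst m \<notin> W} \<subseteq> snd ` M" by (rule image_mono) auto
  then have "snd ` F \<subseteq> snd ` M" using image_mono[OF F(1), of snd] L(3) by (meson order_trans)
  moreover have "snd ` {m \<in> M. snd m \<in> S} = snd ` M \<inter> S" for S by auto
  ultimately have sMF: "snd ` F = snd ` MF" unfolding MF_def by (simp only: Int_absorb1)
  have MFM: "MF \<subseteq> M" by (auto simp: MF_def)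
  then have finMF: "finite MF" using finM finite_subset by blast
  have "card MF = card (snd ` F)" unfolding sMF by (rule card_image[symmetric], rule inj_on_subset[OF M(3) MFM])
  then have cMF: "card MF = 2 ^ j" using card_image[OF F(4)] F(2) by simp
  have dMF: "TQ \<inter> MF = {}" "BQ \<inter> MF = {}" using F(6) by (auto simp: MF_def B_def)
  have sub: "TQ \<union> MF \<subseteq> M" using TQ(1) MFM by blast
  have "x \<notin> fst ` (TQ \<union> MF)" using sub x(3) by blast
  then have "tree (Suc j) x (TQ \<union> MF) (TP \<union> F)"
    using tree_extend[OF t fin(1) inj_on_subset[OF M(2) sub] dMF(1) _ _ sMF] F(3) unfolding A_def by blast
  moreover have eq: "Some ` {c. Some c \<in> \<omega> ` TP} = \<omega> ` TP"
    by (rule Some_image_colors, rule order_trans[OF image_mono[OF TP(1)] L(2)])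
  then have dP: "\<omega> ` TP \<inter> \<omega> ` F = {}" "Some ` BC \<inter> \<omega> ` F = {}"
    using F(7) unfolding C_def image_Un eq Int_Un_distrib Un_empty by (simp_all only: Int_commute)
  then have "TP \<inter> F = {}" "inj_on \<omega> (TP \<union> F)" using TP(2) F(5) by (auto simp: inj_on_Un)
  moreover have "card (TQ \<union> MF) = 2 ^ Suc j - 1" "card (TP \<union> F) = 2 ^ Suc j - 1"
    using card_Un_disjoint[OF fin(1) finMF dMF(1)] card_Un_disjoint[OF fin(2) finF \<open>TP \<inter> F = {}\<close>] TQ(3) TP(3) cMF F(2) by auto
  moreover have "TQ \<union> MF \<subseteq> M" "fst ` (TQ \<union> MF) \<inter> W = {}" "TP \<union> F \<subseteq> L" using TQ TP(1) MFM MFW F(1) by auto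
  ultimately have "grown \<omega> M L W x (Suc j) (TQ \<union> MF) (TP \<union> F)" by (simp add: grown_def)
  moreover have "(TQ \<union> MF) \<inter> BQ = {}" "\<omega> ` (TP \<union> F) \<inter> Some ` BC = {}"
    using BQ(2) dMF BC(2) dP(2) by (simp_all add: image_Un Int_Un_distrib Int_Un_distrib2 Int_commute)
  ultimately show ?thesis by blast
qed

text \<open>The trees must share neither matching edges nor colors, so they grow in turn, each
  avoiding the present state of the other. The tree at \<open>y\<close> is the same construction in
  the swapped coloring.\<close>

lemma two_grown_trees:
  assumes "quasirandom n d \<omega>" "quasirandom n d (\<omega> \<circ> prod.swap)"
    and M: "M \<subseteq> {1..n} \<times> {1..n}" "inj_on fst M" "inj_on snd M"
    and x: "x \<in> {1..n}" "x \<notin> W" "x \<notin> fst ` M" and y: "y \<in> {1..n}" "y \<notin> W'" "y \<notin> snd ` M"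
    and L: "L \<subseteq> {1..n} \<times> {1..n}" "\<omega> ` L \<subseteq> Some ` {1..3 * n}" "snd ` L \<subseteq> snd ` {m \<in> M. fst m \<notin> W}"
    and L': "L' \<subseteq> {1..n} \<times> {1..n}" "(\<omega> \<circ> prod.swap) ` L' \<subseteq> Some ` {1..3 * n}"
      "snd ` L' \<subseteq> snd ` {m \<in> prod.swap ` M. fst m \<notin> W'}"
    and deg: "\<And>x. x \<in> {1..n} - W \<Longrightarrow> 3 / 1000 * d \<le> real (card {e \<in> L. fst e = x})"
    and deg': "\<And>x. x \<in> {1..n} - W' \<Longrightarrow> 3 / 1000 * d \<le> real (card {e \<in> L'. fst e = x})"
  shows "(\<And>i. i < j \<Longrightarrow> 20 * 2 ^ i \<le> real n / 100000000) \<Longrightarrow>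
    \<exists>TQ TP TQ' TP'. grown \<omega> M L W x j TQ TP \<and> grown (\<omega> \<circ> prod.swap) (prod.swap ` M) L' W' y j TQ' TP' \<and>
      TQ \<inter> prod.swap ` TQ' = {} \<and> \<omega> ` TP \<inter> (\<omega> \<circ> prod.swap) ` TP' = {}"
proof (induction j)
  case 0
  have "tree 0 x {} ({} :: (nat \<times> nat) set)" for x by (auto simp: tree_def segment_def)
  then show ?case by (intro exI[of _ "{}"]) (simp add: grown_def)
next
  case (Suc j)
  interpret X: quasirandom n d \<omega> by fact
  interpret Y: quasirandom n d "\<omega> \<circ> prod.swap" by fact
  have small: "20 * 2 ^ j \<le> real n / 100000000" by (rule Suc.prems) simp
  obtain TQ TP TQ' TP' where g: "grown \<omega> M L W x j TQ TP" "grown (\<omega> \<circ> prod.swap) (prod.swap ` M) L' W' y j TQ' TP'"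
    and disj: "TQ \<inter> prod.swap ` TQ' = {}" "\<omega> ` TP \<inter> (\<omega> \<circ> prod.swap) ` TP' = {}"
    using Suc.IH Suc.prems less_SucI by blast
  have fins: "finite L" "finite L'" using L(1) L'(1) finite_subset by blast+
  have M': "prod.swap ` M \<subseteq> {1..n} \<times> {1..n}" "inj_on fst (prod.swap ` M)" "inj_on snd (prod.swap ` M)"
    using M by (auto simp: inj_on_swap)
  have TQ': "TQ' \<subseteq> prod.swap ` M" "card TQ' = 2 ^ j - 1" "TP' \<subseteq> L'" "card TP' = 2 ^ j - 1"
    using g(2) by (auto simp: grown_def)
  have fin': "finite TP'" using TQ'(3) fins(2) finite_subset by blast
  define C' where "C' = {c. Some c \<in> (\<omega> \<circ> prod.swap) ` TP'}"
  have SC': "Some ` C' = (\<omega> \<circ> prod.swap) ` TP'"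
    unfolding C'_def by (rule Some_image_colors, rule order_trans[OF image_mono[OF TQ'(3)] L'(2)])
  have BC: "C' \<subseteq> {1..3 * n}" "\<omega> ` TP \<inter> Some ` C' = {}" "card C' \<le> 2 * 2 ^ j"
    using colors_subset[OF L'(2) TQ'(3)] card_colors_le[OF fin', of "\<omega> \<circ> prod.swap"] TQ'(4) disj(2)
    unfolding SC' unfolding C'_def by linarith+
  have BQ: "prod.swap ` TQ' \<subseteq> M" "TQ \<inter> prod.swap ` TQ' = {}" "card (prod.swap ` TQ') \<le> 2 * 2 ^ j"
    using TQ'(1,2) disj(1) by (auto simp: card_image)
  have "\<exists>UQ UP. grown \<omega> M L W x (Suc j) UQ UP \<and> UQ \<inter> prod.swap ` TQ' = {} \<and> \<omega> ` UP \<inter> Some ` C' = {}"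
    by (rule X.grown_step[OF g(1) M x L _ BQ BC small]) (rule deg)
  then obtain UQ UP where U: "grown \<omega> M L W x (Suc j) UQ UP" "UQ \<inter> prod.swap ` TQ' = {}" "\<omega> ` UP \<inter> Some ` C' = {}"
    by blast
  have UQ: "UQ \<subseteq> M" "card UQ = 2 ^ Suc j - 1" "UP \<subseteq> L" "card UP = 2 ^ Suc j - 1"
    using U(1) by (auto simp: grown_def)
  have finU: "finite UP" using UQ(3) fins(1) finite_subset by blast
  define C where "C = {c. Some c \<in> \<omega> ` UP}"
  have SC: "Some ` C = \<omega> ` UP"
    unfolding C_def by (rule Some_image_colors, rule order_trans[OF image_mono[OF UQ(3)] L(2)])
  have cC: "card C \<le> 2 * 2 ^ j"
    using card_colors_le[OF finU, of \<omega>] UQ(4) unfolding C_def by simp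
  have d1: "(\<omega> \<circ> prod.swap) ` TP' \<inter> Some ` C = {}" using U(3) unfolding SC SC' by blast
  have CK: "C \<subseteq> {1..3 * n}" unfolding C_def by (rule colors_subset[OF L(2) UQ(3)])
  have d2: "TQ' \<inter> prod.swap ` UQ = {}" using U(2) unfolding swap_disjoint[of UQ TQ'] .
  have BQ': "prod.swap ` UQ \<subseteq> prod.swap ` M" "card (prod.swap ` UQ) \<le> 2 * 2 ^ j"
    using UQ(1,2) by (auto simp: card_image)
  have y': "y \<notin> fst ` prod.swap ` M" using y(3) unfolding image_swap .
  have "\<exists>UQ' UP'. grown (\<omega> \<circ> prod.swap) (prod.swap ` M) L' W' y (Suc j) UQ' UP' \<and> UQ' \<inter> prod.swap ` UQ = {} \<and>
      (\<omega> \<circ> prod.swap) ` UP' \<inter> Some ` C = {}"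
    by (rule Y.grown_step[OF g(2) M' y(1,2) y' L' _ BQ'(1) d2 BQ'(2) CK d1 cC small]) (rule deg')
  then obtain UQ' UP' where U': "grown (\<omega> \<circ> prod.swap) (prod.swap ` M) L' W' y (Suc j) UQ' UP'"
    "UQ' \<inter> prod.swap ` UQ = {}" "(\<omega> \<circ> prod.swap) ` UP' \<inter> Some ` C = {}" by blast
  have "UQ \<inter> prod.swap ` UQ' = {}" "\<omega> ` UP \<inter> (\<omega> \<circ> prod.swap) ` UP' = {}"
    using U'(2,3) unfolding SC swap_disjoint[of UQ UQ'] by (simp_all only: Int_commute)
  then show ?case using U U' by blast
qed

text \<open>
  From a vertex outside of \<open>W\<close>, few edges lead into \<open>Z\<close>, to partners of \<open>W\<close> or have a color in \<open>C\<close>. Hence a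
  tree that starts outside of \<open>W\<close> can avoid \<open>Z\<close>, \<open>C\<close> and \<open>W\<close> forever. A set \<open>W\<close> that is maximal among the
  small sets with many such edges will do, since sparsity forces it to have less than \<open>s/4\<close> elements.
\<close>

lemma (in quasirandom) closed_small_set:
  assumes M: "M \<subseteq> {1..n} \<times> {1..n}" "inj_on fst M"
    and Z: "Z \<subseteq> {1..n}" "real (card Z) \<le> 8 * real s * ln (real n)"
    and C: "C \<subseteq> {1..3 * n}" "real (card C) \<le> 8 * real s * ln (real n)"
    and s: "0 < s" "real s \<le> slack n"
  shows "\<exists>W\<subseteq>{1..n}. 4 * card W < s \<and> (\<forall>x\<in>{1..n} - W.
    real (card (hits \<omega> {x} (Z \<union> snd ` {m \<in> M. fst m \<in> W}) {1..3 * n})) + real (card (hits \<omega> {x} {1..n} C)) \<le> 2 / 1000 * d)"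
proof -
  define f where "f W = snd ` {m \<in> M. fst m \<in> W}" for W
  define b where "b W U = real (card (hits \<omega> W (Z \<union> f U) {1..3 * n})) + real (card (hits \<omega> W {1..n} C))" for W U
  define P where "P W \<longleftrightarrow> card W \<le> s \<and> 2 / 1000 * d * real (card W) \<le> b W W" for W
  have finM: "finite M" using M(1) finite_subset by blast
  have fV: "f W \<subseteq> {1..n}" for W using M(1) by (auto simp: f_def)
  have finf: "finite (f W)" for W using finite_subset[OF fV] by auto
  have finZ: "finite Z" using Z(1) finite_subset by blast
  have cf: "card (f W) \<le> card W" if "finite W" for W
  proof -
    have "card (f W) \<le> card {m \<in> M. fst m \<in> W}" unfolding f_def using finM by (intro card_image_le) simp
    also have "\<dots> = card (fst ` {m \<in> M. fst m \<in> W})"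
      by (rule card_image[symmetric], rule inj_on_subset[OF M(2)]) auto
    also have "\<dots> \<le> card W" using that by (intro card_mono) auto
    finally show ?thesis .
  qed
  have "finite {1..n}" "P {}" by (auto simp: P_def b_def hits_def)
  then obtain W where W: "W \<subseteq> {1..n}" "P W" and max: "\<And>W'. W' \<subseteq> {1..n} \<Longrightarrow> P W' \<Longrightarrow> card W' \<le> card W"
    by (rule maximal_card_subset) (rule that)
  have finW: "finite W" using W(1) finite_subset by blast
  have small: "4 * card W < s"
  proof (rule ccontr)
    assume "\<not> 4 * card W < s"
    then have sW: "real s \<le> 4 * real (card W)" by linarith
    then have ne: "W \<noteq> {}" using s by auto
    \<comment> \<open>With s <= 4 |W|, the set \<open>Z\<close> and the partners of \<open>W\<close>
      together have at most 32 |W| ln n + |W| elements, which is within the range of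
      \<open>few_between\<close>.\<close>
    have e1: "8 * real s * ln (real n) \<le> 32 * real (card W) * ln (real n)"
      by (rule mult_right_mono) (use sW ln_pos in auto)
    have "real (card W) * 1 \<le> real (card W) * ln (real n)"
      by (rule mult_left_mono) (use ln_large in auto)
    then have e2: "real (card W) \<le> real (card W) * ln (real n)" by simp
    have "8 * real s * ln (real n) \<le> 8 * slack n * ln (real n)"
      by (rule mult_right_mono) (use s ln_pos in auto)
    also have "8 * slack n * ln (real n) = 8 / 1000000000000 * real n"
      unfolding slack_def using ln_pos by simp
    finally have e3: "8 * real s * ln (real n) \<le> 8 / 1000000000000 * real n" .
    have "1 * slack n \<le> ln (real n) * slack n" by (rule mult_right_mono) (use slack_pos ln_large in auto)
    also have "\<dots> = 1 / 1000000000000 * real n" unfolding slack_def using ln_pos by simp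
    finally have e4: "real (card W) \<le> 1 / 1000000000000 * real n" using W(2) s unfolding P_def by linarith
    have cZf: "card (Z \<union> f W) \<le> card Z + card W" using card_Un_le[of Z "f W"] cf[OF finW] by linarith
    have "real (card (hits \<omega> W (Z \<union> f W) {1..3 * n})) < d * real (card W) / 1000"
    proof (rule few_between)
      show "real (card (Z \<union> f W)) \<le> 40 * real (card W) * ln (real n)"
        using cZf e1 e2 Z(2) by linarith
      show "real (card (Z \<union> f W)) \<le> real n / 100000000" using cZf e3 e4 Z(2) by linarith
    qed (use W Z fV ne in auto)
    moreover have "real (card (hits \<omega> W {1..n} C)) < d * real (card W) / 1000"
    proof (rule few_colored)
      show "real (card C) \<le> 40 * real (card W) * ln (real n)" using e1 e2 C(2) by linarith
      show "real (card C) \<le> real n / 100000000" using e3 C(2) by linarith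
    qed (use W C ne in auto)
    ultimately show False using W(2) unfolding P_def b_def by linarith
  qed
  moreover have "b {x} W \<le> 2 / 1000 * d" if x: "x \<in> {1..n} - W" for x
  proof (rule ccontr)
    assume neg: "\<not> ?thesis"
    have un: "hits \<omega> (insert x W) U C = hits \<omega> {x} U C \<union> hits \<omega> W U C" "hits \<omega> {x} U C \<inter> hits \<omega> W U C = {}" for U C
      using x by (auto simp: hits_def)
    have add: "card (hits \<omega> (insert x W) U C) = card (hits \<omega> {x} U C) + card (hits \<omega> W U C)" if "finite U" for U C
      unfolding un(1) using finW that un(2) by (intro card_Un_disjoint finite_hits) auto
    have fin: "finite (Z \<union> f W)" "finite (Z \<union> f (insert x W))" using finZ finf by auto
    have fm: "f W \<subseteq> f (insert x W)" by (auto simp: f_def)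
    \<comment> \<open>\<open>b\<close> is additive in its first and monotone in its second argument.
      So a vertex that violates the bound can join \<open>W\<close>, and 4 |W| < s leaves room for
      it, against maximality.\<close>
    have "b {x} W + b W W = b (insert x W) W" unfolding b_def using add[OF fin(1)] add[of "{1..n}"] by simp
    also have "\<dots> \<le> b (insert x W) (insert x W)"
      unfolding b_def using fin finW fm by (intro add_right_mono of_nat_mono card_mono finite_hits) (auto simp: hits_def)
    finally have "2 / 1000 * d * real (card (insert x W)) \<le> b (insert x W) (insert x W)"
      using neg W(2) x finW unfolding P_def by (simp add: algebra_simps)
    moreover have "card (insert x W) \<le> s" using small x finW s by simp
    ultimately have "P (insert x W)" by (simp add: P_def)
    then have "card (insert x W) \<le> card W" using W(1) x by (intro max) auto
    then show False using x finW by simp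
  qed
  ultimately show ?thesis using W(1) unfolding b_def f_def by blast
qed

section \<open>Completing a matching\<close>

text \<open>Replacing \<open>Q\<close> by \<open>P\<close> covers \<open>x\<close> and
  \<open>y\<close> in addition. As in \<open>segment\<close>, the size of \<open>P\<close> stands in
  for its being a matching.\<close>

definition exchange :: "'a \<Rightarrow> 'b \<Rightarrow> ('a \<times> 'b) set \<Rightarrow> ('a \<times> 'b) set \<Rightarrow> bool" where
  "exchange x y Q P \<longleftrightarrow> fst ` P = insert x (fst ` Q) \<and> snd ` P = insert y (snd ` Q) \<and>
    finite P \<and> card P \<le> Suc (card Q)"

text \<open>The path goes from \<open>x\<close> to \<open>a\<close>, along \<open>(a, y1)\<close>,
  the matching edge \<open>(x1, y1)\<close> and \<open>(x1, b)\<close>, and then backwards through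
  the other tree from \<open>b\<close> to \<open>y\<close>.\<close>

lemma join_segments:
  assumes s: "segment x a Q P" "segment y b Q' P'"
    and m: "(x1, y1) \<notin> Q" "(x1, y1) \<notin> prod.swap ` Q'" and disj: "Q \<inter> prod.swap ` Q' = {}"
    and fin: "finite Q" "finite Q'"
  shows "exchange x y (insert (x1, y1) (Q \<union> prod.swap ` Q')) (insert (a, y1) (insert (x1, b) (P \<union> prod.swap ` P')))"
  unfolding exchange_def
proof (intro conjI)
  have eqs: "a \<in> insert x (fst ` Q)" "fst ` P = insert x (fst ` Q) - {a}" "snd ` P = snd ` Q" "finite P" "card P \<le> card Q"
    "b \<in> insert y (fst ` Q')" "fst ` P' = insert y (fst ` Q') - {b}" "snd ` P' = snd ` Q'" "finite P'" "card P' \<le> card Q'"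
    using s[unfolded segment_def] by (simp_all only: simp_thms)
  obtain S S' T T' where defs: "S = fst ` Q" "S' = fst ` Q'" "T = snd ` Q" "T' = snd ` Q'" by simp
  show "fst ` insert (a, y1) (insert (x1, b) (P \<union> prod.swap ` P')) = insert x (fst ` insert (x1, y1) (Q \<union> prod.swap ` Q'))"
    using eqs(1) unfolding image_insert image_Un image_swap eqs(2,8) defs[symmetric] fst_conv by blast
  show "snd ` insert (a, y1) (insert (x1, b) (P \<union> prod.swap ` P')) = insert y (snd ` insert (x1, y1) (Q \<union> prod.swap ` Q'))"
    using eqs(6) unfolding image_insert image_Un image_swap eqs(3,7) defs[symmetric] snd_conv by blast
  show "finite (insert (a, y1) (insert (x1, b) (P \<union> prod.swap ` P')))" using eqs(4,9) by simp
  have "card (insert (x1, y1) (Q \<union> prod.swap ` Q')) = Suc (card Q + card Q')"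
    using m fin card_Un_disjoint[OF fin(1) finite_imageI[OF fin(2)] disj] by (simp add: card_image)
  moreover have "card (insert (a, y1) (insert (x1, b) (P \<union> prod.swap ` P'))) \<le> Suc (Suc (card P + card P'))"
    using card_Un_le[of P "prod.swap ` P'"] card_insert_le_m1 eqs(4,9)
    by (simp add: card_image card_insert_if) 
  ultimately show "card (insert (a, y1) (insert (x1, b) (P \<union> prod.swap ` P'))) \<le> Suc (card (insert (x1, y1) (Q \<union> prod.swap ` Q')))"
    using eqs(5,10) by linarith
qed

lemma image_exchanged:
  assumes M: "f ` M \<subseteq> V" and Q: "\<And>x. x \<in> U \<Longrightarrow> Q x \<subseteq> M"
    and P: "\<And>x. x \<in> U \<Longrightarrow> f ` P x = insert (k x) (f ` Q x)" and k: "k ` U = V - f ` M"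
  shows "f ` ((M - (\<Union>x\<in>U. Q x)) \<union> (\<Union>x\<in>U. P x)) = V" (is "f ` ?N = V")
proof (intro equalityI subsetI)
  fix v assume "v \<in> f ` ?N"
  then have "v \<in> f ` M \<or> (\<exists>x\<in>U. v \<in> f ` P x)" by blast
  then have "v \<in> f ` M \<or> (\<exists>x\<in>U. v \<in> insert (k x) (f ` Q x))" using P by blast
  then have "v \<in> f ` M \<or> v \<in> k ` U" using Q by blast
  then show "v \<in> V" using M k by auto
next
  fix v assume v: "v \<in> V"
  consider x where "x \<in> U" "v = k x" | m where "m \<in> M" "v = f m" using v k by blast
  then show "v \<in> f ` ?N"
  proof cases
    case 1
    then have "v \<in> f ` P x" using P by simp
    then show ?thesis using 1 by blast
  next
    case 2
    show ?thesis
    proof (cases "\<exists>x\<in>U. m \<in> Q x")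
      case True
      then obtain x where "x \<in> U" "m \<in> Q x" by blast
      then have "v \<in> f ` P x" using P 2 by simp
      then show ?thesis using \<open>x \<in> U\<close> by blast
    next
      case False
      then show ?thesis using 2 by blast
    qed
  qed
qed

text \<open>Every exchange adds at most one edge, so \<open>N\<close> has at most |M| + (n - |M|) =
  n edges. As both projections are onto \<open>{1..n}\<close>, they are injective; this is the count
  that makes \<open>N\<close> a matching.\<close>

lemma exchange_all:
  fixes M :: "(nat \<times> nat) set"
  assumes M: "M \<subseteq> {1..n} \<times> {1..n}" "inj_on fst M" "inj_on snd M"
    and h: "bij_betw h ({1..n} - fst ` M) ({1..n} - snd ` M)"
    and Q: "\<And>x. x \<in> {1..n} - fst ` M \<Longrightarrow> Q x \<subseteq> M"
    and ex: "\<And>x. x \<in> {1..n} - fst ` M \<Longrightarrow> exchange x (h x) (Q x) (P x)"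
    and disj: "\<And>x x'. x \<in> {1..n} - fst ` M \<Longrightarrow> x' \<in> {1..n} - fst ` M \<Longrightarrow> x \<noteq> x' \<Longrightarrow> Q x \<inter> Q x' = {}"
  defines "N \<equiv> (M - (\<Union>x\<in>{1..n} - fst ` M. Q x)) \<union> (\<Union>x\<in>{1..n} - fst ` M. P x)"
  shows "fst ` N = {1..n}" "snd ` N = {1..n}" "inj_on fst N" "inj_on snd N" "card N = n"
proof -
  define U where "U = {1..n} - fst ` M"
  have finM: "finite M" using M(1) finite_subset by blast
  have finU: "finite U" by (simp add: U_def)
  have finQ: "finite (Q x)" if "x \<in> U" for x using Q that finM finite_subset unfolding U_def by blast
  have e: "fst ` P x = insert x (fst ` Q x)" "snd ` P x = insert (h x) (snd ` Q x)" "finite (P x)" "card (P x) \<le> Suc (card (Q x))"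
    if "x \<in> U" for x
    using ex that unfolding U_def exchange_def by blast+
  have MV: "fst ` M \<subseteq> {1..n}" "snd ` M \<subseteq> {1..n}" using M(1) by auto
  have hU: "h ` U = {1..n} - snd ` M" using h unfolding U_def bij_betw_def by blast
  have N: "N = (M - (\<Union>x\<in>U. Q x)) \<union> (\<Union>x\<in>U. P x)" by (simp add: N_def U_def)
  have QM: "Q x \<subseteq> M" if "x \<in> U" for x using Q that by (simp add: U_def)
  show f: "fst ` N = {1..n}"
    unfolding N by (rule image_exchanged[where k = "\<lambda>x. x"]) (use MV QM e(1) in \<open>auto simp: U_def\<close>)
  show s: "snd ` N = {1..n}"
    unfolding N by (rule image_exchanged[where k = h, OF MV(2) QM e(2) hU])
  have finN: "finite N" unfolding N using finM finU e(3) by auto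
  have "card N \<le> card (M - (\<Union>x\<in>U. Q x)) + card (\<Union>x\<in>U. P x)" unfolding N by (rule card_Un_le)
  also have "card (M - (\<Union>x\<in>U. Q x)) = card M - card (\<Union>x\<in>U. Q x)"
    using finU finQ QM by (intro card_Diff_subset) auto
  also have "card (\<Union>x\<in>U. P x) \<le> (\<Sum>x\<in>U. Suc (card (Q x)))"
    by (rule order_trans[OF card_UN_le[OF finU] sum_mono[OF e(4)]])
  also have "(\<Sum>x\<in>U. Suc (card (Q x))) = card U + (\<Sum>x\<in>U. card (Q x))"
    using sum.distrib[of "\<lambda>_. 1 :: nat" "\<lambda>x. card (Q x)" U] by simp
  also have "(\<Sum>x\<in>U. card (Q x)) = card (\<Union>x\<in>U. Q x)"
    by (rule card_UN_disjoint[symmetric, OF finU]) (use finQ disj in \<open>auto simp: U_def\<close>)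
  finally have "card N \<le> card M - card (\<Union>x\<in>U. Q x) + (card U + card (\<Union>x\<in>U. Q x))" by simp
  moreover have "card (\<Union>x\<in>U. Q x) \<le> card M" by (rule card_mono[OF finM]) (use QM in blast)
  moreover have "card U = n - card M"
    unfolding U_def using card_Diff_subset[OF finite_imageI[OF finM] MV(1)] card_image[OF M(2)] by simp
  moreover have "card M \<le> n" using card_mono[OF _ MV(1)] card_image[OF M(2)] by simp
  ultimately have le: "card N \<le> n" by linarith
  then show "card N = n" using card_image_le[OF finN, of fst] f by simp
  then show "inj_on fst N" "inj_on snd N"
    using finN f s by (auto intro!: eq_card_imp_inj_on)
qed

section \<open>Connecting a pair of uncovered vertices\<close>

lemma card_matched_in:
  assumes "N \<subseteq> {1..n} \<times> {1..n :: nat}" "inj_on f N" "f ` N \<subseteq> {1..n}" "Y \<subseteq> {1..n}"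
  shows "card Y + card N \<le> n + card {m \<in> N. f m \<in> Y}"
proof -
  have fin: "finite N" "finite Y" using assms(1,4) finite_subset by blast+
  have "card Y + card (f ` N) = card (Y \<union> f ` N) + card (Y \<inter> f ` N)"
    using fin by (intro card_Un_Int) auto
  moreover have "card (Y \<union> f ` N) \<le> n"
    using card_mono[of "{1..n}" "Y \<union> f ` N"] assms(3,4) by simp
  moreover have "Y \<inter> f ` N = f ` {m \<in> N. f m \<in> Y}" by auto
  then have "card (Y \<inter> f ` N) = card {m \<in> N. f m \<in> Y}"
    by (simp only:) (rule card_image, rule inj_on_subset[OF assms(2)], auto)
  ultimately show ?thesis using card_image[OF assms(2)] by linarith
qed

context quasirandom
begin

lemma slack_ln: "slack n * ln (real n) = real n / 1000000000000"
  unfolding slack_def using ln_pos by simp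

lemma slack_small: "slack n \<le> real n / 1000000000000"
proof -
  have "slack n * 1 \<le> slack n * ln (real n)" by (rule mult_left_mono) (use slack_pos ln_large in auto)
  then show ?thesis using slack_ln by simp
qed

text \<open>Here d/5 > d/6 enters. Of the 19/100 d reserved edges at \<open>x\<close>, at most d/6
  lie in \<open>H\<close>, d/1000 lead to uncovered vertices, and 2/1000 d are excluded by
  \<open>Z\<close>, \<open>W\<close> or \<open>C\<close>; this leaves more than 2/100 d.\<close>

lemma good_degree:
  assumes x: "x \<in> {1..n}" and M: "M \<subseteq> {1..n} \<times> {1..n}"
    and nice: "real (card (hits \<omega> {x} ({1..n} - snd ` M) {1..3 * n div 5})) \<le> d / 1000"
    and H: "real (card (hits \<omega> {x} {1..n} {1..3 * n div 5} \<inter> H)) \<le> d / 6"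
    and bad: "real (card (hits \<omega> {x} (snd ` Z \<union> snd ` {m \<in> M. fst m \<in> W}) {1..3 * n})) +
      real (card (hits \<omega> {x} {1..n} C)) \<le> 2 / 1000 * d"
    and Z: "Z \<subseteq> M"
  shows "3 / 1000 * d \<le> real (card {e \<in> {e \<in> hits \<omega> {1..n} {1..n} ({1..3 * n div 5} - C) - H.
    snd e \<in> snd ` {m \<in> M - Z. fst m \<notin> W}}. fst e = x})"
proof -
  let ?R = "{1..3 * n div 5}" and ?V = "{1..n}"
  let ?L = "{e \<in> {e \<in> hits \<omega> ?V ?V (?R - C) - H. snd e \<in> snd ` {m \<in> M - Z. fst m \<notin> W}}. fst e = x}"
  let ?S1 = "hits \<omega> {x} ?V ?R \<inter> H" and ?S2 = "hits \<omega> {x} (?V - snd ` M) ?R"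
    and ?S3 = "hits \<omega> {x} (snd ` Z \<union> snd ` {m \<in> M. fst m \<in> W}) {1..3 * n}" and ?S4 = "hits \<omega> {x} ?V C"
  have "hits \<omega> {x} ?V ?R \<subseteq> ?L \<union> (?S1 \<union> (?S2 \<union> (?S3 \<union> ?S4)))"
  proof
    fix e assume "e \<in> hits \<omega> {x} ?V ?R"
    then obtain y c where e: "e = (x, y)" "y \<in> ?V" "c \<in> ?R" "\<omega> e = Some c" by (auto simp: hits_def)
    have cK: "c \<in> {1..3 * n}" using e(3) by auto
    consider "e \<in> H" | "y \<notin> snd ` M" | "y \<in> snd ` Z" | m where "m \<in> M - Z" "snd m = y" using e(2) by blast
    then show "e \<in> ?L \<union> (?S1 \<union> (?S2 \<union> (?S3 \<union> ?S4)))"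
    proof cases
      case 1 then have "e \<in> ?S1" using e by (simp add: hits_def) then show ?thesis by blast
    next
      case 2 then have "e \<in> ?S2" using e by (simp add: hits_def) then show ?thesis by blast
    next
      case 3 then have "e \<in> ?S3" using e cK by (simp add: hits_def) then show ?thesis by blast
    next
      case 4
      consider (w) "fst m \<in> W" | (c) "c \<in> C" | (h) "e \<in> H" | (l) "fst m \<notin> W" "c \<notin> C" "e \<notin> H" by blast
      then show ?thesis
      proof cases
        case w
        then have "y \<in> snd ` {m \<in> M. fst m \<in> W}" using 4 by blast
        then have "e \<in> ?S3" using e cK by (simp add: hits_def) then show ?thesis by blast
      next
        case c then have "e \<in> ?S4" using e by (simp add: hits_def) then show ?thesis by blast
      next
        case h then have "e \<in> ?S1" using e by (simp add: hits_def) then show ?thesis by blast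
      next
        case l
        have "y \<in> snd ` {m \<in> M - Z. fst m \<notin> W}" using 4 l(1) by blast
        then have "e \<in> ?L" using e l x by (simp add: hits_def) then show ?thesis by blast
      qed
    qed
  qed
  moreover have "finite ?L" by (rule finite_subset[of _ "?V \<times> ?V"]) (auto simp: hits_def)
  moreover have "finite ?S1" "finite ?S2" "finite ?S4" by (auto intro!: finite_hits)
  moreover have "finite ?S3"
    using M Z finite_subset[of M "?V \<times> ?V"] finite_subset[of Z M] by (intro finite_hits) auto
  ultimately have "card (hits \<omega> {x} ?V ?R) \<le> card (?L \<union> (?S1 \<union> (?S2 \<union> (?S3 \<union> ?S4))))"
    by (intro card_mono) auto
  also have "\<dots> \<le> card ?L + (card ?S1 + (card ?S2 + (card ?S3 + card ?S4)))"
    by (meson card_Un_le add_left_mono order_trans)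
  finally have "real (card (hits \<omega> {x} ?V ?R)) \<le> real (card ?L) + (real (card ?S1) + (real (card ?S2) + (real (card ?S3) + real (card ?S4))))"
    by linarith
  then show ?thesis using reserved_degree[OF x] nice H bad d_pos by linarith
qed

end

lemma real_card_UN_le:
  assumes "finite I"
  shows "real (card (\<Union>i\<in>I. A i)) \<le> (\<Sum>i\<in>I. real (card (A i)))"
  using of_nat_mono[OF card_UN_le[OF assms, of A], where ?'a = real] by simp

lemma notin_UnI: "x \<notin> S \<Longrightarrow> A \<subseteq> S \<Longrightarrow> B \<subseteq> S \<Longrightarrow> x \<notin> A \<union> B"
  by blast

lemma disjoint_subsets: "A \<subseteq> A' \<Longrightarrow> B \<subseteq> B' \<Longrightarrow> A' \<inter> B' = {} \<Longrightarrow> A \<inter> B = {}"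
  by blast

text \<open>\<open>H\<close> consists of the edges that must not be used: those of all the maximal matchings and of the
  perfect matchings completed before.\<close>

locale completion =
  fixes n :: nat and d :: real and \<omega> :: "nat \<times> nat \<Rightarrow> nat option" and M H :: "(nat \<times> nat) set"
  assumes quasirandom: "quasirandom n d \<omega>" and quasirandom_swap: "quasirandom n d (\<omega> \<circ> prod.swap)"
    and M: "M \<subseteq> {1..n} \<times> {1..n}" "inj_on fst M" "inj_on snd M" "inj_on \<omega> M"
      "\<omega> ` M \<subseteq> Some ` {3 * n div 5<..3 * n}" "real n - slack n < real (card M)"
    and nice: "\<And>x. x \<in> {1..n} \<Longrightarrow> real (card (hits \<omega> {x} ({1..n} - snd ` M) {1..3 * n div 5})) \<le> d / 1000"
    and nice_swap: "\<And>y. y \<in> {1..n} \<Longrightarrow>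
      real (card (hits (\<omega> \<circ> prod.swap) {y} ({1..n} - fst ` M) {1..3 * n div 5})) \<le> d / 1000"
    and H_reserved: "\<And>x. x \<in> {1..n} \<Longrightarrow> real (card (hits \<omega> {x} {1..n} {1..3 * n div 5} \<inter> H)) \<le> d / 6"
    and H_reserved_swap: "\<And>y. y \<in> {1..n} \<Longrightarrow>
      real (card (hits (\<omega> \<circ> prod.swap) {y} {1..n} {1..3 * n div 5} \<inter> prod.swap ` H)) \<le> d / 6"
    and H_sparse: "\<And>A. A \<subseteq> {1..n} \<Longrightarrow> real n / 2000000000 \<le> real (card A) \<Longrightarrow>
      real (card (H \<inter> A \<times> {1..n})) \<le> 17 / 100 * d * real (card A)"
    and H_sparse_swap: "\<And>B. B \<subseteq> {1..n} \<Longrightarrow> real n / 2000000000 \<le> real (card B) \<Longrightarrow>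
      real (card (prod.swap ` H \<inter> B \<times> {1..n})) \<le> 17 / 100 * d * real (card B)"
begin

sublocale X: quasirandom n d \<omega> by (rule quasirandom)

interpretation Y: quasirandom n d "\<omega> \<circ> prod.swap" by (rule quasirandom_swap)

lemma finite_M: "finite M" using M(1) finite_subset by blast

lemma card_M_le: "card M \<le> n"
proof -
  have "fst ` M \<subseteq> {1..n}" using M(1) by auto
  then show ?thesis using card_mono[of "{1..n}" "fst ` M"] card_image[OF M(2)] by simp
qed

text \<open>Trees are doubled until a further round would leave the range of the sparsity
  conditions. Then 2 ^ k lies between n / 2000000000 and n / 1000000000, and 2 k + 2 bounds the
  edges of two tree paths and the two edges that join them.\<close>

lemma doubling_exponent:
  obtains k where "20 * 2 ^ k > real n / 100000000" "\<And>i. i < k \<Longrightarrow> 20 * 2 ^ i \<le> real n / 100000000"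
    "20 * 2 ^ k \<le> 2 * (real n / 100000000)" "2 * real k + 2 \<le> 4 * ln (real n)"
proof -
  let ?P = "\<lambda>k. real n / 100000000 < 20 * 2 ^ k"
  have "\<exists>k0. real n / 100000000 < 2 ^ k0" by (rule real_arch_pow) simp
  then obtain k0 :: nat where "real n / 100000000 < 2 ^ k0" by blast
  moreover have "(2 :: real) ^ k0 \<le> 20 * 2 ^ k0" by simp
  ultimately have "?P k0" by linarith
  then obtain k where k: "?P k" "\<And>i. i < k \<Longrightarrow> \<not> ?P i" using exists_least_iff[of ?P] by blast
  have "k \<noteq> 0"
  proof
    assume "k = 0"
    then show False using k(1) X.n_large by simp
  qed
  then obtain j where j: "k = Suc j" by (cases k) auto
  then have pj: "20 * 2 ^ j \<le> real n / 100000000" using k(2)[of j] by simp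
  then have up: "20 * 2 ^ k \<le> 2 * (real n / 100000000)" using j by simp
  then have "2 ^ k \<le> real n" using X.n_large by linarith
  then have "ln (2 ^ k) \<le> ln (real n)" by (subst ln_le_cancel_iff) (use X.n_pos in auto)
  then have "real k * ln 2 \<le> ln (real n)" by (simp add: ln_realpow)
  moreover have "real k * (2 / 3) \<le> real k * ln 2" by (rule mult_left_mono) (use ln2_ge_two_thirds in auto)
  ultimately have "2 * real k + 2 \<le> 4 * ln (real n)" using X.ln_large by linarith
  then show ?thesis using that[of k] k up by fastforce
qed

lemma exchange_exists:
  assumes x: "x \<in> {1..n}" "x \<notin> fst ` M" "x \<notin> W" and y: "y \<in> {1..n}" "y \<notin> snd ` M" "y \<notin> W'"
    and Z: "Z \<subseteq> M" "real (card Z) \<le> real n / 100" and C: "C \<subseteq> {1..3 * n}" "real (card C) \<le> real n / 100"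
    and W: "\<And>x. x \<in> {1..n} - W \<Longrightarrow> real (card (hits \<omega> {x} (snd ` Z \<union> snd ` {m \<in> M. fst m \<in> W}) {1..3 * n})) +
      real (card (hits \<omega> {x} {1..n} C)) \<le> 2 / 1000 * d"
    and W': "\<And>y. y \<in> {1..n} - W' \<Longrightarrow>
      real (card (hits (\<omega> \<circ> prod.swap) {y} (snd ` prod.swap ` Z \<union> snd ` {m \<in> prod.swap ` M. fst m \<in> W'}) {1..3 * n})) +
      real (card (hits (\<omega> \<circ> prod.swap) {y} {1..n} C)) \<le> 2 / 1000 * d"
  shows "\<exists>Q P. Q \<subseteq> M - Z \<and> P \<subseteq> hits \<omega> {1..n} {1..n} ({1..3 * n} - C) - H \<and> exchange x y Q P \<and> inj_on \<omega> P \<and>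
    \<omega> ` P \<inter> \<omega> ` M = {} \<and> real (card Q) \<le> 4 * ln (real n) \<and> real (card P) \<le> 4 * ln (real n)"
proof -
  obtain k where k: "20 * 2 ^ k > real n / 100000000" "\<And>i. i < k \<Longrightarrow> 20 * 2 ^ i \<le> real n / 100000000"
    "20 * 2 ^ k \<le> 2 * (real n / 100000000)" "2 * real k + 2 \<le> 4 * ln (real n)"
    using doubling_exponent by blast
  let ?V = "{1..n}" and ?R = "{1..3 * n div 5} - C" and ?\<omega>' = "\<omega> \<circ> prod.swap"
  define M0 where "M0 = M - Z"
  define L where "L = {e \<in> hits \<omega> ?V ?V ?R - H. snd e \<in> snd ` {m \<in> M - Z. fst m \<notin> W}}"
  define L' where "L' = {e \<in> hits ?\<omega>' ?V ?V ?R - prod.swap ` H.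
    snd e \<in> snd ` {m \<in> prod.swap ` M - prod.swap ` Z. fst m \<notin> W'}}"
  have finM0: "finite M0" and M0V: "M0 \<subseteq> ?V \<times> ?V" using finite_M M(1) by (auto simp: M0_def)
  have M0: "inj_on fst M0" "inj_on snd M0" using M(2,3) inj_on_diff by (auto simp: M0_def)
  have swapM: "prod.swap ` M \<subseteq> ?V \<times> ?V" using M(1) by auto
  have swapM0: "prod.swap ` M - prod.swap ` Z = prod.swap ` M0"
    unfolding M0_def by (simp add: image_set_diff)
  have x0: "x \<notin> fst ` M0" and y0: "y \<notin> snd ` M0" using x(2) y(2) by (auto simp: M0_def)
  have deg: "3 / 1000 * d \<le> real (card {e \<in> L. fst e = z})" if z: "z \<in> ?V - W" for z
    unfolding L_def by (rule X.good_degree[OF _ M(1) nice H_reserved W Z(1)]) (use z in auto)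
  have deg': "3 / 1000 * d \<le> real (card {e \<in> L'. fst e = z})" if z: "z \<in> ?V - W'" for z
    unfolding L'_def
    by (rule Y.good_degree[OF _ swapM _ H_reserved_swap W' image_mono[OF Z(1)]])
      (use z nice_swap[of z] in \<open>auto simp: image_swap\<close>)
  have LR: "\<omega> ` L \<subseteq> Some ` ?R" "?\<omega>' ` L' \<subseteq> Some ` ?R" by (auto simp: L_def L'_def hits_def)
  have RK: "?R \<subseteq> {1..3 * n}" by auto
  have L: "L \<subseteq> ?V \<times> ?V" "\<omega> ` L \<subseteq> Some ` {1..3 * n}" "snd ` L \<subseteq> snd ` {m \<in> M0. fst m \<notin> W}"
    using order_trans[OF LR(1) image_mono[OF RK]] by (auto simp: L_def hits_def M0_def)
  have L': "L' \<subseteq> ?V \<times> ?V" "?\<omega>' ` L' \<subseteq> Some ` {1..3 * n}" "snd ` L' \<subseteq> snd ` {m \<in> prod.swap ` M0. fst m \<notin> W'}"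
    using order_trans[OF LR(2) image_mono[OF RK]] unfolding L'_def swapM0 by (auto simp: hits_def)
  have "\<exists>TQ TP TQ' TP'. grown \<omega> M0 L W x k TQ TP \<and> grown ?\<omega>' (prod.swap ` M0) L' W' y k TQ' TP' \<and>
      TQ \<inter> prod.swap ` TQ' = {} \<and> \<omega> ` TP \<inter> ?\<omega>' ` TP' = {}"
    by (rule two_grown_trees[OF quasirandom quasirandom_swap M0V M0 x(1,3) x0 y(1,3) y0 L L'])
      (fact deg deg' k(2))+
  then obtain TQ TP TQ' TP' where T: "grown \<omega> M0 L W x k TQ TP" "grown ?\<omega>' (prod.swap ` M0) L' W' y k TQ' TP'"
    "TQ \<inter> prod.swap ` TQ' = {}" "\<omega> ` TP \<inter> ?\<omega>' ` TP' = {}" by blast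
  have T1: "TQ \<subseteq> M0" "fst ` TQ \<inter> W = {}" "TP \<subseteq> L" "inj_on \<omega> TP" "card TQ = 2 ^ k - 1" "tree k x TQ TP"
    using T(1) by (simp_all add: grown_def)
  have T2: "TQ' \<subseteq> prod.swap ` M0" "fst ` TQ' \<inter> W' = {}" "TP' \<subseteq> L'" "inj_on ?\<omega>' TP'" "card TQ' = 2 ^ k - 1" "tree k y TQ' TP'"
    using T(2) by (simp_all add: grown_def)
  have finT: "finite TQ" "finite TQ'" using T1(1) T2(1) finM0 finite_subset by blast+
  have TQ'M: "prod.swap ` TQ' \<subseteq> M0" using T2(1) by auto
  define A where "A = insert x (fst ` TQ)"
  define B where "B = insert y (fst ` TQ')"
  have "x \<notin> fst ` TQ" "y \<notin> fst ` TQ'"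
    using x0 y0 T1(1) image_mono[OF T2(1), of fst] unfolding image_swap by blast+
  moreover have "card (fst ` TQ) = 2 ^ k - 1" "card (fst ` TQ') = 2 ^ k - 1"
    using card_image[OF inj_on_subset[OF M0(1) T1(1)]] T1(5) T2(5)
      card_image[OF inj_on_subset[of fst "prod.swap ` M0", OF _ T2(1)]] M0(2) by (simp_all add: inj_on_swap)
  ultimately have cAB: "card A = 2 ^ k" "card B = 2 ^ k" using finT by (simp_all add: A_def B_def)
  have "fst ` M0 \<subseteq> ?V" "snd ` M0 \<subseteq> ?V" using M0V by auto
  then have "fst ` TQ \<subseteq> ?V" "fst ` TQ' \<subseteq> ?V"
    using order_trans[OF image_mono[OF T1(1), of fst], of ?V] order_trans[OF image_mono[OF T2(1), of fst], of ?V]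
    unfolding image_swap by blast+
  then have AV: "A \<subseteq> ?V" "B \<subseteq> ?V" using x(1) y(1) by (simp_all add: A_def B_def)
  have two_k: "real n / 2000000000 \<le> 2 ^ k" "2 ^ k \<le> real n / 1000000000" using k(1,3) by simp_all
  have big: "real n / 2000000000 \<le> real (card A)" "real n / 2000000000 \<le> real (card B)"
    using two_k cAB by simp_all
  have sl: "slack n \<le> real n / 2000000000" using X.slack_small X.n_pos by linarith
  \<comment> \<open>Colors for the joining edges: 7n/5 - n/100 of them are left, still above the
    27n/20 needed.\<close>
  define D where "D = {c \<in> {3 * n div 5<..3 * n}. Some c \<notin> \<omega> ` M} - C"
  have "7 * n \<le> 5 * card {c \<in> {3 * n div 5<..3 * n}. Some c \<notin> \<omega> ` M}"
    by (rule card_unused_colors[OF finite_M M(4,5) card_M_le])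
  moreover have "card {c \<in> {3 * n div 5<..3 * n}. Some c \<notin> \<omega> ` M} - card C \<le> card D"
    unfolding D_def using finite_subset[OF C(1)] by (intro diff_card_le_card_Diff) auto
  ultimately have cD: "27 / 20 * real n \<le> real (card D)" using C(2) by linarith
  have DK: "D \<subseteq> {1..3 * n}" by (auto simp: D_def)
  define Y1 where "Y1 = {y \<in> ?V. \<exists>a\<in>A. \<exists>a'\<in>A. \<exists>c\<in>D. \<exists>c'\<in>D. c \<noteq> c' \<and>
    \<omega> (a, y) = Some c \<and> \<omega> (a', y) = Some c' \<and> (a, y) \<notin> H \<and> (a', y) \<notin> H}"
  define X2 where "X2 = {y \<in> ?V. \<exists>a\<in>B. \<exists>a'\<in>B. \<exists>c\<in>D. \<exists>c'\<in>D. c \<noteq> c' \<and>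
    ?\<omega>' (a, y) = Some c \<and> ?\<omega>' (a', y) = Some c' \<and> (a, y) \<notin> prod.swap ` H \<and> (a', y) \<notin> prod.swap ` H}"
  have Y1: "11 / 20 * real n \<le> real (card Y1)"
    unfolding Y1_def by (rule X.card_twice_reached[OF AV(1) _ DK cD H_sparse[OF AV(1) big(1)]]) (use sl big in linarith)
  have X2: "11 / 20 * real n \<le> real (card X2)"
    unfolding X2_def by (rule Y.card_twice_reached[OF AV(2) _ DK cD H_sparse_swap[OF AV(2) big(2)]]) (use sl big in linarith)
  have Y1D: "\<exists>a\<in>A. \<exists>c\<in>D. c \<noteq> c0 \<and> \<omega> (a, v) = Some c \<and> (a, v) \<notin> H" if "v \<in> Y1" for v c0
  proof -
    from \<open>v \<in> Y1\<close> obtain a a' c c' where "a \<in> A" "a' \<in> A" "c \<in> D" "c' \<in> D" "c \<noteq> c'"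
      "\<omega> (a, v) = Some c" "\<omega> (a', v) = Some c'" "(a, v) \<notin> H" "(a', v) \<notin> H"
      unfolding Y1_def by blast
    then show ?thesis by (cases "c = c0") auto
  qed
  have X2D: "\<exists>b\<in>B. \<exists>c\<in>D. \<omega> (v, b) = Some c \<and> (v, b) \<notin> H" if "v \<in> X2" for v
  proof -
    from \<open>v \<in> X2\<close> obtain b c where "b \<in> B" "c \<in> D" "?\<omega>' (b, v) = Some c" "(b, v) \<notin> prod.swap ` H"
      unfolding X2_def by blast
    moreover from this(4) have "(v, b) \<notin> H" by (metis image_eqI swap_simp)
    ultimately show ?thesis by auto
  qed
  define N where "N = M0 - (TQ \<union> prod.swap ` TQ')"
  have NM: "N \<subseteq> M" "N \<subseteq> ?V \<times> ?V" using M(1) by (auto simp: N_def M0_def)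
  have finN: "finite N" using NM(1) finite_M finite_subset by blast
  have "card M - card Z \<le> card M0"
    unfolding M0_def using finite_subset[OF Z(1) finite_M] by (rule diff_card_le_card_Diff)
  moreover have "card M0 - card (TQ \<union> prod.swap ` TQ') \<le> card N"
    unfolding N_def using finT by (intro diff_card_le_card_Diff) simp
  moreover have "card (TQ \<union> prod.swap ` TQ') \<le> 2 * 2 ^ k"
    using card_Un_le[of TQ "prod.swap ` TQ'"] T1(5) T2(5) by (simp add: card_image)
  ultimately have "real (card M) \<le> real (card N) + real (card Z) + 2 * 2 ^ k"
    using of_nat_mono[of "card M" "card N + card Z + 2 * 2 ^ k", where ?'a = real] by simp
  then have cN: "97 / 100 * real n \<le> real (card N)"
    using M(6) sl Z(2) two_k by linarith
  have NV: "fst ` N \<subseteq> ?V" "snd ` N \<subseteq> ?V" using NM(2) by auto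
  have Y1V: "Y1 \<subseteq> ?V" "X2 \<subseteq> ?V" by (auto simp: Y1_def X2_def)
  define N1 where "N1 = {m \<in> N. snd m \<in> Y1}"
  define N2 where "N2 = {m \<in> N. fst m \<in> X2}"
  have "card Y1 + card N \<le> n + card N1" unfolding N1_def
    by (rule card_matched_in[OF NM(2) inj_on_subset[OF M(3) NM(1)] NV(2) Y1V(1)])
  moreover have "card X2 + card N \<le> n + card N2" unfolding N2_def
    by (rule card_matched_in[OF NM(2) inj_on_subset[OF M(2) NM(1)] NV(1) Y1V(2)])
  moreover have "card N \<le> card M" by (rule card_mono[OF finite_M NM(1)])
  moreover have "card (N1 \<union> N2) \<le> card N" using finN by (intro card_mono) (auto simp: N1_def N2_def)
  \<comment> \<open>Both \<open>N1\<close> and \<open>N2\<close> have at least 11n/20 + |N| - n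
    elements. Their sum exceeds |N| because |N| >= 97n/100.\<close>
  ultimately have "N1 \<inter> N2 \<noteq> {}"
    using cN Y1 X2 card_M_le X.n_pos card_Un_disjoint[of N1 N2] finN
    by (intro notI) (simp add: N1_def N2_def; linarith)
  then obtain m where "m \<in> N1" "m \<in> N2" by blast
  moreover obtain x1 y1 where "m = (x1, y1)" by fastforce
  ultimately have m: "(x1, y1) \<in> N" "y1 \<in> Y1" "x1 \<in> X2" by (simp_all add: N1_def N2_def)
  obtain b c' where b: "b \<in> B" "c' \<in> D" "\<omega> (x1, b) = Some c'" "(x1, b) \<notin> H" using X2D[OF m(3)] by blast
  obtain a c where a: "a \<in> A" "c \<in> D" "c \<noteq> c'" "\<omega> (a, y1) = Some c" "(a, y1) \<notin> H" using Y1D[OF m(2)] by blast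
  obtain Q1 P1 where s1: "Q1 \<subseteq> TQ" "P1 \<subseteq> TP" "card Q1 \<le> k" "segment x a Q1 P1"
    using T1(6) a(1) unfolding tree_def A_def by blast
  obtain Q2 P2 where s2: "Q2 \<subseteq> TQ'" "P2 \<subseteq> TP'" "card Q2 \<le> k" "segment y b Q2 P2"
    using T2(6) b(1) unfolding tree_def B_def by blast
  have finQ: "finite Q1" "finite Q2" using s1(1) s2(1) finT finite_subset by blast+
  let ?Q = "insert (x1, y1) (Q1 \<union> prod.swap ` Q2)"
  let ?P = "insert (a, y1) (insert (x1, b) (P1 \<union> prod.swap ` P2))"
  have mT: "(x1, y1) \<notin> TQ" "(x1, y1) \<notin> prod.swap ` TQ'" using m(1) by (auto simp: N_def)
  have ex: "exchange x y ?Q ?P"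
    by (rule join_segments[OF s1(4) s2(4) _ _ _ finQ]) (use mT s1(1) image_mono[OF s2(1), of prod.swap] T(3) in blast)+
  have cQ: "card ?Q \<le> 2 * k + 1"
    using card_Un_le[of Q1 "prod.swap ` Q2"] s1(3) s2(3) card_insert_le_m1[of "2 * k + 1" "Q1 \<union> prod.swap ` Q2" "(x1, y1)"]
    by (simp add: card_image)
  have cP: "card ?P \<le> 2 * k + 2" using ex cQ unfolding exchange_def by linarith
  have "?Q \<subseteq> M - Z"
    using m(1) s1(1) T1(1) image_mono[OF s2(1), of prod.swap] TQ'M unfolding N_def M0_def by blast
  moreover have P1L: "P1 \<subseteq> L" using s1(2) T1(3) by blast
  have P2L: "P2 \<subseteq> L'" using s2(2) T2(3) by blast
  have "?P \<subseteq> hits \<omega> ?V ?V ({1..3 * n} - C) - H"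
  proof -
    have "L \<subseteq> hits \<omega> ?V ?V ({1..3 * n} - C) - H" by (auto simp: L_def hits_def)
    moreover have "prod.swap ` L' \<subseteq> hits \<omega> ?V ?V ({1..3 * n} - C) - H" by (auto simp: L'_def hits_def)
    moreover have "(a, y1) \<in> hits \<omega> ?V ?V ({1..3 * n} - C) - H" "(x1, b) \<in> hits \<omega> ?V ?V ({1..3 * n} - C) - H"
    proof -
      have "c \<in> {1..3 * n} - C" "c' \<in> {1..3 * n} - C" using a(2) b(2) DK by (auto simp: D_def)
      moreover have "a \<in> ?V" "b \<in> ?V" "x1 \<in> ?V" "y1 \<in> ?V" using a(1) b(1) AV m(2,3) Y1V by blast+
      ultimately show "(a, y1) \<in> hits \<omega> ?V ?V ({1..3 * n} - C) - H" "(x1, b) \<in> hits \<omega> ?V ?V ({1..3 * n} - C) - H"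
        using a(4,5) b(3,4) by (simp_all add: hits_def)
    qed
    ultimately show ?thesis using P1L image_mono[OF P2L, of prod.swap] by blast
  qed
  moreover have D: "Some z \<notin> Some ` ?R" "Some z \<notin> \<omega> ` M" if "z \<in> D" for z using that by (auto simp: D_def)
  have P2\<omega>: "\<omega> ` prod.swap ` P2 = ?\<omega>' ` P2" by (simp add: image_image)
  have col: "\<omega> ` P1 \<subseteq> Some ` ?R" "\<omega> ` prod.swap ` P2 \<subseteq> Some ` ?R"
    unfolding P2\<omega> by (rule order_trans[OF image_mono[OF P1L] LR(1)], rule order_trans[OF image_mono[OF P2L] LR(2)])
  have inj: "inj_on \<omega> ?P"
  proof -
    have "inj_on \<omega> P1" by (rule inj_on_subset[OF T1(4) s1(2)])
    moreover have "inj_on \<omega> (prod.swap ` P2)"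
      using inj_on_subset[OF T2(4) s2(2)] by (simp add: comp_inj_on_iff)
    moreover have "\<omega> ` P1 \<inter> \<omega> ` prod.swap ` P2 = {}"
      unfolding P2\<omega> by (rule disjoint_subsets[OF image_mono[OF s1(2)] image_mono[OF s2(2)] T(4)])
    ultimately have "inj_on \<omega> (P1 \<union> prod.swap ` P2)" by (auto simp: inj_on_Un)
    moreover have "\<omega> (x1, b) \<notin> \<omega> ` (P1 \<union> prod.swap ` P2)"
      unfolding b(3) image_Un by (rule notin_UnI[OF D(1)[OF b(2)] col])
    moreover have "\<omega> (a, y1) \<notin> \<omega> ` insert (x1, b) (P1 \<union> prod.swap ` P2)"
      unfolding a(4) image_insert b(3) image_Un using notin_UnI[OF D(1)[OF a(2)] col] a(3) by simp
    ultimately show ?thesis by (simp only: inj_on_insert_fresh not_False_eq_True)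
  qed
  moreover have "\<omega> ` ?P \<inter> \<omega> ` M = {}"
  proof -
    have "Some ` ?R \<inter> Some ` {3 * n div 5<..3 * n} = {}" by auto
    from disjoint_subsets[OF col(1) M(5) this] disjoint_subsets[OF col(2) M(5) this]
    show ?thesis unfolding image_insert a(4) b(3) image_Un Int_Un_distrib2 Int_insert_left
      using D(2)[OF a(2)] D(2)[OF b(2)] by simp
  qed
  moreover have "real (card ?Q) \<le> 4 * ln (real n)" "real (card ?P) \<le> 4 * ln (real n)"
    using cQ cP k(4) by linarith+
  ultimately show ?thesis using ex by blast
qed

text \<open>The hypergraph has the edges of \<open>M\<close> and the colors as vertices, and an
  exchange of \<open>x\<close> and \<open>h x\<close> as a hyperedge. Disjointness in the first kind
  lets all exchanges be made at once, disjointness in the second keeps the result rainbow.\<close>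

theorem complete_matching:
  "\<exists>N \<subseteq> {1..n} \<times> {1..n}. inj_on fst N \<and> inj_on snd N \<and> inj_on \<omega> N \<and> fst ` N = {1..n} \<and> snd ` N = {1..n} \<and>
    \<omega> ` N \<subseteq> Some ` {1..3 * n} \<and> (N - M) \<inter> H = {} \<and> real (card (N - M)) \<le> 4 / 1000000000000 * real n"
proof -
  let ?V = "{1..n}" and ?l = "4 * ln (real n)"
  define U where "U = ?V - fst ` M"
  have MV: "fst ` M \<subseteq> ?V" "snd ` M \<subseteq> ?V" using M(1) by auto
  have cU: "card U = n - card M" "card (?V - snd ` M) = n - card M"
    unfolding U_def using card_Diff_subset[OF finite_imageI[OF finite_M] MV(1)] card_image[OF M(2)]
      card_Diff_subset[OF finite_imageI[OF finite_M] MV(2)] card_image[OF M(3)] by simp_all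
  have finU: "finite U" by (simp add: U_def)
  obtain h where h: "bij_betw h U (?V - snd ` M)"
    using finite_same_card_bij[of U "?V - snd ` M"] cU finU by auto
  have Usl: "real (card U) \<le> slack n" using cU(1) M(6) card_M_le by (simp add: of_nat_diff)
  have swapM: "prod.swap ` M \<subseteq> ?V \<times> ?V" "inj_on fst (prod.swap ` M)" using M(1,3) by (auto simp: inj_on_swap)
  define ok where "ok x Q P \<longleftrightarrow> Q \<subseteq> M \<and> P \<subseteq> hits \<omega> ?V ?V {1..3 * n} - H \<and> exchange x (h x) Q P \<and> inj_on \<omega> P \<and>
    \<omega> ` P \<inter> \<omega> ` M = {} \<and> real (card Q) \<le> ?l \<and> real (card P) \<le> ?l" for x Q P
  define body where "body Q P = Inl ` Q \<union> Inr ` \<omega> ` P" for Q P :: "(nat \<times> nat) set"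
  define F where "F x = {body Q P | Q P. ok x Q P}" for x
  have "\<exists>g. (\<forall>x\<in>U. g x \<in> F x) \<and> (\<forall>x\<in>U. \<forall>x'\<in>U. x \<noteq> x' \<longrightarrow> g x \<inter> g x' = {})"
  proof (rule disjoint_transversal[OF finU])
    fix J \<Z>
    assume J: "J \<subseteq> U" "J \<noteq> {}" and \<Z>: "finite \<Z>" "\<Z> \<subseteq> (\<Union>x\<in>U. F x)" "card \<Z> \<le> 2 * (card J - 1)"
    define s where "s = card J"
    have finJ: "finite J" using J(1) finU finite_subset by blast
    have s0: "0 < s" using J(2) finJ by (simp add: s_def card_gt_0_iff)
    have "s \<le> card U" unfolding s_def using J(1) finU by (rule card_mono[rotated])
    then have ssl: "real s \<le> slack n" using Usl by linarith
    define Z where "Z = (\<Union>z\<in>\<Z>. {q. Inl q \<in> z})"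
    define C where "C = (\<Union>z\<in>\<Z>. {c. Inr (Some c) \<in> z})"
    have z: "{q. Inl q \<in> z} \<subseteq> M \<and> real (card {q. Inl q \<in> z}) \<le> ?l \<and> {c. Inr (Some c) \<in> z} \<subseteq> {1..3 * n} \<and>
      real (card {c. Inr (Some c) \<in> z}) \<le> ?l" if "z \<in> \<Z>" for z
    proof -
      obtain x Q P where zQ: "z = body Q P" "ok x Q P" using \<open>z \<in> \<Z>\<close> \<Z>(2) by (auto simp: F_def)
      have eq: "{q. Inl q \<in> z} = Q" "{c. Inr (Some c) \<in> z} = {c. Some c \<in> \<omega> ` P}"
        unfolding zQ(1) body_def by auto
      have P: "P \<subseteq> hits \<omega> ?V ?V {1..3 * n}" "finite P" "real (card P) \<le> ?l" "Q \<subseteq> M" "real (card Q) \<le> ?l"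
        using zQ(2) by (auto simp: ok_def exchange_def)
      have "\<omega> ` hits \<omega> ?V ?V {1..3 * n} \<subseteq> Some ` {1..3 * n}" by (auto simp: hits_def)
      from colors_subset[OF this P(1)] card_colors_le[OF P(2), of \<omega>] P(3-5) show ?thesis
        unfolding eq by auto
    qed
    \<comment> \<open>At most 2 s hyperedges, each with up to 4 ln n matching edges and as many
      colors: this is the origin of 8 s ln n in \<open>closed_small_set\<close>.\<close>
    have "real (card \<Z>) * ?l \<le> real (2 * s) * ?l"
      by (rule mult_right_mono) (use \<Z>(3) X.ln_pos in \<open>auto simp: s_def\<close>)
    then have b: "real (card \<Z>) * ?l \<le> 8 * real s * ln (real n)" by simp
    have "real (card Z) \<le> (\<Sum>z\<in>\<Z>. real (card {q. Inl q \<in> z}))"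
      unfolding Z_def by (rule real_card_UN_le[OF \<Z>(1)])
    also have "\<dots> \<le> real (card \<Z>) * ?l" using z by (intro sum_bounded_above) blast
    finally have cZ: "real (card Z) \<le> 8 * real s * ln (real n)" using b by linarith
    have "real (card C) \<le> (\<Sum>z\<in>\<Z>. real (card {c. Inr (Some c) \<in> z}))"
      unfolding C_def by (rule real_card_UN_le[OF \<Z>(1)])
    also have "\<dots> \<le> real (card \<Z>) * ?l" using z by (intro sum_bounded_above) blast
    finally have cC: "real (card C) \<le> 8 * real s * ln (real n)" using b by linarith
    have "real s * ln (real n) \<le> slack n * ln (real n)" by (rule mult_right_mono[OF ssl]) (use X.ln_pos in simp)
    then have small: "8 * real s * ln (real n) \<le> real n / 100" using X.slack_ln by linarith
    have ZM: "Z \<subseteq> M" and CK: "C \<subseteq> {1..3 * n}" using z by (auto simp: Z_def C_def)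
    have finZ: "finite Z" using ZM finite_M finite_subset by blast
    have "real (card (snd ` Z)) \<le> real (card Z)" "real (card (snd ` prod.swap ` Z)) \<le> real (card Z)"
      unfolding image_swap using card_image_le[OF finZ, of snd] card_image_le[OF finZ, of fst] by simp_all
    then have cZ': "real (card (snd ` Z)) \<le> 8 * real s * ln (real n)"
      "real (card (snd ` prod.swap ` Z)) \<le> 8 * real s * ln (real n)" using cZ by linarith+
    have ZV: "snd ` Z \<subseteq> ?V" "snd ` prod.swap ` Z \<subseteq> ?V" using ZM M(1) by auto
    obtain W where W: "4 * card W < s" "W \<subseteq> ?V" "\<And>x. x \<in> ?V - W \<Longrightarrow>
        real (card (hits \<omega> {x} (snd ` Z \<union> snd ` {m \<in> M. fst m \<in> W}) {1..3 * n})) + real (card (hits \<omega> {x} ?V C)) \<le> 2 / 1000 * d"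
      using X.closed_small_set[OF M(1,2) ZV(1) cZ'(1) CK cC s0 ssl] by blast
    obtain W' where W': "4 * card W' < s" "W' \<subseteq> ?V" "\<And>x. x \<in> ?V - W' \<Longrightarrow>
        real (card (hits (\<omega> \<circ> prod.swap) {x} (snd ` prod.swap ` Z \<union> snd ` {m \<in> prod.swap ` M. fst m \<in> W'}) {1..3 * n})) +
        real (card (hits (\<omega> \<circ> prod.swap) {x} ?V C)) \<le> 2 / 1000 * d"
      using Y.closed_small_set[OF swapM ZV(2) cZ'(2) CK cC s0 ssl] by blast
    have finW: "finite W" "finite W'" using W(2) W'(2) finite_subset by blast+
    have injh: "inj_on h J" using h J(1) unfolding bij_betw_def by (auto intro: inj_on_subset)
    \<comment> \<open>|W| + |W'| < s/2, so some pair with its first vertex in \<open>J\<close>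
      avoids both sets.\<close>
    have "\<exists>x\<in>J. x \<notin> W \<and> h x \<notin> W'"
    proof (rule ccontr)
      assume neg: "\<not> ?thesis"
      have "card J \<le> card ({x \<in> J. x \<in> W} \<union> {x \<in> J. h x \<in> W'})"
        using neg finJ by (intro card_mono) auto
      also have "\<dots> \<le> card {x \<in> J. x \<in> W} + card {x \<in> J. h x \<in> W'}" by (rule card_Un_le)
      also have "card {x \<in> J. x \<in> W} \<le> card W" using finW by (intro card_mono) auto
      also have "card {x \<in> J. h x \<in> W'} = card (h ` {x \<in> J. h x \<in> W'})"
        by (rule card_image[symmetric], rule inj_on_subset[OF injh]) auto
      also have "\<dots> \<le> card W'" using finW by (intro card_mono) auto
      finally show False using W(1) W'(1) unfolding s_def by linarith
    qed
    then obtain x where x: "x \<in> J" "x \<notin> W" "h x \<notin> W'" by blast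
    have xU: "x \<in> ?V" "x \<notin> fst ` M" using x(1) J(1) by (auto simp: U_def)
    have hx: "h x \<in> ?V" "h x \<notin> snd ` M" using h x(1) J(1) unfolding bij_betw_def by blast+
    have "\<exists>Q P. Q \<subseteq> M - Z \<and> P \<subseteq> hits \<omega> ?V ?V ({1..3 * n} - C) - H \<and> exchange x (h x) Q P \<and> inj_on \<omega> P \<and>
      \<omega> ` P \<inter> \<omega> ` M = {} \<and> real (card Q) \<le> ?l \<and> real (card P) \<le> ?l"
      by (rule exchange_exists[OF xU x(2) hx x(3) ZM _ CK _ W(3) W'(3)]) (use cZ cC small in linarith)+
    then obtain Q P where QP: "Q \<subseteq> M - Z" "P \<subseteq> hits \<omega> ?V ?V ({1..3 * n} - C) - H" "exchange x (h x) Q P" "inj_on \<omega> P"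
      "\<omega> ` P \<inter> \<omega> ` M = {}" "real (card Q) \<le> ?l" "real (card P) \<le> ?l" by blast
    have "hits \<omega> ?V ?V ({1..3 * n} - C) - H \<subseteq> hits \<omega> ?V ?V {1..3 * n} - H" by (auto simp: hits_def)
    then have "P \<subseteq> hits \<omega> ?V ?V {1..3 * n} - H" using QP(2) by (rule order_trans[rotated])
    moreover have "Q \<subseteq> M" using QP(1) by blast
    ultimately have "body Q P \<in> F x" using QP(3-7) unfolding F_def ok_def by blast
    moreover have "body Q P \<inter> \<Union>\<Z> = {}"
    proof -
      have "v \<notin> \<Union>\<Z>" if v: "v \<in> body Q P" for v
      proof (cases v)
        case (Inl q)
        then have "q \<in> Q" using v by (auto simp: body_def)
        then have "q \<notin> Z" using QP(1) by blast
        then show ?thesis using Inl by (auto simp: Z_def)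
      next
        case (Inr u)
        then have "u \<in> \<omega> ` P" using v by (auto simp: body_def)
        then obtain p where "p \<in> P" "u = \<omega> p" by blast
        then obtain c where "u = Some c" "c \<notin> C" using QP(2) by (auto simp: hits_def)
        then show ?thesis using Inr by (auto simp: C_def)
      qed
      then show ?thesis by blast
    qed
    ultimately show "\<exists>x\<in>J. \<exists>e\<in>F x. e \<inter> \<Union>\<Z> = {}" using x(1) by blast
  qed
  then obtain g where g: "\<And>x. x \<in> U \<Longrightarrow> g x \<in> F x" "\<And>x x'. x \<in> U \<Longrightarrow> x' \<in> U \<Longrightarrow> x \<noteq> x' \<Longrightarrow> g x \<inter> g x' = {}" by blast
  have "\<forall>x\<in>U. \<exists>QP. ok x (fst QP) (snd QP) \<and> g x = body (fst QP) (snd QP)"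
  proof
    fix x assume "x \<in> U"
    then obtain Q P where "ok x Q P" "g x = body Q P" using g(1) unfolding F_def by blast
    then show "\<exists>QP. ok x (fst QP) (snd QP) \<and> g x = body (fst QP) (snd QP)" by (intro exI[of _ "(Q, P)"]) simp
  qed
  then obtain QP where QP: "\<And>x. x \<in> U \<Longrightarrow> ok x (fst (QP x)) (snd (QP x)) \<and> g x = body (fst (QP x)) (snd (QP x))"
    using bchoice[of U "\<lambda>x QP. ok x (fst QP) (snd QP) \<and> g x = body (fst QP) (snd QP)"] by blast
  define Q where "Q x = fst (QP x)" for x
  define P where "P x = snd (QP x)" for x
  have ok: "ok x (Q x) (P x)" and gx: "g x = body (Q x) (P x)" if "x \<in> U" for x
    using QP[OF that] by (simp_all add: Q_def P_def)
  have disj: "Q x \<inter> Q x' = {}" "\<omega> ` P x \<inter> \<omega> ` P x' = {}" if "x \<in> U" "x' \<in> U" "x \<noteq> x'" for x x'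
    using g(2)[OF that] unfolding gx[OF that(1)] gx[OF that(2)] body_def by auto
  define N where "N = (M - (\<Union>x\<in>?V - fst ` M. Q x)) \<union> (\<Union>x\<in>?V - fst ` M. P x)"
  have okD: "Q x \<subseteq> M" "P x \<subseteq> hits \<omega> ?V ?V {1..3 * n} - H" "exchange x (h x) (Q x) (P x)" "inj_on \<omega> (P x)"
    "\<omega> ` P x \<inter> \<omega> ` M = {}" "real (card (P x)) \<le> ?l" if "x \<in> U" for x
    using ok[OF that] unfolding ok_def by simp_all
  note N1 = exchange_all[OF M(1-3) h[unfolded U_def] okD(1)[unfolded U_def] okD(3)[unfolded U_def] disj(1)[unfolded U_def], folded N_def]
  have NU: "N = (M - (\<Union>x\<in>U. Q x)) \<union> (\<Union>x\<in>U. P x)" by (simp add: N_def U_def)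
  have hV: "hits \<omega> ?V ?V {1..3 * n} \<subseteq> ?V \<times> ?V" by (auto simp: hits_def)
  have PV: "(\<Union>x\<in>U. P x) \<subseteq> hits \<omega> ?V ?V {1..3 * n} - H" using okD(2) by blast
  have "N \<subseteq> ?V \<times> ?V" unfolding NU using M(1) PV hV by blast
  moreover have "inj_on \<omega> N"
  proof -
    have "inj_on \<omega> (\<Union>x\<in>U. P x)"
    proof (rule inj_onI)
      fix e e' assume e: "e \<in> (\<Union>x\<in>U. P x)" "e' \<in> (\<Union>x\<in>U. P x)" "\<omega> e = \<omega> e'"
      then obtain x x' where x: "x \<in> U" "e \<in> P x" "x' \<in> U" "e' \<in> P x'" by blast
      have "x = x'"
      proof (rule ccontr)
        assume "x \<noteq> x'"
        from disj(2)[OF x(1,3) this] show False using x(2,4) e(3) by (metis disjoint_iff image_eqI)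
      qed
      then show "e = e'" using okD(4)[OF x(1)] x e(3) by (auto dest: inj_onD)
    qed
    moreover have "inj_on \<omega> (M - (\<Union>x\<in>U. Q x))" by (rule inj_on_diff[OF M(4)])
    moreover have "\<omega> ` (M - (\<Union>x\<in>U. Q x)) \<inter> \<omega> ` (\<Union>x\<in>U. P x) = {}"
    proof (rule disjoint_subsets[of _ "\<omega> ` M"])
      show "\<omega> ` M \<inter> \<omega> ` (\<Union>x\<in>U. P x) = {}" using okD(5) by (simp add: image_UN Int_UN_distrib Int_commute)
    qed (auto intro: image_mono)
    ultimately show ?thesis unfolding NU inj_on_Un by auto
  qed
  moreover have "\<omega> ` N \<subseteq> Some ` {1..3 * n}"
  proof -
    have "\<omega> ` M \<subseteq> Some ` {1..3 * n}" using M(5) by (rule order_trans) auto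
    moreover have "\<omega> ` (\<Union>x\<in>U. P x) \<subseteq> Some ` {1..3 * n}"
      using image_mono[OF PV, of \<omega>] by (rule order_trans) (auto simp: hits_def)
    ultimately show ?thesis unfolding NU image_Un by auto
  qed
  moreover have NM: "N - M \<subseteq> (\<Union>x\<in>U. P x)" by (auto simp: NU)
  then have "(N - M) \<inter> H = {}" using PV by blast
  moreover have "real (card (N - M)) \<le> 4 / 1000000000000 * real n"
  proof -
    have finP: "finite (\<Union>x\<in>U. P x)" using okD(3) finU by (auto simp: exchange_def)
    have "real (card (N - M)) \<le> real (card (\<Union>x\<in>U. P x))" using card_mono[OF finP NM] by simp
    also have "\<dots> \<le> (\<Sum>x\<in>U. real (card (P x)))" by (rule real_card_UN_le[OF finU])
    also have "\<dots> \<le> real (card U) * ?l" using okD(6) by (rule sum_bounded_above)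
    also have "\<dots> \<le> slack n * ?l" by (rule mult_right_mono[OF Usl]) (use X.ln_pos in simp)
    finally show ?thesis using X.slack_ln by simp
  qed
  ultimately show ?thesis using N1 by blast
qed

end

section \<open>Disjoint perfect rainbow matchings\<close>

definition near_perfect_family :: "nat \<Rightarrow> nat \<Rightarrow> (nat \<times> nat \<Rightarrow> nat option) \<Rightarrow> (nat \<Rightarrow> (nat \<times> nat) set) \<Rightarrow> bool" where
  "near_perfect_family n t \<omega> M \<longleftrightarrow> (\<forall>i<t. M i \<subseteq> {1..n} \<times> {1..n} \<and> inj_on fst (M i) \<and> inj_on snd (M i) \<and> inj_on \<omega> (M i) \<and>
    \<omega> ` M i \<subseteq> Some ` {3 * n div 5<..3 * n} \<and> real n - slack n < real (card (M i)) \<and> (\<forall>j<i. M j \<inter> M i = {}))"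

text \<open>What the first stage of exposure shows: an edge with a reserved color looks like a
  missing one.\<close>

definition unreserved :: "nat \<Rightarrow> (nat \<times> nat \<Rightarrow> nat option) \<Rightarrow> nat \<times> nat \<Rightarrow> nat option" where
  "unreserved n \<omega> e = (if \<omega> e \<in> Some ` {..3 * n div 5} then None else \<omega> e)"

text \<open>All edges of the family have unreserved colors, so it can be selected from the first
  stage alone.\<close>

lemma near_perfect_family_unreserved: "near_perfect_family n t (unreserved n \<omega>) M = near_perfect_family n t \<omega> M"
proof -
  have eq: "inj_on (unreserved n \<omega>) S \<and> unreserved n \<omega> ` S \<subseteq> Some ` {3 * n div 5<..3 * n} \<longleftrightarrow>
      inj_on \<omega> S \<and> \<omega> ` S \<subseteq> Some ` {3 * n div 5<..3 * n}" for S
  proof -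
    have "unreserved n \<omega> e \<in> Some ` {3 * n div 5<..3 * n} \<longleftrightarrow> \<omega> e \<in> Some ` {3 * n div 5<..3 * n}" for e
      by (auto simp: unreserved_def)
    then have sub: "unreserved n \<omega> ` S \<subseteq> Some ` {3 * n div 5<..3 * n} \<longleftrightarrow> \<omega> ` S \<subseteq> Some ` {3 * n div 5<..3 * n}"
      by (simp only: image_subset_iff)
    moreover have "inj_on (unreserved n \<omega>) S \<longleftrightarrow> inj_on \<omega> S" if "\<omega> ` S \<subseteq> Some ` {3 * n div 5<..3 * n}"
    proof (rule inj_on_cong)
      fix e assume "e \<in> S"
      then have "\<omega> e \<in> Some ` {3 * n div 5<..3 * n}" using that by blast
      then show "unreserved n \<omega> e = \<omega> e" by (auto simp: unreserved_def)
    qed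
    ultimately show ?thesis by blast
  qed
  have "inj_on (unreserved n \<omega>) S \<and> unreserved n \<omega> ` S \<subseteq> Some ` {3 * n div 5<..3 * n} \<and> R \<longleftrightarrow>
      inj_on \<omega> S \<and> \<omega> ` S \<subseteq> Some ` {3 * n div 5<..3 * n} \<and> R" for S R
    unfolding conj_assoc[symmetric] eq ..
  then show ?thesis unfolding near_perfect_family_def by (simp only:)
qed

lemma card_Int_matching_le:
  assumes "inj_on fst F" "finite A"
  shows "card (F \<inter> A \<times> B) \<le> card A"
proof (rule card_inj_on_le[of fst])
  show "inj_on fst (F \<inter> A \<times> B)" by (rule inj_on_subset[OF assms(1)]) auto
qed (use assms(2) in auto)

lemma card_Int_matchings_le:
  assumes "\<And>j. j \<in> I \<Longrightarrow> inj_on fst (F j)" "finite I" "finite A"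
  shows "card ((\<Union>j\<in>I. F j) \<inter> A \<times> B) \<le> card I * card A"
proof -
  have "(\<Union>j\<in>I. F j) \<inter> A \<times> B = (\<Union>j\<in>I. F j \<inter> A \<times> B)" by blast
  then have "card ((\<Union>j\<in>I. F j) \<inter> A \<times> B) \<le> (\<Sum>j\<in>I. card (F j \<inter> A \<times> B))"
    using card_UN_le[OF assms(2), of "\<lambda>j. F j \<inter> A \<times> B"] by simp
  also have "\<dots> \<le> (\<Sum>j\<in>I. card A)" by (rule sum_mono, rule card_Int_matching_le) (use assms in auto)
  finally show ?thesis by simp
qed

lemma near_perfect_family_exists:
  assumes qr: "quasirandom n d \<omega>" "quasirandom n d (\<omega> \<circ> prod.swap)"
  shows "real t \<le> d / 6 + 1 \<Longrightarrow> \<exists>M. near_perfect_family n t \<omega> M"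
proof (induction t)
  case 0
  show ?case by (simp add: near_perfect_family_def)
next
  case (Suc t)
  then obtain M where M: "near_perfect_family n t \<omega> M" by auto
  define H where "H = (\<Union>j\<in>{..<t}. M j)"
  have inj: "inj_on fst (M j)" "inj_on fst (prod.swap ` M j)" if "j \<in> {..<t}" for j
    using M that by (auto simp: near_perfect_family_def inj_on_swap)
  have d: "0 < d" using quasirandom.d_pos[OF qr(1)] .
  have t: "real t \<le> 17 / 100 * d" using Suc.prems d by simp
  have le: "real (card ((\<Union>j\<in>{..<t}. F j) \<inter> A \<times> {1..n})) \<le> 17 / 100 * d * real (card A)"
    if F: "\<And>j. j \<in> {..<t} \<Longrightarrow> inj_on fst (F j)" and A: "A \<subseteq> {1..n}" for F :: "nat \<Rightarrow> (nat \<times> nat) set" and A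
  proof -
    have "card ((\<Union>j\<in>{..<t}. F j) \<inter> A \<times> {1..n}) \<le> t * card A"
      using card_Int_matchings_le[of "{..<t}" F A "{1..n}", OF F] finite_subset[OF A] by simp
    then have "real (card ((\<Union>j\<in>{..<t}. F j) \<inter> A \<times> {1..n})) \<le> real t * real (card A)"
      using of_nat_mono[where ?'a = real] by fastforce
    also have "\<dots> \<le> 17 / 100 * d * real (card A)" by (rule mult_right_mono[OF t]) simp
    finally show ?thesis .
  qed
  have H: "real (card (H \<inter> A \<times> {1..n})) \<le> 17 / 100 * d * real (card A)" if "A \<subseteq> {1..n}" for A
    unfolding H_def by (rule le[OF inj(1) that])
  have H': "real (card (H \<inter> {1..n} \<times> A)) \<le> 17 / 100 * d * real (card A)" if "A \<subseteq> {1..n}" for A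
  proof -
    have "(\<Union>j\<in>{..<t}. prod.swap ` M j) \<inter> A \<times> {1..n} = prod.swap ` (H \<inter> {1..n} \<times> A)" by (auto simp: H_def)
    then show ?thesis using le[where F = "\<lambda>j. prod.swap ` M j", OF inj(2) that] by (simp add: card_image)
  qed
  obtain M' where M': "M' \<subseteq> {1..n} \<times> {1..n} - H" "inj_on fst M'" "inj_on snd M'" "inj_on \<omega> M'"
    "\<omega> ` M' \<subseteq> Some ` {3 * n div 5<..3 * n}" "real n - slack n < real (card M')"
    using near_perfect_rainbow_matching[OF qr H H'] by blast
  have "near_perfect_family n (Suc t) \<omega> (M(t := M'))"
    unfolding near_perfect_family_def
  proof (intro allI impI)
    fix i assume "i < Suc t"
    then consider "i < t" | "i = t" by linarith
    then show "(M(t := M')) i \<subseteq> {1..n} \<times> {1..n} \<and> inj_on fst ((M(t := M')) i) \<and> inj_on snd ((M(t := M')) i) \<and>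
      inj_on \<omega> ((M(t := M')) i) \<and> \<omega> ` (M(t := M')) i \<subseteq> Some ` {3 * n div 5<..3 * n} \<and>
      real n - slack n < real (card ((M(t := M')) i)) \<and> (\<forall>j<i. (M(t := M')) j \<inter> (M(t := M')) i = {})"
    proof cases
      case 1
      then show ?thesis using M unfolding near_perfect_family_def by simp
    next
      case 2
      then show ?thesis using M' by (auto simp: H_def)
    qed
  qed
  then show ?case by blast
qed

definition perfect_rainbow :: "nat \<Rightarrow> (nat \<times> nat \<Rightarrow> nat option) \<Rightarrow> (nat \<times> nat) set \<Rightarrow> bool" where
  "perfect_rainbow n \<omega> N \<longleftrightarrow> N \<subseteq> {1..n} \<times> {1..n} \<and> inj_on fst N \<and> inj_on snd N \<and> inj_on \<omega> N \<and>
    fst ` N = {1..n} \<and> snd ` N = {1..n} \<and> \<omega> ` N \<subseteq> Some ` {1..3 * n}"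

text \<open>The maximal matchings contribute (d/6 + 1) a and the edges added by earlier completions
  at most d/6 * 4/10^12 * 2*10^9 * a = d a / 750, together less than 17/100 d a. The lower bound on
  \<open>a\<close> is what makes the second term small.\<close>

lemma sparse_union_bound:
  fixes t :: nat and d a m :: real
  assumes "real t \<le> d / 6 + 1" "i < t" "1000000 \<le> d" "m / 2000000000 \<le> a" "0 \<le> a" "0 \<le> m"
  shows "real t * a + real i * (4 / 1000000000000 * m) \<le> 17 / 100 * d * a"
proof -
  have "real t * a \<le> (d / 6 + 1) * a" by (rule mult_right_mono) (use assms in auto)
  moreover have "real i * (4 / 1000000000000 * m) \<le> d / 6 * (4 / 1000000000000 * (2000000000 * a))"
    by (rule mult_mono) (use assms in auto)
  moreover have "1000000 * a \<le> d * a" by (rule mult_right_mono) (use assms in auto)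
  ultimately show ?thesis using \<open>0 \<le> a\<close> by (simp add: algebra_simps)
qed

text \<open>At a single vertex only reserved edges of \<open>H\<close> are counted; the maximal
  matchings \<open>U\<close> have none, so the \<open>i\<close> earlier perfect matchings alone
  matter. On large sets \<open>U\<close> counts once, and an earlier perfect matching adds only the
  few edges of \<open>N j - M j\<close>.\<close>

theorem disjoint_perfect_rainbow_matchings:
  assumes qr: "quasirandom n d \<omega>" "quasirandom n d (\<omega> \<circ> prod.swap)"
    and t: "real t \<le> d / 6 + 1" and M: "near_perfect_family n t \<omega> M"
    and nice: "\<And>i x. i < t \<Longrightarrow> x \<in> {1..n} \<Longrightarrow>
      real (card (hits \<omega> {x} ({1..n} - snd ` M i) {1..3 * n div 5})) \<le> d / 1000"
    and nice': "\<And>i y. i < t \<Longrightarrow> y \<in> {1..n} \<Longrightarrow>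
      real (card (hits (\<omega> \<circ> prod.swap) {y} ({1..n} - fst ` M i) {1..3 * n div 5})) \<le> d / 1000"
  shows "\<exists>N. \<forall>i<t. perfect_rainbow n \<omega> (N i) \<and> (\<forall>j<i. N i \<inter> N j = {})"
proof -
  let ?V = "{1..n}" and ?R = "{1..3 * n div 5}"
  interpret X: quasirandom n d \<omega> by fact
  have Mi: "M i \<subseteq> ?V \<times> ?V" "inj_on fst (M i)" "inj_on snd (M i)" "inj_on \<omega> (M i)"
    "\<omega> ` M i \<subseteq> Some ` {3 * n div 5<..3 * n}" "real n - slack n < real (card (M i))" "\<And>j. j < i \<Longrightarrow> M j \<inter> M i = {}"
    if "i < t" for i using M that unfolding near_perfect_family_def by blast+
  have Mdisj: "M i \<inter> M j = {}" if "i < t" "j < t" "i \<noteq> j" for i j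
    using that Mi(7)[of i j] Mi(7)[of j i] by (metis Int_commute linorder_neqE_nat)
  define U where "U = (\<Union>j\<in>{..<t}. M j)"
  let ?good = "\<lambda>N j. perfect_rainbow n \<omega> (N j) \<and> (N j - M j) \<inter> U = {} \<and>
    real (card (N j - M j)) \<le> 4 / 1000000000000 * real n \<and> (\<forall>l<j. N j \<inter> N l = {})"
  have "i \<le> t \<Longrightarrow> \<exists>N. \<forall>j<i. ?good N j" for i
  proof (induction i)
    case 0
    show ?case by simp
  next
    case (Suc i)
    then obtain N where N: "\<And>j. j < i \<Longrightarrow> ?good N j" by auto
    have it: "i < t" using Suc.prems by simp
    \<comment> \<open>\<open>i < t\<close> is strict, which absorbs the \<open>+ 1\<close> in the
      bound on \<open>t\<close>.\<close>
    then have id6: "real i \<le> d / 6" using t by linarith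
    have NV: "N j \<subseteq> ?V \<times> ?V" "inj_on fst (N j)" "inj_on snd (N j)" if "j < i" for j
      using N[OF that] by (auto simp: perfect_rainbow_def)
    define H where "H = U \<union> (\<Union>j\<in>{..<i}. N j)"
    have UR: "U \<inter> hits \<omega> A B ?R = {}" for A B
    proof -
      have "e \<notin> hits \<omega> A B ?R" if "e \<in> U" for e
      proof -
        obtain j where "j < t" "e \<in> M j" using \<open>e \<in> U\<close> by (auto simp: U_def)
        then have "\<omega> e \<in> Some ` {3 * n div 5<..3 * n}" using Mi(5)[of j] by blast
        then show ?thesis by (auto simp: hits_def)
      qed
      then show ?thesis by blast
    qed
    have finH: "finite H"
    proof -
      have "U \<subseteq> ?V \<times> ?V" unfolding U_def using Mi(1) by blast
      then have "H \<subseteq> ?V \<times> ?V" unfolding H_def using NV(1) by blast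
      then show ?thesis using finite_subset by blast
    qed
    have D: "real (card (\<Union>j\<in>{..<i}. N j - M j)) \<le> real i * (4 / 1000000000000 * real n)"
    proof -
      have "real (card (\<Union>j\<in>{..<i}. N j - M j)) \<le> (\<Sum>j\<in>{..<i}. real (card (N j - M j)))"
        by (rule real_card_UN_le) simp
      also have "\<dots> \<le> real (card {..<i}) * (4 / 1000000000000 * real n)"
        using N by (intro sum_bounded_above) auto
      finally show ?thesis by simp
    qed
    have finD: "finite (\<Union>j\<in>{..<i}. N j - M j)"
      using NV(1) finite_subset[of _ "?V \<times> ?V"] by auto
    have HD: "H \<subseteq> U \<union> (\<Union>j\<in>{..<i}. N j - M j)" using it by (auto simp: H_def U_def)
    have n0: "0 \<le> real n" by simp
    have Usmall: "card (U \<inter> A \<times> ?V) \<le> t * card A" if "A \<subseteq> ?V" for A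
      using card_Int_matchings_le[of "{..<t}" M A ?V] Mi(2) finite_subset[OF that] by (simp add: U_def)
    have Usmall': "card (prod.swap ` U \<inter> A \<times> ?V) \<le> t * card A" if "A \<subseteq> ?V" for A
    proof -
      have "prod.swap ` U = (\<Union>j\<in>{..<t}. prod.swap ` M j)" by (auto simp: U_def)
      then show ?thesis
        using card_Int_matchings_le[of "{..<t}" "\<lambda>j. prod.swap ` M j" A ?V] Mi(3) finite_subset[OF that]
        by (simp add: inj_on_swap)
    qed
    have comp: "completion n d \<omega> (M i) H"
    proof (rule completion.intro)
      show "real (card (hits \<omega> {x} ?V ?R \<inter> H)) \<le> d / 6" if "x \<in> ?V" for x
      proof -
        have "hits \<omega> {x} ?V ?R \<inter> H \<subseteq> (\<Union>j\<in>{..<i}. N j) \<inter> {x} \<times> ?V"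
          using UR[of "{x}" ?V] unfolding H_def by (auto simp: hits_def)
        moreover have "finite ((\<Union>j\<in>{..<i}. N j) \<inter> {x} \<times> ?V)" by (rule finite_subset[of _ "{x} \<times> ?V"]) auto
        ultimately have "card (hits \<omega> {x} ?V ?R \<inter> H) \<le> card ((\<Union>j\<in>{..<i}. N j) \<inter> {x} \<times> ?V)"
          by (rule card_mono[rotated])
        also have "\<dots> \<le> card {..<i} * card {x}" by (rule card_Int_matchings_le) (use NV(2) in auto)
        finally show ?thesis using id6 by simp
      qed
      show "real (card (hits (\<omega> \<circ> prod.swap) {y} ?V ?R \<inter> prod.swap ` H)) \<le> d / 6" if "y \<in> ?V" for y
      proof -
        have "hits (\<omega> \<circ> prod.swap) {y} ?V ?R \<inter> prod.swap ` H \<subseteq> (\<Union>j\<in>{..<i}. prod.swap ` N j) \<inter> {y} \<times> ?V"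
          using UR[of ?V "{y}"] unfolding H_def by (auto simp: hits_def)
        moreover have "finite ((\<Union>j\<in>{..<i}. prod.swap ` N j) \<inter> {y} \<times> ?V)" by (rule finite_subset[of _ "{y} \<times> ?V"]) auto
        ultimately have "card (hits (\<omega> \<circ> prod.swap) {y} ?V ?R \<inter> prod.swap ` H) \<le>
            card ((\<Union>j\<in>{..<i}. prod.swap ` N j) \<inter> {y} \<times> ?V)"
          by (rule card_mono[rotated])
        also have "\<dots> \<le> card {..<i} * card {y}" by (rule card_Int_matchings_le) (use NV(3) in \<open>auto simp: inj_on_swap\<close>)
        finally show ?thesis using id6 by simp
      qed
      show "real (card (H \<inter> A \<times> ?V)) \<le> 17 / 100 * d * real (card A)"
        if A: "A \<subseteq> ?V" "real n / 2000000000 \<le> real (card A)" for A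
      proof -
        have "H \<inter> A \<times> ?V \<subseteq> (U \<inter> A \<times> ?V) \<union> (\<Union>j\<in>{..<i}. N j - M j)" using HD by blast
        moreover have "finite (U \<inter> A \<times> ?V)" using finite_subset[OF A(1)] by (intro finite_Int) auto
        ultimately have "card (H \<inter> A \<times> ?V) \<le> card (U \<inter> A \<times> ?V) + card (\<Union>j\<in>{..<i}. N j - M j)"
          using finD by (meson card_Un_le card_mono finite_UnI order_trans)
        then have "real (card (H \<inter> A \<times> ?V)) \<le> real t * real (card A) + real i * (4 / 1000000000000 * real n)"
          using Usmall[OF A(1)] D of_nat_mono[of "card (U \<inter> A \<times> ?V)" "t * card A", where ?'a = real] by simp
        then show ?thesis using sparse_union_bound[OF t it X.d_large A(2) _ n0] by simp
      qed
      show "real (card (prod.swap ` H \<inter> A \<times> ?V)) \<le> 17 / 100 * d * real (card A)"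
        if A: "A \<subseteq> ?V" "real n / 2000000000 \<le> real (card A)" for A
      proof -
        have "prod.swap ` H \<inter> A \<times> ?V \<subseteq> (prod.swap ` U \<inter> A \<times> ?V) \<union> prod.swap ` (\<Union>j\<in>{..<i}. N j - M j)"
          using image_mono[OF HD, of prod.swap] by blast
        moreover have "finite (prod.swap ` U \<inter> A \<times> ?V)" using finite_subset[OF A(1)] by (intro finite_Int) auto
        ultimately have "card (prod.swap ` H \<inter> A \<times> ?V) \<le>
            card (prod.swap ` U \<inter> A \<times> ?V) + card (prod.swap ` (\<Union>j\<in>{..<i}. N j - M j))"
          using finD by (meson card_Un_le card_mono finite_UnI finite_imageI order_trans)
        also have "card (prod.swap ` (\<Union>j\<in>{..<i}. N j - M j)) = card (\<Union>j\<in>{..<i}. N j - M j)"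
          by (rule card_image) simp
        finally have "real (card (prod.swap ` H \<inter> A \<times> ?V)) \<le> real t * real (card A) + real i * (4 / 1000000000000 * real n)"
          using Usmall'[OF A(1)] D of_nat_mono[of "card (prod.swap ` U \<inter> A \<times> ?V)" "t * card A", where ?'a = real] by simp
        then show ?thesis using sparse_union_bound[OF t it X.d_large A(2) _ n0] by simp
      qed
    qed (fact qr Mi[OF it] nice[OF it] nice'[OF it])+
    obtain N' where N': "perfect_rainbow n \<omega> N'" "(N' - M i) \<inter> H = {}" "real (card (N' - M i)) \<le> 4 / 1000000000000 * real n"
      using completion.complete_matching[OF comp] unfolding perfect_rainbow_def by blast
    have "?good (N(i := N')) j" if "j < Suc i" for j
    proof (cases "j = i")
      case True
      \<comment> \<open>An edge of \<open>N'\<close> outside of \<open>M i\<close> avoids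
        \<open>H\<close> and with it \<open>N l\<close>. An edge of \<open>M i\<close> is not in
        \<open>M l\<close>, and as it lies in \<open>U\<close>, it is not among the edges added to
        \<open>M l\<close> either.\<close>
      have "N' \<inter> N l = {}" if l: "l < i" for l
      proof -
        have "(N l - M l) \<inter> U = {}" using N[OF l] by blast
        moreover have "M i \<subseteq> U" using it by (auto simp: U_def)
        moreover have "N l \<subseteq> H" using l by (auto simp: H_def)
        moreover have "M i \<inter> M l = {}" using Mdisj it l by simp
        ultimately show ?thesis using N'(2) by blast
      qed
      moreover have "(N' - M i) \<inter> U = {}" using N'(2) by (auto simp: H_def)
      ultimately show ?thesis using N'(1,3) True by simp
    next
      case False
      then show ?thesis using N[of j] that by simp
    qed
    then show ?case by blast
  qed
  from this[of t] show ?thesis by blast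
qed

section \<open>Large deviations\<close>

text \<open>The moment generating function at \<open>z\<close> = exp(s): the power factors over the
  independent coordinates as 1 + (z - 1) times an indicator, and 1 + u <= exp u. Values of
  \<open>z\<close> on both sides of 1 are covered.\<close>

lemma expectation_power_card_le:
  fixes z :: real
  assumes A: "finite A" and z: "0 < z"
  shows "integrable (measure_pmf (Pi_pmf A dflt Q)) (\<lambda>\<omega>. z ^ card {e \<in> A. \<omega> e \<in> S e})"
    and "measure_pmf.expectation (Pi_pmf A dflt Q) (\<lambda>\<omega>. z ^ card {e \<in> A. \<omega> e \<in> S e}) \<le>
      exp ((z - 1) * (\<Sum>e\<in>A. measure_pmf.prob (Q e) (S e)))"
proof -
  define f where "f e v = 1 + (z - 1) * indicator (S e) v" for e v
  have eq: "z ^ card {e \<in> A. \<omega> e \<in> S e} = (\<Prod>e\<in>A. f e (\<omega> e))" for \<omega>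
  proof -
    have "(\<Prod>e\<in>A. f e (\<omega> e)) = (\<Prod>e\<in>A. if \<omega> e \<in> S e then z else 1)"
      by (rule prod.cong) (auto simp: f_def)
    also have "\<dots> = (\<Prod>e\<in>{e \<in> A. \<omega> e \<in> S e}. z)"
      using A by (simp add: prod.If_cases Int_def)
    finally show ?thesis by simp
  qed
  have ind: "integrable (measure_pmf (Q e)) (indicator (S e) :: _ \<Rightarrow> real)" for e
    by (rule measure_pmf.integrable_const_bound[of _ 1]) auto
  have int: "integrable (measure_pmf (Q e)) (f e)" for e
    unfolding f_def using ind[of e] by (intro Bochner_Integration.integrable_add integrable_mult_right) auto
  have nonneg: "0 \<le> f e v" for e v using z by (auto simp: f_def indicator_def)
  have val: "measure_pmf.expectation (Q e) (f e) = 1 + (z - 1) * measure_pmf.prob (Q e) (S e)" for e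
    unfolding f_def using ind[of e] by (subst Bochner_Integration.integral_add) auto
  show "integrable (measure_pmf (Pi_pmf A dflt Q)) (\<lambda>\<omega>. z ^ card {e \<in> A. \<omega> e \<in> S e})"
    unfolding eq by (rule integrable_prod_Pi_pmf[OF A int])
  have "measure_pmf.expectation (Pi_pmf A dflt Q) (\<lambda>\<omega>. z ^ card {e \<in> A. \<omega> e \<in> S e}) =
      (\<Prod>e\<in>A. 1 + (z - 1) * measure_pmf.prob (Q e) (S e))"
    unfolding eq val[symmetric] by (rule expectation_prod_Pi_pmf[OF A int nonneg])
  also have "\<dots> \<le> (\<Prod>e\<in>A. exp ((z - 1) * measure_pmf.prob (Q e) (S e)))"
  proof (rule prod_mono)
    fix e
    have "0 \<le> measure_pmf.expectation (Q e) (f e)" by (rule Bochner_Integration.integral_nonneg) (rule nonneg)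
    then show "0 \<le> 1 + (z - 1) * measure_pmf.prob (Q e) (S e) \<and>
      1 + (z - 1) * measure_pmf.prob (Q e) (S e) \<le> exp ((z - 1) * measure_pmf.prob (Q e) (S e))"
      unfolding val by (simp add: exp_ge_add_one_self)
  qed
  also have "\<dots> = exp ((z - 1) * (\<Sum>e\<in>A. measure_pmf.prob (Q e) (S e)))"
    using A by (simp add: exp_sum sum_distrib_left)
  finally show "measure_pmf.expectation (Pi_pmf A dflt Q) (\<lambda>\<omega>. z ^ card {e \<in> A. \<omega> e \<in> S e}) \<le>
      exp ((z - 1) * (\<Sum>e\<in>A. measure_pmf.prob (Q e) (S e)))" .
qed

text \<open>Markov's inequality. The event compares powers of \<open>z\<close>, so that it becomes
  an upper tail for z > 1 and a lower tail for z < 1.\<close>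

lemma prob_power_card_le:
  fixes z m :: real
  assumes A: "finite A" and z: "0 < z"
  shows "measure_pmf.prob (Pi_pmf A dflt Q) {\<omega>. z powr m \<le> z ^ card {e \<in> A. \<omega> e \<in> S e}} \<le>
    exp ((z - 1) * (\<Sum>e\<in>A. measure_pmf.prob (Q e) (S e)) - m * ln z)"
proof -
  let ?P = "Pi_pmf A dflt Q" and ?X = "\<lambda>\<omega>. z ^ card {e \<in> A. \<omega> e \<in> S e}"
  have "measure_pmf.prob ?P {\<omega> \<in> space (measure_pmf ?P). z powr m \<le> ?X \<omega>} \<le> measure_pmf.expectation ?P ?X / (z powr m)"
    by (rule integral_Markov_inequality_measure[where A = "space (measure_pmf ?P)"])
      (use z expectation_power_card_le(1)[OF A z, of dflt Q S] in auto)
  also have "\<dots> \<le> exp ((z - 1) * (\<Sum>e\<in>A. measure_pmf.prob (Q e) (S e))) / (z powr m)"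
    by (rule divide_right_mono[OF expectation_power_card_le(2)[OF A z]]) simp
  also have "\<dots> = exp ((z - 1) * (\<Sum>e\<in>A. measure_pmf.prob (Q e) (S e)) - m * ln z)"
    using z by (simp add: powr_def exp_diff)
  finally show ?thesis by simp
qed

lemma upper_tail:
  fixes z m \<mu> :: real
  assumes A: "finite A" and z: "1 \<le> z" and \<mu>: "(\<Sum>e\<in>A. measure_pmf.prob (Q e) (S e)) \<le> \<mu>"
  shows "measure_pmf.prob (Pi_pmf A dflt Q) {\<omega>. m \<le> real (card {e \<in> A. \<omega> e \<in> S e})} \<le> exp ((z - 1) * \<mu> - m * ln z)"
proof -
  have z0: "0 < z" using z by simp
  have "measure_pmf.prob (Pi_pmf A dflt Q) {\<omega>. m \<le> real (card {e \<in> A. \<omega> e \<in> S e})} \<le>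
      measure_pmf.prob (Pi_pmf A dflt Q) {\<omega>. z powr m \<le> z ^ card {e \<in> A. \<omega> e \<in> S e}}"
  proof (rule measure_pmf.finite_measure_mono)
    show "{\<omega>. m \<le> real (card {e \<in> A. \<omega> e \<in> S e})} \<subseteq> {\<omega>. z powr m \<le> z ^ card {e \<in> A. \<omega> e \<in> S e}}"
      using z z0 by (auto simp flip: powr_realpow intro!: powr_mono)
  qed simp
  also have "\<dots> \<le> exp ((z - 1) * (\<Sum>e\<in>A. measure_pmf.prob (Q e) (S e)) - m * ln z)"
    by (rule prob_power_card_le[OF A z0])
  also have "\<dots> \<le> exp ((z - 1) * \<mu> - m * ln z)"
    using mult_left_mono[OF \<mu>, of "z - 1"] z by simp
  finally show ?thesis .
qed

text \<open>The right side times 1 + \<open>\<theta>\<close> + \<open>\<theta>\<^sup>2\<close> / 2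
  is 1 + \<open>\<theta>^4\<close> / 4 >= 1, and that factor is at most exp
  \<open>\<theta>\<close>.\<close>

lemma exp_minus_le_quadratic:
  fixes \<theta> :: real
  assumes "0 \<le> \<theta>"
  shows "exp (- \<theta>) \<le> 1 - \<theta> + \<theta>\<^sup>2 / 2"
proof -
  let ?a = "1 - \<theta> + \<theta>\<^sup>2 / 2" and ?b = "1 + \<theta> + \<theta>\<^sup>2 / 2"
  have "?a * ?b = 1 + (\<theta>\<^sup>2)\<^sup>2 / 4" by (simp add: algebra_simps power2_eq_square)
  then have ab: "1 \<le> ?a * ?b" by simp
  have b: "0 < ?b" using assms by (simp add: add_pos_nonneg)
  have "exp (- \<theta>) = 1 / exp \<theta>" by (simp add: exp_minus inverse_eq_divide)
  also have "\<dots> \<le> 1 / ?b"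
    by (rule divide_left_mono) (use exp_lower_Taylor_quadratic[OF assms] b in auto)
  also have "\<dots> \<le> ?a" using ab b by (simp add: divide_le_eq)
  finally show ?thesis .
qed

lemma lower_tail:
  fixes \<theta> m \<mu> :: real
  assumes A: "finite A" and \<theta>: "0 \<le> \<theta>" "\<theta> \<le> 2" and \<mu>: "\<mu> \<le> (\<Sum>e\<in>A. measure_pmf.prob (Q e) (S e))" "0 \<le> \<mu>"
  shows "measure_pmf.prob (Pi_pmf A dflt Q) {\<omega>. real (card {e \<in> A. \<omega> e \<in> S e}) \<le> m} \<le> exp (\<theta> * m - (\<theta> - \<theta>\<^sup>2 / 2) * \<mu>)"
proof -
  define z where "z = exp (- \<theta>)"
  have z: "0 < z" "z \<le> 1" "ln z = - \<theta>" using \<theta> by (simp_all add: z_def)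
  have "measure_pmf.prob (Pi_pmf A dflt Q) {\<omega>. real (card {e \<in> A. \<omega> e \<in> S e}) \<le> m} \<le>
      measure_pmf.prob (Pi_pmf A dflt Q) {\<omega>. z powr m \<le> z ^ card {e \<in> A. \<omega> e \<in> S e}}"
  proof (rule measure_pmf.finite_measure_mono)
    show "{\<omega>. real (card {e \<in> A. \<omega> e \<in> S e}) \<le> m} \<subseteq> {\<omega>. z powr m \<le> z ^ card {e \<in> A. \<omega> e \<in> S e}}"
      using z by (auto simp flip: powr_realpow intro!: powr_mono')
  qed simp
  also have "\<dots> \<le> exp ((z - 1) * (\<Sum>e\<in>A. measure_pmf.prob (Q e) (S e)) - m * ln z)"
    by (rule prob_power_card_le[OF A z(1)])
  also have "\<dots> \<le> exp (\<theta> * m - (\<theta> - \<theta>\<^sup>2 / 2) * \<mu>)"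
  proof -
    have "(z - 1) * (\<Sum>e\<in>A. measure_pmf.prob (Q e) (S e)) \<le> (z - 1) * \<mu>"
      using \<mu>(1) z(2) by (intro mult_left_mono_neg) auto
    also have "\<dots> \<le> - (\<theta> - \<theta>\<^sup>2 / 2) * \<mu>"
      using exp_minus_le_quadratic[OF \<theta>(1)] \<mu>(2) by (intro mult_right_mono) (auto simp: z_def)
    finally show ?thesis using z(3) by (simp add: algebra_simps)
  qed
  finally show ?thesis .
qed

section \<open>The random edge coloring as a product measure\<close>

definition colored_edge :: "nat \<Rightarrow> real \<Rightarrow> nat option pmf" where
  "colored_edge c p = bind_pmf (bernoulli_pmf p) (\<lambda>b. if b then map_pmf Some (pmf_of_set {1..c}) else return_pmf None)"

lemma prob_colored_edge:
  assumes "0 \<le> p" "p \<le> 1" "0 < c" "C \<subseteq> {1..c}"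
  shows "measure_pmf.prob (colored_edge c p) (Some ` C) = p * real (card C) / real c"
proof -
  have "pmf (colored_edge c p) (Some k) = p / real c" if "k \<in> {1..c}" for k
    using that assms unfolding colored_edge_def
    by (simp add: pmf_bind pmf_map_inj' integral_bernoulli_pmf pmf_of_set[of "{1..c}"] indicator_def)
  then have "(\<Sum>k\<in>C. pmf (colored_edge c p) (Some k)) = (\<Sum>k\<in>C. p / real c)"
    using assms(4) by (intro sum.cong) auto
  then have "(\<Sum>x\<in>Some ` C. pmf (colored_edge c p) x) = (\<Sum>k\<in>C. p / real c)"
    by (subst sum.reindex) auto
  moreover have "finite C" using assms(4) finite_subset by blast
  ultimately show ?thesis by (simp add: measure_measure_pmf_finite)
qed

text \<open>Keeping and coloring are merged into one independent value per edge, with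
  \<open>None\<close> for a missing edge, so that the tail bounds apply to a single product.\<close>

definition edge_colors :: "nat \<Rightarrow> real \<Rightarrow> (nat \<times> nat \<Rightarrow> nat option) pmf" where
  "edge_colors n p = Pi_pmf ({1..n} \<times> {1..n}) None (\<lambda>_. colored_edge (3 * n) p)"

lemma sum_prob_hits:
  assumes "0 \<le> p" "p \<le> 1" "0 < n" "A \<subseteq> {1..n}" "B \<subseteq> {1..n}" "C \<subseteq> {1..3 * n}"
  shows "(\<Sum>e\<in>{1..n} \<times> {1..n}. measure_pmf.prob (colored_edge (3 * n) p) (if e \<in> A \<times> B then Some ` C else {})) =
    real (card A) * real (card B) * (p * real (card C) / (3 * real n))"
proof -
  have "(\<Sum>e\<in>{1..n} \<times> {1..n}. measure_pmf.prob (colored_edge (3 * n) p) (if e \<in> A \<times> B then Some ` C else {})) =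
      (\<Sum>e\<in>A \<times> B. measure_pmf.prob (colored_edge (3 * n) p) (Some ` C))"
    using assms(4,5) by (intro sum.mono_neutral_cong_right) auto
  also have "\<dots> = real (card A) * real (card B) * (p * real (card C) / (3 * real n))"
    using prob_colored_edge[OF assms(1,2) _ assms(6)] assms(3) by (simp add: card_cartesian_product)
  finally show ?thesis .
qed

lemma hits_eq: "A \<subseteq> {1..n} \<Longrightarrow> B \<subseteq> {1..n} \<Longrightarrow>
    hits \<omega> A B C = {e \<in> {1..n} \<times> {1..n}. \<omega> e \<in> (if e \<in> A \<times> B then Some ` C else {})}"
  by (auto simp: hits_def split: if_splits)

lemma hits_upper_tail:
  assumes "0 \<le> p" "p \<le> 1" "0 < n" "A \<subseteq> {1..n}" "B \<subseteq> {1..n}" "C \<subseteq> {1..3 * n}" "1 \<le> z"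
    and "real (card A) * real (card B) * (p * real (card C) / (3 * real n)) \<le> \<mu>"
  shows "measure_pmf.prob (edge_colors n p) {\<omega>. m \<le> real (card (hits \<omega> A B C))} \<le> exp ((z - 1) * \<mu> - m * ln z)"
  unfolding hits_eq[OF assms(4,5)] edge_colors_def
  by (rule upper_tail[OF _ assms(7)]) (use assms(8) sum_prob_hits[OF assms(1-6)] in auto)

lemma hits_lower_tail:
  assumes "0 \<le> p" "p \<le> 1" "0 < n" "A \<subseteq> {1..n}" "B \<subseteq> {1..n}" "C \<subseteq> {1..3 * n}" "0 \<le> \<theta>" "\<theta> \<le> 2"
    and "\<mu> \<le> real (card A) * real (card B) * (p * real (card C) / (3 * real n))" "0 \<le> \<mu>"
  shows "measure_pmf.prob (edge_colors n p) {\<omega>. real (card (hits \<omega> A B C)) \<le> m} \<le> exp (\<theta> * m - (\<theta> - \<theta>\<^sup>2 / 2) * \<mu>)"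
  unfolding hits_eq[OF assms(4,5)] edge_colors_def
  by (rule lower_tail[OF _ assms(7,8)]) (use assms(9,10) sum_prob_hits[OF assms(1-6)] in auto)

section \<open>Union bounds and the number of small sets\<close>

lemma prob_Ex_le:
  assumes "finite I" "\<And>i. i \<in> I \<Longrightarrow> measure_pmf.prob M {\<omega>. B i \<omega>} \<le> f i"
  shows "measure_pmf.prob M {\<omega>. \<exists>i\<in>I. B i \<omega>} \<le> (\<Sum>i\<in>I. f i)"
proof -
  have "{\<omega>. \<exists>i\<in>I. B i \<omega>} = (\<Union>i\<in>I. {\<omega>. B i \<omega>})" by auto
  then have "measure_pmf.prob M {\<omega>. \<exists>i\<in>I. B i \<omega>} \<le> (\<Sum>i\<in>I. measure_pmf.prob M {\<omega>. B i \<omega>})"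
    using measure_pmf.finite_measure_subadditive_finite[OF assms(1), of "\<lambda>i. {\<omega>. B i \<omega>}" M] by simp
  also have "\<dots> \<le> (\<Sum>i\<in>I. f i)" using assms(2) by (rule sum_mono)
  finally show ?thesis .
qed

lemma prob_disj_le:
  "measure_pmf.prob M {\<omega>. P \<omega> \<or> Q \<omega>} \<le> measure_pmf.prob M {\<omega>. P \<omega>} + measure_pmf.prob M {\<omega>. Q \<omega>}"
proof -
  have "{\<omega>. P \<omega> \<or> Q \<omega>} = {\<omega>. P \<omega>} \<union> {\<omega>. Q \<omega>}" by auto
  then show ?thesis using measure_Un_le[of "{\<omega>. P \<omega>}" "measure_pmf M" "{\<omega>. Q \<omega>}"] by simp
qed

lemma prob_mono:
  "(\<And>\<omega>. P \<omega> \<Longrightarrow> Q \<omega>) \<Longrightarrow> measure_pmf.prob M {\<omega>. P \<omega>} \<le> measure_pmf.prob M {\<omega>. Q \<omega>}"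
  by (rule measure_pmf.finite_measure_mono) auto

lemma sum_Pow_power_card:
  fixes x :: real
  assumes "finite G"
  shows "(\<Sum>B\<in>Pow G. x ^ card B) = (1 + x) ^ card G"
  using prod_add[OF assms, of "\<lambda>_. x" "\<lambda>_. 1"] by (simp add: add.commute)

text \<open>Every counted set contributes at least x^b to the sum of x^|B| over all subsets, which
  is (1 + x)^|G|. With |G| <= 3n and x = b / (3n) this becomes the familiar (3 e n / b)^b.\<close>

lemma card_small_subsets_le:
  fixes x b :: real
  assumes G: "finite G" and x: "0 < x" "x \<le> 1"
  shows "real (card {B \<in> Pow G. real (card B) \<le> b}) \<le> exp (x * real (card G) - b * ln x)"
proof -
  have "real (card {B \<in> Pow G. real (card B) \<le> b}) * x powr b = (\<Sum>B | B \<in> Pow G \<and> real (card B) \<le> b. x powr b)"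
    by simp
  also have "\<dots> \<le> (\<Sum>B | B \<in> Pow G \<and> real (card B) \<le> b. x ^ card B)"
    using x by (intro sum_mono) (auto simp flip: powr_realpow intro!: powr_mono')
  also have "\<dots> \<le> (\<Sum>B\<in>Pow G. x ^ card B)"
    using G x by (intro sum_mono2) auto
  also have "\<dots> = (1 + x) ^ card G" by (rule sum_Pow_power_card[OF G])
  also have "\<dots> \<le> exp x ^ card G" using x by (intro power_mono) auto
  also have "\<dots> = exp (x * real (card G))" by (simp add: exp_of_nat2_mult)
  finally have "real (card {B \<in> Pow G. real (card B) \<le> b}) \<le> exp (x * real (card G)) / x powr b"
    using x by (simp add: pos_le_divide_eq)
  also have "\<dots> = exp (x * real (card G) - b * ln x)" using x by (simp add: powr_def exp_diff)
  finally show ?thesis .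
qed

lemma one_le_ln_10: "1 \<le> ln (10 :: real)"
proof -
  have "exp 1 \<le> (10 :: real)" using exp_le by simp
  then have "ln (exp 1) \<le> ln (10 :: real)" by (subst ln_le_cancel_iff) auto
  then show ?thesis by simp
qed

text \<open>For y = n / b these reduce all logarithms in \<open>sparse_exponent\<close> to multiples
  of ln y.\<close>

lemma ln_large_bounds:
  fixes y :: real
  assumes "100000000 \<le> y"
  shows "1 \<le> ln y" "ln y / 2 \<le> ln (y / 1000) - 1" "1 + ln (3 * y) \<le> 2 * ln y"
proof -
  have "ln (10 ^ 8) \<le> ln y" using assms by (subst ln_le_cancel_iff) auto
  moreover have "ln (10 ^ 8) = 8 * ln (10 :: real)" using ln_realpow[of 10 8] by simp
  ultimately have y: "8 * ln 10 \<le> ln y" by (simp only:)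
  have k: "ln 1000 = 3 * ln (10 :: real)" using ln_realpow[of 10 3] by simp
  have l3: "ln 3 \<le> ln (10 :: real)" by (subst ln_le_cancel_iff) auto
  have d: "ln (y / 1000) = ln y - ln 1000" using assms by (simp add: ln_div)
  have m: "ln (3 * y) = ln 3 + ln y" using assms by (simp add: ln_mult)
  show "1 \<le> ln y" "ln y / 2 \<le> ln (y / 1000) - 1" "1 + ln (3 * y) \<le> 2 * ln y"
    using y k l3 d m one_le_ln_10 by linarith+
qed

text \<open>The finite form of the asymptotic hypotheses; \<open>degree_large\<close> is what is
  extracted from pn / log n tending to infinity.\<close>

locale large_parameters =
  fixes n :: nat and p :: real
  assumes p: "0 \<le> p" "p \<le> 1" and n: "1000000000000000 \<le> real n" "100 \<le> ln (real n)"
    and sqrt_large: "200000000000000 * ln (real n) \<le> sqrt (real n)"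
    and degree_large: "100000000000000000 * ln (real n) \<le> real n * p"
begin

abbreviation "d \<equiv> real n * p"

abbreviation "pr \<equiv> measure_pmf.prob (edge_colors n p)"

lemma n0: "0 < n" using n(1) by (cases n) auto

lemma exp_ln_n: "exp (- (real k * ln (real n))) = 1 / real n ^ k"
  using n0 by (simp add: exp_minus exp_of_nat_mult inverse_eq_divide)

lemma prob_few_monochromatic:
  "pr {\<omega>. \<exists>y\<in>{1..n}. \<exists>c\<in>{1..3 * n}.
    \<not> real (card (hits \<omega> {1..n} {y} {c})) \<le> d / (200000000000000 * ln (real n))} \<le> 1 / real n"
    (is "?p \<le> _")
proof -
  define m where "m = d / (200000000000000 * ln (real n))"
  have m: "500 \<le> m" unfolding m_def using degree_large n(2) by (simp add: pos_le_divide_eq)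
  have single: "pr {\<omega>. \<not> real (card (hits \<omega> {1..n} {y} {c})) \<le> m} \<le> 1 / real n ^ 4"
    if yc: "y \<in> {1..n}" "c \<in> {1..3 * n}" for y c
  proof -
    have "pr {\<omega>. \<not> real (card (hits \<omega> {1..n} {y} {c})) \<le> m} \<le>
        pr {\<omega>. m \<le> real (card (hits \<omega> {1..n} {y} {c}))}"
      by (rule prob_mono) simp
    \<comment> \<open>The base sqrt n is small enough for sqrt n * p <= m, by
      \<open>sqrt_large\<close>, and large enough for each of the m >= 500 edges to gain a factor
      n^(-1/2).\<close>
    also have "\<dots> \<le> exp ((sqrt (real n) - 1) * p - m * ln (sqrt (real n)))"
      by (rule hits_upper_tail[OF p n0]) (use yc p n n0 in auto)
    also have "\<dots> \<le> exp (- (real 4 * ln (real n)))"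
    proof -
      have "(sqrt (real n) - 1) * p \<le> sqrt (real n) * p" using p(1) by (intro mult_right_mono) auto
      also have "\<dots> \<le> m"
      proof -
        have "sqrt (real n) * (200000000000000 * ln (real n)) \<le> sqrt (real n) * sqrt (real n)"
          by (rule mult_left_mono[OF sqrt_large]) simp
        then have "sqrt (real n) * (200000000000000 * ln (real n)) \<le> real n" by simp
        then have "sqrt (real n) * (200000000000000 * ln (real n)) * p \<le> real n * p" by (rule mult_right_mono[OF _ p(1)])
        then show ?thesis unfolding m_def using n(2) by (simp add: pos_le_divide_eq ac_simps)
      qed
      finally have e1: "(sqrt (real n) - 1) * p \<le> m" .
      have "500 * (ln (real n) / 2 - 1) \<le> m * (ln (real n) / 2 - 1)"
        by (rule mult_right_mono[OF m]) (use n(2) in simp)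
      then have "500 * (ln (real n) / 2 - 1) \<le> m * (ln (real n) / 2) - m" by (simp only: right_diff_distrib mult_1_right)
      moreover have lnsq: "ln (sqrt (real n)) = ln (real n) / 2" using n0 by (simp add: ln_sqrt)
      have arith: "q - r \<le> - (4 * l)" if "500 * (l / 2 - 1) \<le> r - m" "q \<le> m" "100 \<le> l" for q r l :: real
      proof -
        have "500 * (l / 2 - 1) = 250 * l - 500" by simp
        then show ?thesis using that by linarith
      qed
      ultimately show ?thesis unfolding exp_le_cancel_iff of_nat_numeral lnsq by (intro arith e1 n(2))
    qed
    also have "\<dots> = 1 / real n ^ 4" by (rule exp_ln_n)
    finally show ?thesis .
  qed
  have "?p \<le> (\<Sum>y\<in>{1..n}. \<Sum>c\<in>{1..3 * n}. 1 / real n ^ 4)"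
    using single unfolding m_def by (intro prob_Ex_le) auto
  also have "\<dots> = 3 * real n * real n / real n ^ 4" by simp
  also have "\<dots> = 3 / real n / real n" using n0 by (simp add: power4_eq_xxxx)
  also have "\<dots> \<le> 1 / real n" using n by (intro divide_right_mono) auto
  finally show ?thesis .
qed

lemma prob_reserved_degree:
  "pr {\<omega>. \<exists>x\<in>{1..n}.
    \<not> 19 / 100 * d \<le> real (card (hits \<omega> {x} {1..n} {1..3 * n div 5}))} \<le> 1 / real n"
    (is "?p \<le> _")
proof -
  have num: "4 / 100 * (19 / 100 * x) - (4 / 100 - (4 / 100)\<^sup>2 / 2) * (199 / 1000 * x) = - (2008 / 10000000) * x" for x :: real
    by (simp add: power2_eq_square)
  have single: "pr {\<omega>. \<not> 19 / 100 * d \<le> real (card (hits \<omega> {x} {1..n} {1..3 * n div 5}))}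
      \<le> 1 / real n ^ 2" if x: "x \<in> {1..n}" for x
  proof -
    \<comment> \<open>Rounding 3n/5 down is paid for by 199/1000 in place of 1/5. The value 4/100 of
      \<open>\<theta>\<close> is close to the optimal 9/199.\<close>
    have "3 * n \<le> 5 * (3 * n div 5) + 4" by linarith
    then have r: "3 * real n \<le> 5 * real (3 * n div 5) + 4" by linarith
    then have "597 / 1000 * real n \<le> real (3 * n div 5)" using n(1) by linarith
    then have "597 / 1000 * real n * p \<le> real (3 * n div 5) * p" by (rule mult_right_mono[OF _ p(1)])
    then have \<mu>: "199 / 1000 * d \<le> real (card {x}) * real (card {1..n}) * (p * real (card {1..3 * n div 5}) / (3 * real n))"
      using n0 by (simp add: field_simps)
    have "pr {\<omega>. \<not> 19 / 100 * d \<le> real (card (hits \<omega> {x} {1..n} {1..3 * n div 5}))} \<le>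
        pr {\<omega>. real (card (hits \<omega> {x} {1..n} {1..3 * n div 5})) \<le> 19 / 100 * d}"
      by (rule prob_mono) simp
    also have "\<dots> \<le> exp (4 / 100 * (19 / 100 * d) - (4 / 100 - (4 / 100)\<^sup>2 / 2) * (199 / 1000 * d))"
      by (rule hits_lower_tail[OF p n0 _ _ _ _ _ \<mu>]) (use x p in auto)
    also have "\<dots> \<le> exp (- (real 2 * ln (real n)))"
      using degree_large n(2) unfolding num exp_le_cancel_iff of_nat_numeral by linarith
    also have "\<dots> = 1 / real n ^ 2" by (rule exp_ln_n)
    finally show ?thesis .
  qed
  have "?p \<le> (\<Sum>x\<in>{1..n}. 1 / real n ^ 2)"
    using single by (intro prob_Ex_le) auto
  also have "\<dots> = 1 / real n" using n0 by (simp add: power2_eq_square)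
  finally show ?thesis .
qed

text \<open>The mean is at least 9/20 * 9/20 * d a. The choice of \<open>slack\<close> gives d a >=
  100000 n, so the tail beats the number 2^(5n) of triples.\<close>

lemma prob_many_between:
  "pr {\<omega>. \<exists>A\<in>Pow {1..n}. \<exists>B\<in>Pow {1..n}. \<exists>C\<in>Pow {1..3 * n}.
    slack n \<le> real (card A) \<and> 9 / 20 * real n \<le> real (card B) \<and> 27 / 20 * real n \<le> real (card C) \<and>
    \<not> 18 / 100 * d * real (card A) \<le> real (card (hits \<omega> A B C))} \<le> 1 / real n"
    (is "?p \<le> _")
proof -
  have single: "pr {\<omega>. slack n \<le> real (card A) \<and> 9 / 20 * real n \<le> real (card B) \<and>
      27 / 20 * real n \<le> real (card C) \<and> \<not> 18 / 100 * d * real (card A) \<le> real (card (hits \<omega> A B C))} \<le> exp (- (6 * real n))"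
    if ABC: "A \<in> Pow {1..n}" "B \<in> Pow {1..n}" "C \<in> Pow {1..3 * n}" for A B C
  proof (cases "slack n \<le> real (card A) \<and> 9 / 20 * real n \<le> real (card B) \<and> 27 / 20 * real n \<le> real (card C)")
    case False
    then show ?thesis by auto
  next
    case True
    define a where "a = real (card A)"
    have "9 / 20 * real n * (27 / 20 * real n) \<le> real (card B) * real (card C)"
      using True by (intro mult_mono) auto
    then have "9 / 20 * real n * (27 / 20 * real n) * (a * p / (3 * real n)) \<le> real (card B) * real (card C) * (a * p / (3 * real n))"
      by (rule mult_right_mono) (use p in \<open>simp add: a_def\<close>)
    then have \<mu>: "2025 / 10000 * (d * a) \<le> real (card A) * real (card B) * (p * real (card C) / (3 * real n))"
      using n0 by (simp add: a_def ac_simps)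
    have "pr {\<omega>. slack n \<le> real (card A) \<and> 9 / 20 * real n \<le> real (card B) \<and>
        27 / 20 * real n \<le> real (card C) \<and> \<not> 18 / 100 * d * real (card A) \<le> real (card (hits \<omega> A B C))} \<le>
      pr {\<omega>. real (card (hits \<omega> A B C)) \<le> 18 / 100 * (d * a)}"
      by (rule prob_mono) (simp add: a_def)
    also have "\<dots> \<le> exp (1 / 10 * (18 / 100 * (d * a)) - (1 / 10 - (1 / 10)\<^sup>2 / 2) * (2025 / 10000 * (d * a)))"
      by (rule hits_lower_tail[OF p n0 _ _ _ _ _ \<mu>]) (use ABC p in \<open>auto simp: a_def\<close>)
    also have "\<dots> \<le> exp (- (6 * real n))"
    proof -
      have "100000000000000000 * ln (real n) * slack n \<le> d * a"
        by (rule mult_mono[OF degree_large]) (use True n p in \<open>auto simp: a_def slack_def\<close>)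
      moreover have "ln (real n) * slack n = real n / 1000000000000" unfolding slack_def using n(2) by simp
      ultimately have "100000 * real n \<le> d * a" by linarith
      moreover have "1 / 10 * (18 / 100 * x) - (1 / 10 - (1 / 10)\<^sup>2 / 2) * (2025 / 10000 * x) = - (12375 / 10000000) * x" for x :: real
        by (simp add: power2_eq_square)
      ultimately show ?thesis unfolding exp_le_cancel_iff by (simp only:)
    qed
    finally show ?thesis .
  qed
  have "?p \<le> (\<Sum>A\<in>Pow {1..n}. \<Sum>B\<in>Pow {1..n}. \<Sum>C\<in>Pow {1..3 * n}. exp (- (6 * real n)))"
    by (intro prob_Ex_le single) auto
  also have "\<dots> = 2 ^ (5 * n) * exp (- (6 * real n))"
    by (simp add: card_Pow flip: power_add)
  also have "\<dots> \<le> exp 1 ^ (5 * n) * exp (- (6 * real n))"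
    using exp_ge_add_one_self[of 1] by (intro mult_right_mono power_mono) auto
  also have "\<dots> = exp (- real n)"
    by (simp flip: exp_of_nat_mult exp_add)
  also have "\<dots> \<le> 1 / real n"
  proof -
    have "real n \<le> exp (real n)" using exp_ge_add_one_self[of "real n"] by linarith
    then show ?thesis using n0 by (simp add: exp_minus inverse_eq_divide frac_le)
  qed
  finally show ?thesis .
qed

text \<open>The first two terms count the choices of a set of size at most b, the others come from
  the tail bound. With y = n / b, the choices cost at most 80 a ln n ln y and the tail gains at
  least 5 * 10^13 a ln n ln y.\<close>

lemma sparse_exponent:
  fixes a b :: real
  assumes a: "1 \<le> a" and b: "0 < b" "b \<le> 40 * a * ln (real n)" "b \<le> real n / 100000000"
  shows "b - b * ln (b / (3 * real n)) + d * a / 1000 - d * a / 1000 * ln (real n / (1000 * b)) \<le> - (real 4 * (a * ln (real n)))"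
proof -
  define y where "y = real n / b"
  have y: "100000000 \<le> y" using b unfolding y_def by (simp add: pos_le_divide_eq)
  have e1: "ln (b / (3 * real n)) = - ln (3 * y)"
    using b n0 unfolding y_def by (simp add: ln_div ln_mult)
  have e2: "real n / (1000 * b) = y / 1000" by (simp add: y_def)
  let ?l = "ln (real n)"
  have "b * (1 + ln (3 * y)) \<le> b * (2 * ln y)" by (rule mult_left_mono[OF ln_large_bounds(3)[OF y]]) (use b in simp)
  also have "\<dots> \<le> 40 * a * ?l * (2 * ln y)" by (rule mult_right_mono[OF b(2)]) (use ln_large_bounds(1)[OF y] in simp)
  finally have s1: "b * (1 + ln (3 * y)) \<le> 80 * (a * ?l * ln y)" by simp
  have "100000000000000 * (a * ?l) \<le> d * a / 1000"
    using mult_right_mono[OF degree_large, of a] a by simp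
  then have "100000000000000 * (a * ?l) * (ln y / 2) \<le> d * a / 1000 * (ln (y / 1000) - 1)"
    by (rule mult_mono[OF _ ln_large_bounds(2)[OF y]]) (use ln_large_bounds(1)[OF y] a p in auto)
  then have s2: "50000000000000 * (a * ?l * ln y) \<le> d * a / 1000 * ln (y / 1000) - d * a / 1000"
    by (simp add: algebra_simps)
  have "a * ?l * 1 \<le> a * ?l * ln y"
    by (rule mult_left_mono[OF ln_large_bounds(1)[OF y]]) (use a n in simp)
  moreover have "0 \<le> a * ?l" using a n by simp
  ultimately show ?thesis using s1 s2 unfolding e1 e2 by (simp add: distrib_left)
qed

text \<open>One argument for ends and for colors: \<open>G\<close> is the ground set of
  \<open>B\<close>, and \<open>X\<close> counts the edges. For fixed \<open>A\<close> the union over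
  \<open>B\<close> leaves n^(-4|A|), and summing this over nonempty \<open>A\<close> gives (1 +
  n^(-4))^n - 1.\<close>

lemma prob_sparse:
  fixes X :: "(nat \<times> nat \<Rightarrow> nat option) \<Rightarrow> nat set \<Rightarrow> nat set \<Rightarrow> nat"
  assumes G: "finite G" "card G \<le> 3 * n"
    and tail: "\<And>A B z \<mu> m. A \<subseteq> {1..n} \<Longrightarrow> B \<subseteq> G \<Longrightarrow> 1 \<le> z \<Longrightarrow> real (card A) * real (card B) * p \<le> \<mu> \<Longrightarrow>
      measure_pmf.prob M {\<omega>. m \<le> real (X \<omega> A B)} \<le> exp ((z - 1) * \<mu> - m * ln z)"
  shows "measure_pmf.prob M {\<omega>. \<exists>A\<in>Pow {1..n} - {{}}. \<exists>B\<in>Pow G. real (card B) \<le> 40 * real (card A) * ln (real n) \<and>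
    real (card B) \<le> real n / 100000000 \<and> \<not> real (X \<omega> A B) < d * real (card A) / 1000} \<le> 1 / real n"
    (is "measure_pmf.prob _ {\<omega>. \<exists>A\<in>_. ?E A \<omega>} \<le> _")
proof -
  define x where "x = 1 / real n ^ 4"
  have "measure_pmf.prob M {\<omega>. ?E A \<omega>} \<le> x ^ card A"
    if A: "A \<in> Pow {1..n} - {{}}" for A
  proof -
    define a where "a = real (card A)"
    define b where "b = min (40 * a * ln (real n)) (real n / 100000000)"
    \<comment> \<open>This base turns z times the bound a b p on the mean into exactly the threshold
      \<open>?m\<close>.\<close>
    define z where "z = real n / (1000 * b)"
    let ?m = "d * a / 1000"
    have finA: "finite A" using A finite_subset by auto
    then have a: "1 \<le> a" using A by (simp add: a_def Suc_le_eq card_gt_0_iff)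
    have b: "0 < b" "b \<le> 40 * a * ln (real n)" "b \<le> real n / 100000000"
      using a n n0 by (auto simp: b_def)
    have z: "1 \<le> z" using b unfolding z_def by (simp add: pos_le_divide_eq)
    let ?S = "{B \<in> Pow G. real (card B) \<le> b}"
    have "measure_pmf.prob M {\<omega>. ?E A \<omega>} \<le>
      measure_pmf.prob M {\<omega>. \<exists>B\<in>?S. ?m \<le> real (X \<omega> A B)}"
      by (rule prob_mono) (auto simp: a_def b_def not_less)
    also have "\<dots> \<le> (\<Sum>B\<in>?S. exp (?m - ?m * ln z))"
    proof (rule prob_Ex_le)
      fix B assume B: "B \<in> ?S"
      have "real (card A) * real (card B) * p \<le> a * b * p"
        using B p a by (intro mult_right_mono mult_mono) (auto simp: a_def)
      then have "measure_pmf.prob M {\<omega>. ?m \<le> real (X \<omega> A B)} \<le> exp ((z - 1) * (a * b * p) - ?m * ln z)"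
        using A B z by (intro tail) auto
      also have "\<dots> \<le> exp (?m - ?m * ln z)"
      proof -
        have "(z - 1) * (a * b * p) \<le> z * (a * b * p)" using a b p by (intro mult_right_mono) auto
        also have "\<dots> = ?m" unfolding z_def using b by simp
        finally show ?thesis by simp
      qed
      finally show "measure_pmf.prob M {\<omega>. ?m \<le> real (X \<omega> A B)} \<le> exp (?m - ?m * ln z)" .
    qed (use G in simp)
    also have "\<dots> = real (card ?S) * exp (?m - ?m * ln z)" by simp
    also have "\<dots> \<le> exp (b / (3 * real n) * real (card G) - b * ln (b / (3 * real n))) * exp (?m - ?m * ln z)"
      by (intro mult_right_mono card_small_subsets_le[OF G(1)]) (use b n0 in \<open>auto simp: divide_le_eq\<close>)
    also have "\<dots> = exp (b / (3 * real n) * real (card G) - b * ln (b / (3 * real n)) + (?m - ?m * ln z))"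
      by (simp add: exp_add)
    also have "\<dots> \<le> exp (- (real 4 * (a * ln (real n))))"
    proof -
      have "b / (3 * real n) * real (card G) \<le> b / (3 * real n) * (3 * real n)"
        using G(2) b n0 by (intro mult_left_mono) auto
      also have "\<dots> = b" using n0 by simp
      finally show ?thesis using sparse_exponent[OF a b] by (simp add: z_def)
    qed
    also have "- (real 4 * (a * ln (real n))) = real (card A) * (- (real 4 * ln (real n)))" by (simp add: a_def)
    also have "exp \<dots> = x ^ card A" unfolding exp_of_nat_mult x_def exp_ln_n ..
    finally show ?thesis .
  qed
  then have "measure_pmf.prob M {\<omega>. \<exists>A\<in>Pow {1..n} - {{}}. ?E A \<omega>} \<le> (\<Sum>A\<in>Pow {1..n} - {{}}. x ^ card A)"
    by (intro prob_Ex_le) auto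
  also have "\<dots> = (1 + x) ^ n - 1"
    by (subst sum_diff) (auto simp: sum_Pow_power_card)
  also have "(1 + x) ^ n \<le> exp x ^ n" by (intro power_mono) (auto simp: x_def)
  also have "exp x ^ n = exp (real n * x)" by (simp add: exp_of_nat_mult)
  also have "real n * x = 1 / real n ^ 3" unfolding x_def using n0 by (simp add: power4_eq_xxxx power3_eq_cube)
  also have "exp (1 / real n ^ 3) - 1 \<le> 1 / real n"
  proof -
    define w where "w = 1 / real n"
    have w: "0 \<le> w" "w \<le> 1 / 2" using n n0 by (auto simp: w_def divide_le_eq)
    have w3: "w ^ 3 \<le> w / 2"
    proof -
      have "w * w \<le> 1 / 2 * 1" using w by (intro mult_mono) auto
      then have "w * (w * w) \<le> w * (1 / 2)" using w(1) by (intro mult_left_mono) auto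
      then show ?thesis by (simp add: power3_eq_cube mult.assoc)
    qed
    then have w31: "0 \<le> w ^ 3" "w ^ 3 \<le> 1" using w by auto
    then have "exp (w ^ 3) \<le> 1 + w ^ 3 + (w ^ 3)\<^sup>2" by (rule exp_bound)
    also have "(w ^ 3)\<^sup>2 \<le> w ^ 3" using mult_left_mono[OF w31(2,1)] by (simp only: power2_eq_square mult_1_right)
    finally show ?thesis using w3 by (simp add: w_def power_divide)
  qed
  finally show ?thesis by simp
qed

lemma prob_few_between:
  "pr {\<omega>. \<exists>A\<in>Pow {1..n} - {{}}. \<exists>B\<in>Pow {1..n}. real (card B) \<le> 40 * real (card A) * ln (real n) \<and>
    real (card B) \<le> real n / 100000000 \<and> \<not> real (card (hits \<omega> A B {1..3 * n})) < d * real (card A) / 1000} \<le> 1 / real n"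
  by (rule prob_sparse, simp, simp, rule hits_upper_tail[OF p n0]) (use n0 in auto)

lemma prob_few_colored:
  "pr {\<omega>. \<exists>A\<in>Pow {1..n} - {{}}. \<exists>C\<in>Pow {1..3 * n}. real (card C) \<le> 40 * real (card A) * ln (real n) \<and>
    real (card C) \<le> real n / 100000000 \<and> \<not> real (card (hits \<omega> A {1..n} C)) < d * real (card A) / 1000} \<le> 1 / real n"
proof (rule prob_sparse, simp, simp, rule hits_upper_tail[OF p n0])
  fix A B :: "nat set" and \<mu> :: real
  assume "real (card A) * real (card B) * p \<le> \<mu>"
  moreover have "real (card A) * real (card {1..n}) * (p * real (card B) / (3 * real n)) = real (card A) * real (card B) * p / 3"
    using n0 by simp
  moreover have "0 \<le> real (card A) * real (card B) * p" using p by simp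
  ultimately show "real (card A) * real (card {1..n}) * (p * real (card B) / (3 * real n)) \<le> \<mu>" by linarith
qed auto

lemma prob_not_quasirandom:
  "pr {\<omega>. \<not> quasirandom n d \<omega>} \<le> 5 / real n"
proof -
  let ?E1 = "\<lambda>\<omega>. \<exists>A\<in>Pow {1..n} - {{}}. \<exists>B\<in>Pow {1..n}. real (card B) \<le> 40 * real (card A) * ln (real n) \<and>
    real (card B) \<le> real n / 100000000 \<and> \<not> real (card (hits \<omega> A B {1..3 * n})) < d * real (card A) / 1000"
  let ?E2 = "\<lambda>\<omega>. \<exists>A\<in>Pow {1..n} - {{}}. \<exists>C\<in>Pow {1..3 * n}. real (card C) \<le> 40 * real (card A) * ln (real n) \<and>
    real (card C) \<le> real n / 100000000 \<and> \<not> real (card (hits \<omega> A {1..n} C)) < d * real (card A) / 1000"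
  let ?E3 = "\<lambda>\<omega>. \<exists>A\<in>Pow {1..n}. \<exists>B\<in>Pow {1..n}. \<exists>C\<in>Pow {1..3 * n}.
    slack n \<le> real (card A) \<and> 9 / 20 * real n \<le> real (card B) \<and> 27 / 20 * real n \<le> real (card C) \<and>
    \<not> 18 / 100 * d * real (card A) \<le> real (card (hits \<omega> A B C))"
  let ?E4 = "\<lambda>\<omega>. \<exists>y\<in>{1..n}. \<exists>c\<in>{1..3 * n}. \<not> real (card (hits \<omega> {1..n} {y} {c})) \<le> d / (200000000000000 * ln (real n))"
  let ?E5 = "\<lambda>\<omega>. \<exists>x\<in>{1..n}. \<not> 19 / 100 * d \<le> real (card (hits \<omega> {x} {1..n} {1..3 * n div 5}))"
  have "1000000 \<le> d" using degree_large n by linarith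
  have "quasirandom n d \<omega>" if "\<not> (?E1 \<omega> \<or> ?E2 \<omega> \<or> ?E3 \<omega> \<or> ?E4 \<omega> \<or> ?E5 \<omega>)" for \<omega>
  proof -
    have "\<not> ?E1 \<omega>" "\<not> ?E2 \<omega>" "\<not> ?E3 \<omega>" "\<not> ?E4 \<omega>" "\<not> ?E5 \<omega>" using that by blast+
    then show ?thesis by (intro quasirandom.intro n \<open>1000000 \<le> d\<close>) blast+
  qed
  then have "pr {\<omega>. \<not> quasirandom n d \<omega>} \<le>
      pr {\<omega>. ?E1 \<omega> \<or> ?E2 \<omega> \<or> ?E3 \<omega> \<or> ?E4 \<omega> \<or> ?E5 \<omega>}"
    by (intro prob_mono) blast
  also have "\<dots> \<le> 1 / real n + (1 / real n + (1 / real n + (1 / real n + 1 / real n)))"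
    by (intro order_trans[OF prob_disj_le] add_mono prob_few_between prob_few_colored prob_many_between
      prob_few_monochromatic prob_reserved_degree)
  finally show ?thesis by simp
qed

end

section \<open>Exposing the unreserved edges first\<close>

lemma edge_colors_swap: "map_pmf (\<lambda>\<omega>. \<omega> \<circ> prod.swap) (edge_colors n p) = edge_colors n p"
proof -
  have "bij_betw prod.swap ({1..n} \<times> {1..n}) ({1..n} \<times> {1..n})"
    by (intro bij_betwI[of _ _ _ prod.swap]) auto
  then show ?thesis
    unfolding edge_colors_def by (intro Pi_pmf_bij_betw[symmetric]) auto
qed

lemma prob_swap:
  "measure_pmf.prob (edge_colors n p) {\<omega>. P (\<omega> \<circ> prod.swap)} = measure_pmf.prob (edge_colors n p) {\<omega>. P \<omega>}"
proof -
  have "measure_pmf.prob (map_pmf (\<lambda>\<omega>. \<omega> \<circ> prod.swap) (edge_colors n p)) {\<omega>. P \<omega>} =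
      measure_pmf.prob (edge_colors n p) {\<omega>. P (\<omega> \<circ> prod.swap)}"
    by (simp add: vimage_def)
  then show ?thesis by (simp only: edge_colors_swap)
qed

lemma prob_bind_le:
  fixes c :: real
  assumes "\<And>x. x \<in> set_pmf M \<Longrightarrow> measure_pmf.prob (N x) X \<le> c" "0 \<le> c"
  shows "measure_pmf.prob (bind_pmf M N) X \<le> c"
proof -
  have "emeasure (measure_pmf (bind_pmf M N)) X = (\<integral>\<^sup>+x. emeasure (measure_pmf (N x)) X \<partial>measure_pmf M)" by simp
  also have "\<dots> \<le> (\<integral>\<^sup>+x. ennreal c \<partial>measure_pmf M)"
    using assms by (intro nn_integral_mono_AE) (auto simp: AE_measure_pmf_iff measure_pmf.emeasure_eq_measure intro!: ennreal_leI)
  also have "\<dots> = ennreal c" by simp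
  finally show ?thesis using assms(2) by (simp add: measure_pmf.emeasure_eq_measure)
qed

lemma prob_not:
  "measure_pmf.prob M {\<omega>. \<not> P \<omega>} = 1 - measure_pmf.prob M {\<omega>. P \<omega>}"
proof -
  have "{\<omega>. \<not> P \<omega>} = UNIV - {\<omega>. P \<omega>}" by auto
  then show ?thesis using measure_pmf.prob_compl[of "{\<omega>. P \<omega>}" M] by simp
qed

lemma set_Pi_pmfD:
  assumes "finite A" "f \<in> set_pmf (Pi_pmf A dflt Q)"
  shows "e \<in> A \<Longrightarrow> f e \<in> set_pmf (Q e)" "e \<notin> A \<Longrightarrow> f e = dflt"
  using assms by (auto simp: set_Pi_pmf PiE_dflt_def)

definition unreserve :: "nat \<Rightarrow> nat option \<Rightarrow> nat option" where
  "unreserve n v = (if v \<in> Some ` {..3 * n div 5} then None else v)"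

lemma unreserved_eq: "unreserved n \<omega> e = unreserve n (\<omega> e)"
  by (simp add: unreserved_def unreserve_def)

text \<open>The second stage: the law of a color conditioned on what the first stage has shown of
  it.\<close>

definition recolored_edge :: "nat \<Rightarrow> real \<Rightarrow> nat option \<Rightarrow> nat option pmf" where
  "recolored_edge n p a = cond_pmf (colored_edge (3 * n) p) {v. a = unreserve n v}"

lemma set_unreserved_edge:
  assumes "a \<in> set_pmf (map_pmf (unreserve n) (colored_edge (3 * n) p))"
  shows "set_pmf (colored_edge (3 * n) p) \<inter> {v. a = unreserve n v} \<noteq> {}"
  using assms by auto

lemma bind_recolored_edge:
  "bind_pmf (map_pmf (unreserve n) (colored_edge (3 * n) p)) (recolored_edge n p) = colored_edge (3 * n) p"
  unfolding recolored_edge_def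
proof (rule bind_cond_pmf_cancel)
  let ?q = "colored_edge (3 * n) p"
  fix x y
  assume "x \<in> set_pmf (map_pmf (unreserve n) ?q)" "y \<in> set_pmf ?q" "x = unreserve n y"
  then show "measure (measure_pmf ?q) {y. x = unreserve n y} = measure (measure_pmf (map_pmf (unreserve n) ?q)) {x. x = unreserve n y}"
    by (simp add: vimage_def eq_commute)
qed auto

text \<open>Since each edge is exposed in two stages separately, the edges remain independent when
  the first stage \<open>\<alpha>\<close> is fixed.\<close>

lemma edge_colors_bind:
  "edge_colors n p = bind_pmf (Pi_pmf ({1..n} \<times> {1..n}) None (\<lambda>_. map_pmf (unreserve n) (colored_edge (3 * n) p)))
    (\<lambda>\<alpha>. Pi_pmf ({1..n} \<times> {1..n}) None (\<lambda>e. recolored_edge n p (\<alpha> e)))"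
  unfolding edge_colors_def by (subst Pi_pmf_bind[symmetric]) (simp_all add: bind_recolored_edge)

lemma unreserved_recolored:
  assumes \<alpha>: "\<alpha> \<in> set_pmf (Pi_pmf ({1..n} \<times> {1..n}) None (\<lambda>_. map_pmf (unreserve n) (colored_edge (3 * n) p)))"
    and \<omega>: "\<omega> \<in> set_pmf (Pi_pmf ({1..n} \<times> {1..n}) None (\<lambda>e. recolored_edge n p (\<alpha> e)))"
  shows "unreserved n \<omega> = \<alpha>"
proof
  fix e
  have fin: "finite ({1..n} \<times> {1..n})" by simp
  show "unreserved n \<omega> e = \<alpha> e"
  proof (cases "e \<in> {1..n} \<times> {1..n}")
    case True
    have a: "\<alpha> e \<in> set_pmf (map_pmf (unreserve n) (colored_edge (3 * n) p))"
      by (rule set_Pi_pmfD(1)[OF fin \<alpha> True])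
    have "\<omega> e \<in> set_pmf (recolored_edge n p (\<alpha> e))"
      by (rule set_Pi_pmfD(1)[OF fin \<omega> True])
    then show ?thesis
      unfolding recolored_edge_def using set_cond_pmf[OF set_unreserved_edge[OF a]] by (simp add: unreserved_eq)
  next
    case False
    then have "\<alpha> e = None" "\<omega> e = None"
      using set_Pi_pmfD(2)[OF fin \<alpha>] set_Pi_pmfD(2)[OF fin \<omega>] by blast+
    then show ?thesis by (simp add: unreserved_def)
  qed
qed

lemma set_colored_edge: "0 < c \<Longrightarrow> set_pmf (colored_edge c p) \<subseteq> insert None (Some ` {1..c})"
  unfolding colored_edge_def by (auto simp: set_pmf_of_set split: if_splits)

text \<open>If the first stage shows a color, the probability is 0. Otherwise, with
  \<open>\<rho>\<close> the share of reserved colors, it is p \<open>\<rho>\<close> / (1 - p (1 -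
  \<open>\<rho>\<close>)), and this is at most p because (1 - p) (1 - \<open>\<rho>\<close>) >=
  0.\<close>

lemma prob_recolored_edge_le:
  assumes p: "0 \<le> p" "p \<le> 1" and n: "0 < n"
    and a: "a \<in> set_pmf (map_pmf (unreserve n) (colored_edge (3 * n) p))"
  shows "measure_pmf.prob (recolored_edge n p a) (Some ` {1..3 * n div 5}) \<le> p"
proof -
  let ?q = "colored_edge (3 * n) p" and ?T = "Some ` {1..3 * n div 5}" and ?S = "{v. a = unreserve n v}"
  have ne: "set_pmf ?q \<inter> ?S \<noteq> {}" by (rule set_unreserved_edge[OF a])
  then obtain v where "v \<in> set_pmf ?q \<inter> ?S" by (metis ex_in_conv)
  then have pos: "0 < measure_pmf.prob ?q ?S" by (intro measure_pmf_posI[of v]) simp_all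
  have cond: "measure_pmf.prob (recolored_edge n p a) ?T = measure_pmf.prob ?q (?S \<inter> ?T) / measure_pmf.prob ?q ?S"
    unfolding recolored_edge_def cond_pmf.rep_eq[OF ne]
    using pos by (subst measure_uniform_measure) (auto simp: measure_pmf.emeasure_eq_measure)
  show ?thesis
  proof (cases "a = None")
    case False
    then have "?S \<inter> ?T = {}" by (auto simp: unreserve_def)
    then show ?thesis unfolding cond using p by simp
  next
    case True
    define \<rho> where "\<rho> = real (3 * n div 5) / real (3 * n)"
    have \<rho>: "0 \<le> \<rho>" "\<rho> \<le> 1" using n by (auto simp: \<rho>_def divide_le_eq)
    have S: "- ?S = Some ` {3 * n div 5<..}"
    proof (rule set_eqI)
      show "v \<in> - ?S \<longleftrightarrow> v \<in> Some ` {3 * n div 5<..}" for v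
        by (cases v) (auto simp: True unreserve_def inj_image_mem_iff)
    qed
    have "measure_pmf.prob ?q (- ?S) = measure_pmf.prob ?q (- ?S \<inter> set_pmf ?q)" by (simp add: measure_Int_set_pmf)
    also have "\<dots> \<le> measure_pmf.prob ?q (Some ` {3 * n div 5<..3 * n})"
      using set_colored_edge[of "3 * n" p] n unfolding S by (intro measure_pmf.finite_measure_mono) auto
    also have "\<dots> = p * real (card {3 * n div 5<..3 * n}) / real (3 * n)"
      by (rule prob_colored_edge[OF p]) (use n in auto)
    also have "\<dots> = p * (1 - \<rho>)"
      using n by (simp add: \<rho>_def of_nat_diff field_simps)
    finally have "1 - p * (1 - \<rho>) \<le> measure_pmf.prob ?q ?S"
      using measure_pmf.prob_compl[of ?S ?q] by (simp add: Compl_eq_Diff_UNIV)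
    have "measure_pmf.prob ?q (?S \<inter> ?T) \<le> measure_pmf.prob ?q ?T" by (rule measure_pmf.finite_measure_mono) auto
    also have "\<dots> = p * \<rho>"
      using prob_colored_edge[OF p, of "3 * n" "{1..3 * n div 5}"] n by (simp add: \<rho>_def)
    also have "\<dots> \<le> p * (1 - p * (1 - \<rho>))"
    proof (rule mult_left_mono[OF _ p(1)])
      have "0 \<le> (1 - p) * (1 - \<rho>)" using p \<rho> by simp
      then show "\<rho> \<le> 1 - p * (1 - \<rho>)" by (simp add: algebra_simps)
    qed
    also have "\<dots> \<le> p * measure_pmf.prob ?q ?S"
      by (rule mult_left_mono[OF _ p(1)]) fact
    finally show ?thesis unfolding cond using pos by (simp add: divide_le_eq)
  qed
qed

text \<open>A function of the first stage \<open>\<alpha>\<close>, so its uncovered sets are fixed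
  while the second stage is still random.\<close>

definition chosen_family :: "nat \<Rightarrow> nat \<Rightarrow> (nat \<times> nat \<Rightarrow> nat option) \<Rightarrow> nat \<Rightarrow> (nat \<times> nat) set" where
  "chosen_family n t \<alpha> = (SOME M. near_perfect_family n t \<alpha> M)"

text \<open>The size of the uncovered sets is part of the event because \<open>chosen_family\<close>
  is arbitrary where no family exists, and the tail bound needs small sets.\<close>

definition crowded :: "nat \<Rightarrow> real \<Rightarrow> nat \<Rightarrow> (nat \<times> nat \<Rightarrow> nat option) \<Rightarrow> (nat \<times> nat \<Rightarrow> nat option) \<Rightarrow> bool" where
  "crowded n d t \<alpha> \<omega> \<longleftrightarrow> (\<exists>i\<in>{..<t}. \<exists>x\<in>{1..n}.
    (real (card ({1..n} - snd ` chosen_family n t \<alpha> i)) \<le> slack n \<and>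
      d / 1000 \<le> real (card (hits \<omega> {x} ({1..n} - snd ` chosen_family n t \<alpha> i) {1..3 * n div 5}))) \<or>
    (real (card ({1..n} - fst ` chosen_family n t \<alpha> i)) \<le> slack n \<and>
      d / 1000 \<le> real (card (hits \<omega> ({1..n} - fst ` chosen_family n t \<alpha> i) {x} {1..3 * n div 5}))))"

context large_parameters
begin

lemma recolored_tail:
  assumes \<alpha>: "\<alpha> \<in> set_pmf (Pi_pmf ({1..n} \<times> {1..n}) None (\<lambda>_. map_pmf (unreserve n) (colored_edge (3 * n) p)))"
    and AB: "A \<subseteq> {1..n}" "B \<subseteq> {1..n}" "real (card A) * real (card B) \<le> slack n"
  shows "measure_pmf.prob (Pi_pmf ({1..n} \<times> {1..n}) None (\<lambda>e. recolored_edge n p (\<alpha> e)))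
    {\<omega>. d / 1000 \<le> real (card (hits \<omega> A B {1..3 * n div 5}))} \<le> 1 / real n ^ 4"
proof -
  let ?E = "{1..n} \<times> {1..n}" and ?T = "Some ` {1..3 * n div 5}"
  let ?S = "\<lambda>e. if e \<in> A \<times> B then ?T else {}"
  have a: "\<alpha> e \<in> set_pmf (map_pmf (unreserve n) (colored_edge (3 * n) p))" if "e \<in> ?E" for e
    by (rule set_Pi_pmfD(1)[OF _ \<alpha> that]) simp
  have "(\<Sum>e\<in>?E. measure_pmf.prob (recolored_edge n p (\<alpha> e)) (?S e)) =
      (\<Sum>e\<in>A \<times> B. measure_pmf.prob (recolored_edge n p (\<alpha> e)) ?T)"
    using AB by (intro sum.mono_neutral_cong_right) auto
  also have "\<dots> \<le> real (card (A \<times> B)) * p"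
    using AB by (intro sum_bounded_above prob_recolored_edge_le[OF p n0 a]) auto
  also have "\<dots> \<le> slack n * p"
    using AB(3) p by (intro mult_right_mono) (auto simp: card_cartesian_product)
  finally have \<mu>: "(\<Sum>e\<in>?E. measure_pmf.prob (recolored_edge n p (\<alpha> e)) (?S e)) \<le> slack n * p" .
  \<comment> \<open>The mean is at most d / 10^12. With base 10^6 its term costs only d / 10^6,
    while each of the d / 1000 edges gains ln (10^6) >= 6.\<close>
  have "measure_pmf.prob (Pi_pmf ?E None (\<lambda>e. recolored_edge n p (\<alpha> e))) {\<omega>. d / 1000 \<le> real (card (hits \<omega> A B {1..3 * n div 5}))}
      \<le> exp ((1000000 - 1) * (slack n * p) - d / 1000 * ln 1000000)"
    unfolding hits_eq[OF AB(1,2)] by (rule upper_tail[OF _ _ \<mu>]) auto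
  also have "\<dots> \<le> exp (- (real 4 * ln (real n)))"
  proof -
    have "real n / (1000000000000 * ln (real n)) \<le> real n / 1000000000000"
      using n by (intro divide_left_mono) auto
    then have "slack n * p \<le> real n / 1000000000000 * p" unfolding slack_def by (rule mult_right_mono[OF _ p(1)])
    then have s: "slack n * p \<le> d / 1000000000000" by simp
    have "ln 1000000 = 6 * ln (10 :: real)" using ln_realpow[of 10 6] by simp
    then have "6 \<le> ln (1000000 :: real)" using one_le_ln_10 by linarith
    then have "d / 1000 * 6 \<le> d / 1000 * ln 1000000" using p by (intro mult_left_mono) auto
    moreover have "(1000000 - 1) * (slack n * p) = 999999 * (slack n * p)" "0 \<le> d" using p by simp_all
    ultimately have "(1000000 - 1) * (slack n * p) - d / 1000 * ln 1000000 \<le> 1 / 1000000 * d - 6 / 1000 * d" using s by linarith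
    also have "\<dots> \<le> - (real 4 * ln (real n))" using degree_large n(2) unfolding of_nat_numeral by linarith
    finally show ?thesis by simp
  qed
  also have "\<dots> = 1 / real n ^ 4" by (rule exp_ln_n)
  finally show ?thesis .
qed

lemma prob_crowded:
  assumes t: "t \<le> n"
  shows "measure_pmf.prob (edge_colors n p) {\<omega>. crowded n d t (unreserved n \<omega>) \<omega>} \<le> 1 / real n"
  unfolding edge_colors_bind
proof (rule prob_bind_le)
  fix \<alpha>
  assume \<alpha>: "\<alpha> \<in> set_pmf (Pi_pmf ({1..n} \<times> {1..n}) None (\<lambda>_. map_pmf (unreserve n) (colored_edge (3 * n) p)))"
  let ?P = "Pi_pmf ({1..n} \<times> {1..n}) None (\<lambda>e. recolored_edge n p (\<alpha> e))"
  define U where "U i = {1..n} - snd ` chosen_family n t \<alpha> i" for i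
  define U' where "U' i = {1..n} - fst ` chosen_family n t \<alpha> i" for i
  have "measure_pmf.prob ?P {\<omega>. crowded n d t (unreserved n \<omega>) \<omega>} =
      measure_pmf.prob ?P ({\<omega>. crowded n d t (unreserved n \<omega>) \<omega>} \<inter> set_pmf ?P)"
    by (simp only: measure_Int_set_pmf)
  also have "\<dots> \<le> measure_pmf.prob ?P {\<omega>. crowded n d t \<alpha> \<omega>}"
    by (rule measure_pmf.finite_measure_mono) (use unreserved_recolored[OF \<alpha>] in auto)
  also have "\<dots> \<le> (\<Sum>i\<in>{..<t}. \<Sum>x\<in>{1..n}. 1 / real n ^ 4 + 1 / real n ^ 4)"
    unfolding crowded_def
  proof (intro prob_Ex_le order_trans[OF prob_disj_le] add_mono)
    fix i x assume "i \<in> {..<t}" "x \<in> {1..n}"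
    show "measure_pmf.prob ?P {\<omega>. real (card ({1..n} - snd ` chosen_family n t \<alpha> i)) \<le> slack n \<and>
      d / 1000 \<le> real (card (hits \<omega> {x} ({1..n} - snd ` chosen_family n t \<alpha> i) {1..3 * n div 5}))} \<le> 1 / real n ^ 4"
    proof (cases "real (card (U i)) \<le> slack n")
      case True
      then show ?thesis
        using recolored_tail[OF \<alpha>, of "{x}" "U i"] \<open>x \<in> {1..n}\<close> by (simp add: U_def)
    qed (simp add: U_def)
    show "measure_pmf.prob ?P {\<omega>. real (card ({1..n} - fst ` chosen_family n t \<alpha> i)) \<le> slack n \<and>
      d / 1000 \<le> real (card (hits \<omega> ({1..n} - fst ` chosen_family n t \<alpha> i) {x} {1..3 * n div 5}))} \<le> 1 / real n ^ 4"
    proof (cases "real (card (U' i)) \<le> slack n")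
      case True
      then show ?thesis
        using recolored_tail[OF \<alpha>, of "U' i" "{x}"] \<open>x \<in> {1..n}\<close> by (simp add: U'_def)
    qed (simp add: U'_def)
  qed auto
  also have "\<dots> = real t * (2 / real n ^ 3)" using n0 by (simp add: power4_eq_xxxx power3_eq_cube)
  also have "\<dots> \<le> real n * (2 / real n ^ 3)" using t by (intro mult_right_mono) auto
  also have "\<dots> = 2 / real n / real n" using n0 by (simp add: power3_eq_cube)
  also have "\<dots> \<le> 1 / real n" using n by (intro divide_right_mono) auto
  finally show "measure_pmf.prob ?P {\<omega>. crowded n d t (unreserved n \<omega>) \<omega>} \<le> 1 / real n" .
qed simp

lemma prob_disjoint_perfect_rainbow:
  assumes t: "real t \<le> d / 6 + 1"
  shows "1 - 11 / real n \<le> measure_pmf.prob (edge_colors n p)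
    {\<omega>. \<exists>N. \<forall>i<t. perfect_rainbow n \<omega> (N i) \<and> (\<forall>j<i. N i \<inter> N j = {})}"
proof -
  let ?P = "edge_colors n p" and ?C = "\<lambda>\<omega>. chosen_family n t (unreserved n \<omega>)"
  let ?bad = "\<lambda>\<omega>. crowded n d t (unreserved n \<omega>) \<omega>"
  let ?good = "\<lambda>\<omega>. \<exists>N. \<forall>i<t. perfect_rainbow n \<omega> (N i) \<and> (\<forall>j<i. N i \<inter> N j = {})"
  have "d \<le> real n" using mult_left_mono[OF p(2), of "real n"] by simp
  then have tn: "t \<le> n" using t n by linarith
  have good: "?good \<omega>" if \<omega>: "quasirandom n d \<omega>" "quasirandom n d (\<omega> \<circ> prod.swap)" "\<not> ?bad \<omega>" for \<omega>
  proof -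
    obtain M where "near_perfect_family n t \<omega> M" using near_perfect_family_exists[OF \<omega>(1,2) t] by blast
    then have "near_perfect_family n t (unreserved n \<omega>) M" by (simp only: near_perfect_family_unreserved)
    then have "near_perfect_family n t (unreserved n \<omega>) (?C \<omega>)"
      unfolding chosen_family_def by (rule someI[of "near_perfect_family n t (unreserved n \<omega>)"])
    then have fam: "near_perfect_family n t \<omega> (?C \<omega>)" by (simp only: near_perfect_family_unreserved)
    have U: "real (card ({1..n} - snd ` ?C \<omega> i)) \<le> slack n" "real (card ({1..n} - fst ` ?C \<omega> i)) \<le> slack n" if "i < t" for i
    proof -
      have M: "?C \<omega> i \<subseteq> {1..n} \<times> {1..n}" "inj_on fst (?C \<omega> i)" "inj_on snd (?C \<omega> i)" "real n - slack n < real (card (?C \<omega> i))"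
        using fam \<open>i < t\<close> unfolding near_perfect_family_def by blast+
      have fin: "finite (?C \<omega> i)" using M(1) finite_subset by blast
      have sub: "fst ` ?C \<omega> i \<subseteq> {1..n}" "snd ` ?C \<omega> i \<subseteq> {1..n}" using M(1) by auto
      have "card (?C \<omega> i) \<le> n" using card_mono[OF _ sub(1)] card_image[OF M(2)] by simp
      then show "real (card ({1..n} - snd ` ?C \<omega> i)) \<le> slack n" "real (card ({1..n} - fst ` ?C \<omega> i)) \<le> slack n"
        using card_Diff_subset[OF finite_imageI[OF fin] sub(1)] card_Diff_subset[OF finite_imageI[OF fin] sub(2)]
          card_image[OF M(2)] card_image[OF M(3)] M(4) by (simp_all add: of_nat_diff)
    qed
    show ?thesis
    proof (rule disjoint_perfect_rainbow_matchings[OF \<omega>(1,2) t fam])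
      show "real (card (hits \<omega> {x} ({1..n} - snd ` ?C \<omega> i) {1..3 * n div 5})) \<le> d / 1000" if "i < t" "x \<in> {1..n}" for i x
        using \<omega>(3) U[OF that(1)] that unfolding crowded_def by (meson lessThan_iff linear)
      show "real (card (hits (\<omega> \<circ> prod.swap) {x} ({1..n} - fst ` ?C \<omega> i) {1..3 * n div 5})) \<le> d / 1000" if "i < t" "x \<in> {1..n}" for i x
        unfolding card_hits_swap using \<omega>(3) U[OF that(1)] that unfolding crowded_def by (meson lessThan_iff linear)
    qed
  qed
  have "measure_pmf.prob ?P {\<omega>. \<not> ?good \<omega>} \<le>
      measure_pmf.prob ?P {\<omega>. \<not> quasirandom n d \<omega> \<or> \<not> quasirandom n d (\<omega> \<circ> prod.swap) \<or> ?bad \<omega>}"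
    by (rule prob_mono) (use good in blast)
  \<comment> \<open>5/n for quasirandomness in each orientation and 1/n for crowding.\<close>
  also have "\<dots> \<le> 5 / real n + (5 / real n + 1 / real n)"
    by (intro order_trans[OF prob_disj_le] add_mono prob_not_quasirandom prob_crowded[OF tn]
      order_trans[OF eq_refl[OF prob_swap[where P = "\<lambda>\<omega>. \<not> quasirandom n d \<omega>"]] prob_not_quasirandom])
  finally have "measure_pmf.prob ?P {\<omega>. \<not> ?good \<omega>} \<le> 11 / real n" by (simp add: add_divide_distrib[symmetric])
  moreover have "measure_pmf.prob ?P {\<omega>. \<not> ?good \<omega>} = 1 - measure_pmf.prob ?P {\<omega>. ?good \<omega>}"
    by (rule prob_not)
  ultimately show ?thesis by linarith
qed

end

section \<open>The random edge-colored graph\<close>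

definition bipartite_edge :: "nat \<times> nat \<Rightarrow> (nat + nat) set" where
  "bipartite_edge e = {Inl (fst e), Inr (snd e)}"

lemma inj_bipartite_edge: "inj bipartite_edge"
  by (auto simp: inj_def bipartite_edge_def doubleton_eq_iff prod_eq_iff)

lemma edges_complete_bipartite: "snd (complete_bipartite n n) = bipartite_edge ` ({1..n} \<times> {1..n})"
  by (force simp: complete_bipartite_def bipartite_edge_def)

lemma random_colored_graph_eq:
  assumes "finite (snd F)"
  shows "random_colored_graph c F p = map_pmf (Pair (fst F)) (Pi_pmf (snd F) None (\<lambda>_. colored_edge c p))"
proof -
  have "Pi_pmf (snd F) None (\<lambda>_. colored_edge c p) =
      bind_pmf (Pi_pmf (snd F) False (\<lambda>_. bernoulli_pmf p)) (\<lambda>kept. Pi_pmf (snd F) None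
        (\<lambda>e. if kept e then map_pmf Some (pmf_of_set {1..c}) else return_pmf None))"
    unfolding colored_edge_def by (rule Pi_pmf_bind[OF assms])
  also have "\<dots> = bind_pmf (Pi_pmf (snd F) False (\<lambda>_. bernoulli_pmf p)) (\<lambda>kept. Pi_pmf {e \<in> snd F. kept e} None
        (\<lambda>_. map_pmf Some (pmf_of_set {1..c})))"
    by (simp add: Pi_pmf_if_set[OF assms])
  finally show ?thesis by (simp add: random_colored_graph_def map_bind_pmf)
qed

lemma edge_colors_eq:
  "edge_colors n p = map_pmf (\<lambda>\<kappa>. \<kappa> \<circ> bipartite_edge) (Pi_pmf (snd (complete_bipartite n n)) None (\<lambda>_. colored_edge (3 * n) p))"
  unfolding edge_colors_def edges_complete_bipartite
proof (rule Pi_pmf_bij_betw)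
  show "bij_betw bipartite_edge ({1..n} \<times> {1..n}) (bipartite_edge ` ({1..n} \<times> {1..n}))"
    using inj_bipartite_edge by (auto simp: bij_betw_def intro: inj_on_subset)
qed (use inj_bipartite_edge in \<open>auto simp: inj_image_mem_iff\<close>)

lemma perfect_rainbow_imp:
  assumes N: "perfect_rainbow n (\<kappa> \<circ> bipartite_edge) N"
  defines "G \<equiv> (fst (complete_bipartite n n), \<kappa>)"
  shows "perfect_matching (underlying_graph G) (bipartite_edge ` N)" "rainbow G (bipartite_edge ` N)"
proof -
  have N': "inj_on fst N" "inj_on snd N" "inj_on (\<kappa> \<circ> bipartite_edge) N" "fst ` N = {1..n}" "snd ` N = {1..n}"
    "(\<kappa> \<circ> bipartite_edge) ` N \<subseteq> Some ` {1..3 * n}"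
    using N unfolding perfect_rainbow_def by blast+
  show "rainbow G (bipartite_edge ` N)"
    unfolding rainbow_def G_def by (simp add: inj_on_imageI[OF N'(3)])
  have "bipartite_edge ` N \<subseteq> dom \<kappa>" using N'(6) by (force simp: dom_def)
  moreover have "\<exists>!e. e \<in> bipartite_edge ` N \<and> v \<in> e" if v: "v \<in> fst (complete_bipartite n n)" for v
  proof -
    have unique: "\<exists>!e. e \<in> bipartite_edge ` N \<and> v \<in> e"
      if f: "inj_on f N" "k \<in> f ` N" "\<And>e. v \<in> bipartite_edge e \<longleftrightarrow> f e = k" for f :: "nat \<times> nat \<Rightarrow> nat" and k
    proof -
      obtain e where e: "e \<in> N" "f e = k" using f(2) by blast
      show ?thesis
      proof (rule ex1I[of _ "bipartite_edge e"])
        show "bipartite_edge e \<in> bipartite_edge ` N \<and> v \<in> bipartite_edge e" using e f(3) by blast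
        fix g assume "g \<in> bipartite_edge ` N \<and> v \<in> g"
        then obtain e' where "e' \<in> N" "g = bipartite_edge e'" "f e' = k" using f(3) by blast
        then show "g = bipartite_edge e" using f(1) e by (metis inj_onD)
      qed
    qed
    consider i where "i \<in> {1..n}" "v = Inl i" | j where "j \<in> {1..n}" "v = Inr j"
      using v by (auto simp: complete_bipartite_def)
    then show ?thesis
    proof cases
      case 1
      then show ?thesis using N'(4) by (intro unique[OF N'(1)]) (auto simp: bipartite_edge_def)
    next
      case 2
      then show ?thesis using N'(5) by (intro unique[OF N'(2)]) (auto simp: bipartite_edge_def)
    qed
  qed
  ultimately show "perfect_matching (underlying_graph G) (bipartite_edge ` N)"
    by (simp add: perfect_matching_def underlying_graph_def G_def)
qed

lemma has_disjoint_rainbow_perfect_matchingsI: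
  assumes N: "\<And>i. i < t \<Longrightarrow> perfect_rainbow n (\<kappa> \<circ> bipartite_edge) (N i)" "\<And>i j. j < i \<Longrightarrow> i < t \<Longrightarrow> N i \<inter> N j = {}"
    and n: "0 < n" and b: "b \<le> real t"
  shows "has_disjoint_rainbow_perfect_matchings (fst (complete_bipartite n n), \<kappa>) b"
proof -
  let ?M = "\<lambda>i. bipartite_edge ` N i"
  have disj: "?M i \<inter> ?M j = {}" if "i < t" "j < t" "i \<noteq> j" for i j
  proof -
    have "N i \<inter> N j = {}"
      using that N(2)[of j i] N(2)[of i j] by (metis Int_commute linorder_neqE_nat)
    then show ?thesis using image_Int[OF inj_bipartite_edge, of "N i" "N j"] by simp
  qed
  have ne: "?M i \<noteq> {}" if "i < t" for i
    using N(1)[OF that] n unfolding perfect_rainbow_def by auto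
  \<comment> \<open>Disjoint nonempty matchings are distinct, so the set of them has
    \<open>t\<close> elements; nonemptiness comes from \<open>0 < n\<close>.\<close>
  have "inj_on ?M {..<t}"
  proof (rule inj_onI, rule ccontr)
    fix i j assume "i \<in> {..<t}" "j \<in> {..<t}" "?M i = ?M j" "i \<noteq> j"
    then show False using disj[of i j] ne[of i] by simp
  qed
  then have "card (?M ` {..<t}) = t" by (simp add: card_image)
  moreover have "disjoint (?M ` {..<t})"
  proof (rule disjointI)
    fix A B assume "A \<in> ?M ` {..<t}" "B \<in> ?M ` {..<t}" "A \<noteq> B"
    then show "A \<inter> B = {}" using disj by auto
  qed
  ultimately show ?thesis
    unfolding has_disjoint_rainbow_perfect_matchings_def using perfect_rainbow_imp[OF N(1)] b
    by (intro exI[of _ "?M ` {..<t}"]) auto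
qed

theorem (in large_parameters) prob_has_disjoint_rainbow_perfect_matchings:
  "1 - 11 / real n \<le> measure_pmf.prob (random_colored_graph (3 * n) (complete_bipartite n n) p)
    {G. has_disjoint_rainbow_perfect_matchings G (real n * p / 6)}"
proof -
  define t where "t = nat \<lceil>d / 6\<rceil>"
  have d0: "0 \<le> d / 6" using p by simp
  have t: "real t \<le> d / 6 + 1" "d / 6 \<le> real t" unfolding t_def using d0 by linarith+
  let ?Q = "Pi_pmf (snd (complete_bipartite n n)) None (\<lambda>_. colored_edge (3 * n) p)"
  have fin: "finite (snd (complete_bipartite n n))" by (simp add: edges_complete_bipartite)
  have "1 - 11 / real n \<le> measure_pmf.prob (edge_colors n p)
    {\<omega>. \<exists>N. \<forall>i<t. perfect_rainbow n \<omega> (N i) \<and> (\<forall>j<i. N i \<inter> N j = {})}"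
    by (rule prob_disjoint_perfect_rainbow[OF t(1)])
  also have "\<dots> = measure_pmf.prob ?Q
    {\<kappa>. \<exists>N. \<forall>i<t. perfect_rainbow n (\<kappa> \<circ> bipartite_edge) (N i) \<and> (\<forall>j<i. N i \<inter> N j = {})}"
    unfolding edge_colors_eq by (simp add: vimage_def)
  also have "\<dots> \<le> measure_pmf.prob ?Q
    {\<kappa>. has_disjoint_rainbow_perfect_matchings (fst (complete_bipartite n n), \<kappa>) (d / 6)}"
  proof (rule prob_mono)
    fix \<kappa> assume "\<exists>N. \<forall>i<t. perfect_rainbow n (\<kappa> \<circ> bipartite_edge) (N i) \<and> (\<forall>j<i. N i \<inter> N j = {})"
    then obtain N where "\<forall>i<t. perfect_rainbow n (\<kappa> \<circ> bipartite_edge) (N i) \<and> (\<forall>j<i. N i \<inter> N j = {})" by blast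
    then show "has_disjoint_rainbow_perfect_matchings (fst (complete_bipartite n n), \<kappa>) (d / 6)"
      by (intro has_disjoint_rainbow_perfect_matchingsI[OF _ _ n0 t(2)]) blast+
  qed
  also have "\<dots> = measure_pmf.prob (random_colored_graph (3 * n) (complete_bipartite n n) p)
    {G. has_disjoint_rainbow_perfect_matchings G (real n * p / 6)}"
    unfolding random_colored_graph_eq[OF fin] by (simp add: vimage_def)
  finally show ?thesis .
qed

theorem theorem1p4:
  fixes p :: "nat \<Rightarrow> real"
  assumes "\<And>n. n \<ge> 1 \<Longrightarrow> p n \<in> {0..1}"
    and "filterlim (\<lambda>n. p n * real n / ln (real n)) at_top sequentially"
  shows "\<exists>\<epsilon> :: nat \<Rightarrow> real. \<epsilon> \<longlonglongrightarrow> 0 \<and>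
    (\<lambda>n. measure_pmf.prob (random_colored_graph (3 * n) (complete_bipartite n n) (p n))
       {G. has_disjoint_rainbow_perfect_matchings G ((1 - \<epsilon> n) * (real n * p n / 6))})
    \<longlonglongrightarrow> 1"
proof (intro exI conjI)
  let ?pr = "\<lambda>n. measure_pmf.prob (random_colored_graph (3 * n) (complete_bipartite n n) (p n))
       {G. has_disjoint_rainbow_perfect_matchings G ((1 - 0) * (real n * p n / 6))}"
  \<comment> \<open>No error term is needed: the number of matchings found is d/6 rounded
    up.\<close>
  show "(\<lambda>_. 0 :: real) \<longlonglongrightarrow> 0" by simp
  have "eventually (\<lambda>n. 100000000000000000 \<le> p n * real n / ln (real n)) sequentially"
    using assms(2) by (simp add: filterlim_at_top)
  moreover have "eventually (\<lambda>n. 1000000000000000 \<le> real n) sequentially" by real_asymp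
  moreover have "eventually (\<lambda>n. 100 \<le> ln (real n)) sequentially" by real_asymp
  moreover have "eventually (\<lambda>n. 200000000000000 * ln (real n) \<le> sqrt (real n)) sequentially" by real_asymp
  ultimately have "eventually (\<lambda>n. large_parameters n (p n)) sequentially"
  proof eventually_elim
    case (elim n)
    then have "1 \<le> n" by linarith
    then have "0 \<le> p n" "p n \<le> 1" using assms(1) by auto
    moreover have "100000000000000000 * ln (real n) \<le> real n * p n"
      using elim by (simp add: pos_le_divide_eq mult.commute)
    ultimately show ?case using elim by (simp add: large_parameters_def)
  qed
  then have "eventually (\<lambda>n. 1 - 11 / real n \<le> ?pr n) sequentially"
    by eventually_elim (simp add: large_parameters.prob_has_disjoint_rainbow_perfect_matchings)
  moreover have "eventually (\<lambda>n. ?pr n \<le> 1) sequentially" by simp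
  moreover have "(\<lambda>n. 1 - 11 / real n) \<longlonglongrightarrow> 1" by real_asymp
  ultimately show "?pr \<longlonglongrightarrow> 1"
    by (rule tendsto_sandwich[OF _ _ _ tendsto_const])
qed

end
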